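(* Let $\Omega\subset\mathbb{R}^2$ be a bounded domain with boundary parameterized by a smooth regular closed curve $\gamma:[0,L]\to\mathbb{R}^2$, let $V:[0,L]\to\mathbb{R}^2$ be a smooth (periodic) deformation field, not necessarily normal, and let $\Omega_\varepsilon$ be the domain bounded by $\gamma_\varepsilon(s)=\gamma(s)+\varepsilon V(s)$. Let $u_\varepsilon$ be a (not necessarily normalized) Dirichlet eigenfunction of $\Omega_\varepsilon$ with eigenvalue $k_\varepsilon^2$, $k_\varepsilon>0$, depending smoothly on $\varepsilon$, let $\sigma_\varepsilon=-\partial_nu_\varepsilon|_{\partial\Omega_\varepsilon}$, and let $\mathcal{N}=\mathcal{N}(\Omega_\varepsilon)=\|u_\varepsilon\|_{L^2(\Omega_\varepsilon)}^2$. Then the derivative of $\mathcal{N}$ at $\varepsilon=0$ is $$\delta\mathcal{N}=-2\frac{\delta k}{k}\,\mathcal{N}+\frac{1}{k^2}\int_{\partial\Omega}\sigma\,\delta\sigma\,(x\cdot n)\,ds+\frac{1}{2k^2}\int_{\partial\Omega}\sigma^2\Big[V\cdot n+x\cdot\Big(R\frac{dV}{d\tau}\Big)\Big]ds ,$$ where on the right-hand side all undifferentiated quantities are evaluated at $\varepsilon=0$.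
   Context: A Dirichlet eigenfunction with eigenvalue $k^2$ is a nonzero solution of $(\Delta+k^2)u=0$ in the domain with $u=0$ on its boundary. $\delta f:=\partial_\varepsilon f|_{\varepsilon=0}$; boundary functions are regarded as functions of the parameter $s$, so $\delta\sigma(s)=\partial_\varepsilon|_{\varepsilon=0}\sigma_\varepsilon(s)$ where $\sigma_\varepsilon(s)$ is the value at $\gamma_\varepsilon(s)$. $\tau=\dot\gamma/|\dot\gamma|$ is the unit tangent (counterclockwise orientation), $R$ is clockwise rotation by $\pi/2$, $n=R\tau$ is the outward unit normal, $\partial_n$ is the outward normal derivative, $\frac{dV}{d\tau}=\dot V/|\dot\gamma|$ is the tangential (arc-length) derivative, $x=\gamma(s)$ is the position vector, and $ds$ in the integrals over $\partial\Omega$ is arc length. *)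

theory Defs
  imports "HOL-Complex_Analysis.Complex_Analysis"
begin

text \<open>
  The plane is the type \<^typ>\<open>complex\<close>, used as a two-dimensional Euclidean space
  (inner product \<^term>\<open>z \<bullet> w\<close>, measure \<^term>\<open>lborel\<close>), so that the winding number is at hand.
\<close>

text \<open>Meant for an open set \<open>S\<close>: all iterated directional derivatives up to order \<open>k\<close> exist
  on \<open>S\<close>, those of order less than \<open>k\<close> are differentiable, those of order \<open>k\<close> continuous.\<close>

primrec Ck_on :: "nat \<Rightarrow> ('a::real_normed_vector \<Rightarrow> 'b::real_normed_vector) \<Rightarrow> 'a set \<Rightarrow> bool" where
  "Ck_on 0 f S \<longleftrightarrow> continuous_on S f"
| "Ck_on (Suc k) f S \<longleftrightarrow>
     (\<forall>x\<in>S. f differentiable (at x)) \<and> (\<forall>v. Ck_on k (\<lambda>x. frechet_derivative f (at x) v) S)"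

definition smooth_on :: "('a::real_normed_vector \<Rightarrow> 'b::real_normed_vector) \<Rightarrow> 'a set \<Rightarrow> bool" where
  "smooth_on f S \<longleftrightarrow> (\<forall>k. Ck_on k f S)"

text \<open>Smoothness on a set that need not be open, e.g. smoothness up to the boundary. Only the
  values of \<open>f\<close> on \<open>S\<close> matter.\<close>

definition smooth_up_to :: "('a::real_normed_vector \<Rightarrow> 'b::real_normed_vector) \<Rightarrow> 'a set \<Rightarrow> bool" where
  "smooth_up_to f S \<longleftrightarrow> (\<exists>U g. open U \<and> S \<subseteq> U \<and> smooth_on g U \<and> (\<forall>x\<in>S. g x = f x))"

text \<open>A closed curve on \<open>[0, L]\<close> is represented by its \<open>L\<close>-periodic extension to the real line.\<close>

definition smooth_periodic :: "real \<Rightarrow> (real \<Rightarrow> complex) \<Rightarrow> bool" where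
  "smooth_periodic L f \<longleftrightarrow> smooth_on f UNIV \<and> (\<forall>s. f (s + L) = f s)"

definition velocity :: "(real \<Rightarrow> complex) \<Rightarrow> real \<Rightarrow> complex" where
  "velocity \<gamma> s = vector_derivative \<gamma> (at s)"

definition smooth_regular_simple_closed :: "real \<Rightarrow> (real \<Rightarrow> complex) \<Rightarrow> bool" where
  "smooth_regular_simple_closed L \<gamma> \<longleftrightarrow>
     0 < L \<and> smooth_periodic L \<gamma> \<and> (\<forall>s. velocity \<gamma> s \<noteq> 0) \<and> inj_on \<gamma> {0..<L}"

definition bounded_domain_with_boundary :: "real \<Rightarrow> (real \<Rightarrow> complex) \<Rightarrow> complex set \<Rightarrow> bool" where
  "bounded_domain_with_boundary L \<gamma> D \<longleftrightarrow>
     open D \<and> connected D \<and> D \<noteq> {} \<and> bounded D \<and> frontier D = \<gamma> ` {0..L}"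

text \<open>The reparametrisation to \<open>[0, 1]\<close> is the library's convention for paths.\<close>

definition counterclockwise_around :: "real \<Rightarrow> (real \<Rightarrow> complex) \<Rightarrow> complex set \<Rightarrow> bool" where
  "counterclockwise_around L \<gamma> D \<longleftrightarrow> (\<forall>z\<in>D. winding_number (\<lambda>t. \<gamma> (L * t)) z = 1)"

definition clockwise_rotation :: "complex \<Rightarrow> complex" where
  "clockwise_rotation z = - \<i> * z"

definition unit_tangent :: "(real \<Rightarrow> complex) \<Rightarrow> real \<Rightarrow> complex" where
  "unit_tangent \<gamma> s = velocity \<gamma> s /\<^sub>R norm (velocity \<gamma> s)"

definition unit_normal :: "(real \<Rightarrow> complex) \<Rightarrow> real \<Rightarrow> complex" where
  "unit_normal \<gamma> s = clockwise_rotation (unit_tangent \<gamma> s)"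

definition tangential_derivative ::
    "(real \<Rightarrow> complex) \<Rightarrow> (real \<Rightarrow> complex) \<Rightarrow> real \<Rightarrow> complex" where
  "tangential_derivative \<gamma> V s = velocity V s /\<^sub>R norm (velocity \<gamma> s)"

text \<open>\<open>\<integral> f ds\<close> with respect to arc length; \<open>f\<close> is a function of the curve parameter.\<close>

definition arc_length_integral :: "real \<Rightarrow> (real \<Rightarrow> complex) \<Rightarrow> (real \<Rightarrow> real) \<Rightarrow> real" where
  "arc_length_integral L \<gamma> f = integral {0..L} (\<lambda>s. f s * norm (velocity \<gamma> s))"

text \<open>Since \<open>u\<close> carries no information outside the closed domain, the outward normal derivative
  at a boundary point \<open>p\<close> is one-sided: \<open>lim (u p - u (p - t n)) / t\<close> as \<open>t\<close> tends to \<open>0\<close>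
  from above.\<close>

definition outward_derivative :: "(complex \<Rightarrow> real) \<Rightarrow> complex \<Rightarrow> complex \<Rightarrow> real" where
  "outward_derivative u p n = vector_derivative (\<lambda>t. u (p + t *\<^sub>R n)) (at 0 within {..0})"

definition laplacian :: "(complex \<Rightarrow> real) \<Rightarrow> complex \<Rightarrow> real" where
  "laplacian u x =
     (\<Sum>b\<in>Basis. frechet_derivative (\<lambda>y. frechet_derivative u (at y) b) (at x) b)"

definition dirichlet_eigenfunction :: "complex set \<Rightarrow> real \<Rightarrow> (complex \<Rightarrow> real) \<Rightarrow> bool" where
  "dirichlet_eigenfunction D \<mu> u \<longleftrightarrow>
     Ck_on 2 u D \<and> continuous_on (closure D) u \<and>
     (\<forall>x\<in>D. laplacian u x + \<mu> * u x = 0) \<and> (\<forall>x\<in>frontier D. u x = 0) \<and> (\<exists>x\<in>D. u x \<noteq> 0)"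

definition deformed_curve :: "(real \<Rightarrow> complex) \<Rightarrow> (real \<Rightarrow> complex) \<Rightarrow> real \<Rightarrow> real \<Rightarrow> complex" where
  "deformed_curve \<gamma> V \<epsilon> s = \<gamma> s + \<epsilon> *\<^sub>R V s"

end

theory Submission
  imports Defs "HOL-Real_Asymp.Real_Asymp"
begin

text \<open>
  Rellich's identity \<open>2 k\<^sup>2 \<integral> u\<^sup>2 = \<integral> \<sigma>\<^sup>2 (x \<bullet> n) ds\<close>, which is the divergence theorem for
  \<open>(x \<bullet> \<nabla>u) \<nabla>u + (k\<^sup>2 u\<^sup>2 - \<bar>\<nabla>u\<bar>\<^sup>2) x / 2\<close>, expresses the norm by boundary data on the fixed parameter interval,
  where it can be differentiated under the integral sign.

  Green's theorem is obtained without boundary charts: by the Cauchy-Pompeiu formula,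
  \<open>\<integral>\<^sub>\<gamma> F dz = 2 \<i> \<integral> (\<partial>F / \<partial>cnj z) W\<close> for compactly supported \<open>F\<close>, where \<open>W\<close> is the winding number of \<open>\<gamma>\<close>,
  and \<open>W\<close> is the indicator function of the domain by the Jordan curve theorem. For small \<open>\<epsilon>\<close> the deformed
  curve stays simple and keeps its orientation. Since \<open>u\<close> is only known on the closed domain, it also has to
  be shown that the inward normal points into the domain; this again follows from Green's theorem.
\<close>

subsection \<open>Integration over the complex plane\<close>

text \<open>The norm is an integral over a moving domain, and Rellich's identity trades it for an
  integral over a fixed interval. In the curve parameter, \<open>(x \<bullet> n) ds\<close> becomes
  \<open>x \<bullet> R \<gamma>' ds\<close>: the speed cancels and the expression is bilinear in the
  curve and its velocity. Its variation is therefore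
  \<open>V \<bullet> R \<gamma>' + x \<bullet> R V'\<close>, the bracket of the formula, whether or
  not V is normal. The square of \<sigma> yields the term with the variation of \<sigma>, and the
  factor \<open>1 / k\<^sup>2\<close> the term with the norm itself; the variation of u inside the
  domain never has to be determined. The price is that Rellich's identity is required on a whole
  neighbourhood of \<epsilon> = 0, while orientation and simplicity are given at \<epsilon> = 0
  only. One extension of u, smooth in \<epsilon> and x jointly, carries the argument: its slices
  enter Rellich's identity, and its gradient on the moving curve is \<sigma>, which can be
  differentiated in \<epsilon> at fixed s although a point of one boundary may lie outside the
  neighbouring closed domains.\<close>

lemma measurable_Complex_pair [measurable]:
  "(\<lambda>p. Complex (fst p) (snd p)) \<in> borel_measurable (borel \<Otimes>\<^sub>M borel)"
  unfolding Complex_eq by measurable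

text \<open>The bridge to Fubini's theorem: a measure is identified with \<open>lborel\<close> by
  its values on boxes, and the preimage of a box is a product of two intervals.\<close>

lemma lborel_complex_eq_distr_pair:
  "(lborel :: complex measure) = distr (lborel \<Otimes>\<^sub>M lborel) borel (\<lambda>(x, y). Complex x y)"
proof (rule lborel_eqI)
  fix l u :: complex
  assume le: "\<And>b. b \<in> Basis \<Longrightarrow> l \<bullet> b \<le> u \<bullet> b"
  have [measurable]: "(\<lambda>(x, y). Complex x y) \<in> borel_measurable (lborel \<Otimes>\<^sub>M lborel)"
    using measurable_Complex_pair by (simp add: case_prod_beta)
  have eq: "(\<lambda>(x, y). Complex x y) -` box l u \<inter> space (lborel \<Otimes>\<^sub>M lborel)
      = {Re l <..< Re u} \<times> {Im l <..< Im u}"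
    by (auto simp: space_pair_measure in_box_complex_iff)
  have "Re l \<le> Re u" "Im l \<le> Im u"
    using le[of 1] le[of \<i>] by (auto simp: Basis_complex_def)
  then show "emeasure (distr (lborel \<Otimes>\<^sub>M lborel) borel (\<lambda>(x, y). Complex x y)) (box l u)
      = (\<Prod>b\<in>Basis. (u - l) \<bullet> b)"
    by (simp add: emeasure_distr eq lborel.emeasure_pair_measure_Times Basis_complex_def
        ennreal_mult[symmetric])
qed simp

lemma integrable_complex_iff_pair:
  fixes f :: "complex \<Rightarrow> 'b::{banach, second_countable_topology}"
  assumes [measurable]: "f \<in> borel_measurable borel"
  shows "integrable lborel f \<longleftrightarrow> integrable (lborel \<Otimes>\<^sub>M lborel) (\<lambda>(x, y). f (Complex x y))"
proof -
  have [measurable]: "(\<lambda>(x, y). Complex x y) \<in> borel_measurable (lborel \<Otimes>\<^sub>M lborel)"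
    using measurable_Complex_pair by (simp add: case_prod_beta)
  show ?thesis
    by (subst lborel_complex_eq_distr_pair, subst integrable_distr_eq) (auto simp: case_prod_beta')
qed

lemma integral_complex_eq_pair:
  fixes f :: "complex \<Rightarrow> 'b::{banach, second_countable_topology}"
  assumes [measurable]: "f \<in> borel_measurable borel"
  shows "integral\<^sup>L lborel f = (\<integral>(x, y). f (Complex x y) \<partial>(lborel \<Otimes>\<^sub>M lborel))"
proof -
  have [measurable]: "(\<lambda>(x, y). Complex x y) \<in> borel_measurable (lborel \<Otimes>\<^sub>M lborel)"
    using measurable_Complex_pair by (simp add: case_prod_beta)
  show ?thesis
    by (subst lborel_complex_eq_distr_pair, subst integral_distr) (auto simp: case_prod_beta')
qed

text \<open>Both orders are used later: a partial derivative has to be integrated first along the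
  lines parallel to its own direction.\<close>

lemma
  fixes f :: "complex \<Rightarrow> 'b::{banach, second_countable_topology}"
  assumes f: "integrable lborel f"
  shows integral_complex_Fubini: "integral\<^sup>L lborel f = (\<integral>x. \<integral>y. f (Complex x y) \<partial>lborel \<partial>lborel)"
    and integral_complex_Fubini': "integral\<^sup>L lborel f = (\<integral>y. \<integral>x. f (Complex x y) \<partial>lborel \<partial>lborel)"
proof -
  have m: "f \<in> borel_measurable borel" using f by auto
  have i: "integrable (lborel \<Otimes>\<^sub>M lborel) (\<lambda>(x, y). f (Complex x y))"
    using f integrable_complex_iff_pair[OF m] by simp
  show "integral\<^sup>L lborel f = (\<integral>x. \<integral>y. f (Complex x y) \<partial>lborel \<partial>lborel)"
    using integral_complex_eq_pair[OF m] lborel_pair.integral_fst[OF i] by simp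
  show "integral\<^sup>L lborel f = (\<integral>y. \<integral>x. f (Complex x y) \<partial>lborel \<partial>lborel)"
    using integral_complex_eq_pair[OF m] lborel_pair.integral_snd[OF i] by simp
qed

lemma negligible_imp_AE_lborel:
  assumes "negligible S" "S \<in> sets borel"
  shows "AE x in lborel. x \<notin> S"
proof (rule AE_not_in)
  have "S \<in> null_sets lebesgue"
    using assms(1) negligible_iff_null_sets by blast
  then show "S \<in> null_sets lborel"
    using assms(2) by (simp add: null_sets_def)
qed

lemma integrable_continuous_compact_support:
  fixes f :: "'a::euclidean_space \<Rightarrow> 'b::{banach, second_countable_topology}"
  assumes "continuous_on UNIV f" "\<And>x. R < norm x \<Longrightarrow> f x = 0"
  shows "integrable lborel f"
proof -
  have "integrable lborel (\<lambda>x. indicator (cball 0 R) x *\<^sub>R f x)"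
    by (rule borel_integrable_compact) (auto intro: continuous_on_subset[OF assms(1)])
  also have "(\<lambda>x. indicator (cball 0 R) x *\<^sub>R f x) = f"
    using assms(2) by (force simp: indicator_def)
  finally show ?thesis .
qed

text \<open>Because the integrand is nonnegative, the existence of the two limits of an
  antiderivative already gives Lebesgue integrability.\<close>

lemma has_bochner_integral_FTC_real_line:
  fixes f F :: "real \<Rightarrow> real"
  assumes "\<And>x. DERIV F x :> f x" "continuous_on UNIV f" "\<And>x. 0 \<le> f x"
    and "(F \<longlongrightarrow> A) at_bot" "(F \<longlongrightarrow> B) at_top"
  shows "has_bochner_integral lborel f (B - A)"
proof -
  have c: "isCont f x" for x
    using assms(2) by (simp add: continuous_on_eq_continuous_at)
  have "((F \<circ> real_of_ereal) \<longlongrightarrow> A) (at_right (-\<infinity>))" "((F \<circ> real_of_ereal) \<longlongrightarrow> B) (at_left \<infinity>)"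
    using assms(4,5) by (simp_all add: ereal_tendsto_simps1)
  from interval_integral_FTC_nonneg[of "-\<infinity>" \<infinity> F f, OF _ _ _ _ this]
  show ?thesis
    using assms c by (simp add: has_bochner_integral_iff set_integrable_def
      interval_lebesgue_integral_def set_lebesgue_integral_def einterval_def)
qed

lemma has_bochner_integral_inverse_square_quadratic:
  fixes a :: real
  assumes a: "0 < a"
  shows "has_bochner_integral lborel (\<lambda>x. 1 / (a + x\<^sup>2)\<^sup>2) (pi / (2 * a * sqrt a))"
proof -
  \<comment> \<open>The antiderivative from the reduction formula. Its rational part tends to 0 at
    both ends, so only the arctangent contributes, with \<open>pi / 2\<close> on either
    side.\<close>
  define F where "F x = x / (2 * a * (a + x\<^sup>2)) + arctan (x / sqrt a) / (2 * a * sqrt a)" for x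
  have nz: "a + x\<^sup>2 > 0" for x using a by (simp add: add_pos_nonneg)
  have lim: "((\<lambda>x. x / (2 * a * (a + x\<^sup>2)) + arctan (x / b) / c) \<longlongrightarrow> - (pi/2) / c) at_bot"
      "((\<lambda>x. x / (2 * a * (a + x\<^sup>2)) + arctan (x / b) / c) \<longlongrightarrow> (pi/2) / c) at_top"
    if "0 < b" "0 < c" for b c :: real
    using a that by (real_asymp simp: field_simps)+
  have "has_bochner_integral lborel (\<lambda>x. 1 / (a + x\<^sup>2)\<^sup>2)
    ((pi/2) / (2 * a * sqrt a) - (- (pi/2) / (2 * a * sqrt a)))"
  proof (rule has_bochner_integral_FTC_real_line[where F = F])
    show "DERIV F x :> 1 / (a + x\<^sup>2)\<^sup>2" for x
    proof -
      have [simp]: "a + x\<^sup>2 \<noteq> 0" "a + x * x \<noteq> 0" using nz[of x] by (auto simp: power2_eq_square)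
      have d1: "DERIV (\<lambda>x. 2 * a * (a + x\<^sup>2)) x :> 2 * a * (2 * x)"
        by (auto intro!: derivative_eq_intros)
      have d2: "DERIV (\<lambda>x. arctan (x / sqrt a)) x :> inverse (1 + (x / sqrt a)\<^sup>2) * (1 / sqrt a)"
        by (rule DERIV_chain2[OF DERIV_arctan DERIV_cdivide[OF DERIV_ident]])
      have "2 * a * (a + x\<^sup>2) \<noteq> 0" using a by simp
      note d = DERIV_add[OF DERIV_divide[OF DERIV_ident d1 this] DERIV_cdivide[OF d2, of "2 * a * sqrt a"]]
      have F: "F = (\<lambda>x. x / (2 * a * (a + x\<^sup>2)) + arctan (x / sqrt a) / (2 * a * sqrt a))"
        by (simp add: F_def fun_eq_iff)
      have "DERIV F x :> (1 * (2 * a * (a + x\<^sup>2)) - x * (2 * a * (2 * x))) / (2 * a * (a + x\<^sup>2))\<^sup>2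
         + (1 / sqrt a) / (1 + (x / sqrt a)\<^sup>2) / (2 * a * sqrt a)"
        unfolding F by (rule DERIV_cong[OF d]) (simp only: power2_eq_square divide_inverse mult_ac)
      moreover have "(1 / sqrt a) / (1 + (x / sqrt a)\<^sup>2) / (2 * a * sqrt a) = 1 / (2 * a * (a + x\<^sup>2))"
      proof -
        have "(1 / sqrt a) / (1 + (x / sqrt a)\<^sup>2) / (2 * a * sqrt a)
            = (1 / (sqrt a * sqrt a)) / (1 + x\<^sup>2 / a) / (2 * a)"
          using a by (simp add: power_divide)
        also have "1 + x\<^sup>2 / a = (a + x\<^sup>2) / a"
          using a by (simp add: field_simps)
        finally show ?thesis
          using a by (simp add: field_simps)
      qed
      moreover have "(1 * (2 * a * (a + x\<^sup>2)) - x * (2 * a * (2 * x))) / (2 * a * (a + x\<^sup>2))\<^sup>2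
         + 1 / (2 * a * (a + x\<^sup>2)) = 1 / (a + x\<^sup>2)\<^sup>2"
        using a by (simp add: divide_simps) (simp add: power2_eq_square algebra_simps)
      ultimately show ?thesis by (simp only:)
    qed
    show "continuous_on UNIV (\<lambda>x. 1 / (a + x\<^sup>2)\<^sup>2)"
      using nz by (intro continuous_intros) (auto simp: less_le)
    show "(F \<longlongrightarrow> - (pi/2) / (2 * a * sqrt a)) at_bot" "(F \<longlongrightarrow> (pi/2) / (2 * a * sqrt a)) at_top"
      unfolding F_def using a lim[of "sqrt a" "2 * a * sqrt a"] by simp_all
  qed auto
  then show ?thesis by (simp add: field_simps)
qed

lemma has_bochner_integral_inverse_cube_sqrt:
  "has_bochner_integral lborel (\<lambda>y::real. pi / (2 * (1 + y\<^sup>2) * sqrt (1 + y\<^sup>2))) pi"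
proof -
  have "has_bochner_integral lborel (\<lambda>y::real. pi / (2 * (1 + y\<^sup>2) * sqrt (1 + y\<^sup>2)))
    (pi / 2 - (- pi / 2))"
  proof (rule has_bochner_integral_FTC_real_line[where F = "\<lambda>y. pi / 2 * (y / sqrt (1 + y\<^sup>2))"])
    fix x :: real
    have p: "1 + x\<^sup>2 > 0" "1 + x * x > 0" by (simp_all add: add_pos_nonneg)
    have s: "sqrt (1 + x\<^sup>2) * sqrt (1 + x\<^sup>2) = 1 + x\<^sup>2" using p by simp
    have d1: "DERIV (\<lambda>x. 1 + x\<^sup>2) x :> 2 * x"
      by (auto intro!: derivative_eq_intros)
    have d: "DERIV (\<lambda>x. sqrt (1 + x\<^sup>2)) x :> inverse (sqrt (1 + x\<^sup>2)) / 2 * (2 * x)"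
      by (rule DERIV_chain2[where f = sqrt and g = "\<lambda>x. 1 + x\<^sup>2", OF DERIV_real_sqrt[OF p(1)] d1])
    have nz: "sqrt (1 + x\<^sup>2) \<noteq> 0" using p by simp
    have e: "inverse r / 2 * (2 * x) = 2 * x / (2 * r)" for r
      by (simp add: field_simps)
    note d' = DERIV_cmult[OF DERIV_divide[OF DERIV_ident d nz], of "pi / 2"]
    have "DERIV (\<lambda>y. pi / 2 * (y / sqrt (1 + y\<^sup>2))) x :>
       pi / 2 * ((1 * sqrt (1 + x\<^sup>2) - x * (2 * x / (2 * sqrt (1 + x\<^sup>2)))) / (sqrt (1 + x\<^sup>2) * sqrt (1 + x\<^sup>2)))"
      by (rule DERIV_cong[OF d']) (simp only: e)
    moreover have "(1 * sqrt (1 + x\<^sup>2) - x * (2 * x / (2 * sqrt (1 + x\<^sup>2)))) = 1 / sqrt (1 + x\<^sup>2)"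
      using p s by (simp add: field_simps power2_eq_square)
    ultimately show "DERIV (\<lambda>y. pi / 2 * (y / sqrt (1 + y\<^sup>2))) x :> pi / (2 * (1 + x\<^sup>2) * sqrt (1 + x\<^sup>2))"
      unfolding s by (simp add: mult_ac)
  next
    show "continuous_on UNIV (\<lambda>y::real. pi / (2 * (1 + y\<^sup>2) * sqrt (1 + y\<^sup>2)))"
      by (intro continuous_intros) (auto simp: add_nonneg_eq_0_iff)
    show "((\<lambda>y::real. pi / 2 * (y / sqrt (1 + y\<^sup>2))) \<longlongrightarrow> - pi / 2) at_bot"
      "((\<lambda>y::real. pi / 2 * (y / sqrt (1 + y\<^sup>2))) \<longlongrightarrow> pi / 2) at_top"
      by real_asymp+
  qed auto
  then show ?thesis by simp
qed

text \<open>The rescalings \<open>d / ((norm w)\<^sup>2 + d)\<^sup>2\<close> of this profile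
  concentrate at 0, and its mass is the source of the constant \<open>pi\<close> in the
  Cauchy-Pompeiu formula. Iterated Cartesian integration, with \<open>a = 1 + x\<^sup>2\<close> in
  the inner integral, takes the place of polar coordinates.\<close>

lemma has_bochner_integral_inverse_square_norm:
  "has_bochner_integral lborel (\<lambda>w::complex. 1 / (1 + (norm w)\<^sup>2)\<^sup>2) pi"
proof -
  let ?f = "\<lambda>w::complex. 1 / (1 + (norm w)\<^sup>2)\<^sup>2"
  have eq: "?f (Complex x y) = 1 / ((1 + x\<^sup>2) + y\<^sup>2)\<^sup>2" for x y
    by (simp add: cmod_power2 add_ac)
  have inner: "has_bochner_integral lborel (\<lambda>y. ?f (Complex x y)) (pi / (2 * (1 + x\<^sup>2) * sqrt (1 + x\<^sup>2)))" for x
    unfolding eq by (rule has_bochner_integral_inverse_square_quadratic) (simp add: add_pos_nonneg)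
  have m[measurable]: "?f \<in> borel_measurable borel" by measurable
  have [measurable]: "(\<lambda>(x, y). Complex x y) \<in> borel_measurable (lborel \<Otimes>\<^sub>M lborel)"
    using measurable_Complex_pair by (simp add: case_prod_beta)
  have int: "integrable (lborel \<Otimes>\<^sub>M lborel) (\<lambda>(x, y). ?f (Complex x y))"
  proof (rule lborel_pair.Fubini_integrable)
    show "integrable lborel (\<lambda>x. \<integral>y. norm (case (x, y) of (x, y) \<Rightarrow> ?f (Complex x y)) \<partial>lborel)"
      using inner has_bochner_integral_inverse_cube_sqrt
      by (simp add: has_bochner_integral_iff)
    show "AE x in lborel. integrable lborel (\<lambda>y. case (x, y) of (x, y) \<Rightarrow> ?f (Complex x y))"
      using inner by (simp add: has_bochner_integral_iff)
  qed (simp add: case_prod_beta eq)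
  then have i: "integrable lborel ?f"
    by (simp add: integrable_complex_iff_pair[OF m])
  moreover have "integral\<^sup>L lborel ?f = pi"
    unfolding integral_complex_Fubini[OF i]
    using inner has_bochner_integral_inverse_cube_sqrt
    by (simp add: has_bochner_integral_iff)
  ultimately show ?thesis by (simp add: has_bochner_integral_iff)
qed

section \<open>Local integrability of the Cauchy kernel\<close>

lemma integrable_inverse_sqrt_abs:
  fixes R :: real
  assumes R: "0 \<le> R"
  shows "integrable lborel (\<lambda>x::real. indicator {-R..R} x / sqrt \<bar>x\<bar>)"
proof -
  have "(\<lambda>x::real. x powr (-1/2)) integrable_on {0..R}"
    using integrable_on_powr_from_0[of "-1/2" R] R by simp
  then have "(\<lambda>x::real. x powr (-1/2)) absolutely_integrable_on {0..R}"
    by (intro nonnegative_absolutely_integrable_1) auto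
  then have "integrable lebesgue (\<lambda>x::real. indicator {0..R} x *\<^sub>R x powr (-1/2))"
    by (simp add: set_integrable_def)
  then have "integrable lborel (\<lambda>x::real. indicator {0..R} x *\<^sub>R x powr (-1/2))"
    by (subst (asm) integrable_completion) auto
  also have "(\<lambda>x::real. indicator {0..R} x *\<^sub>R x powr (-1/2)) = (\<lambda>x. indicator {0..R} x / sqrt x)"
    by (auto simp: indicator_def powr_minus powr_half_sqrt field_simps)
  finally have p: "integrable lborel (\<lambda>x::real. indicator {0..R} x / sqrt x)" .
  then have "integrable lborel (\<lambda>x::real. indicator {0..R} (0 + (-1) * x) / sqrt (0 + (-1) * x))"
    by (subst lborel_integrable_real_affine_iff) auto
  with p have "integrable lborel (\<lambda>x::real. indicator {0..R} x / sqrt x + indicator {0..R} (0 + (-1) * x) / sqrt (0 + (-1) * x))"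
    by (rule Bochner_Integration.integrable_add)
  \<comment> \<open>The two halves overlap only at \<open>x = 0\<close>, where every quotient is 0
    because division by 0 gives 0.\<close>
  moreover have "indicator {0..R} x / sqrt x + indicator {0..R} (0 + (-1) * x) / sqrt (0 + (-1) * x)
     = indicator {-R..R} x / sqrt \<bar>x\<bar>" for x
    using R by (auto simp: indicator_def real_sqrt_minus)
  ultimately show ?thesis by simp
qed

text \<open>\<open>\<bar>x y\<bar> \<le> \<bar>x + \<i> y\<bar>\<^sup>2\<close> bounds \<open>1 / \<bar>w\<bar>\<close> by a product of integrable functions of one variable.\<close>

lemma integrable_inverse_norm_cball:
  "integrable lborel (\<lambda>w::complex. indicator (cball 0 R) w / norm w)"
proof (cases "0 \<le> R")
  case True
  let ?g = "\<lambda>x::real. indicator {-R..R} x / sqrt \<bar>x\<bar>"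
  let ?h = "\<lambda>w. ?g (Re w) * ?g (Im w)"
  have [measurable]: "cball 0 R \<in> sets (borel :: complex measure)"
    by (simp add: borel_closed)
  have "integrable (lborel \<Otimes>\<^sub>M lborel) (\<lambda>(x, y). ?g x * ?g y)"
    using integrable_inverse_sqrt_abs[OF True]
    by (intro lborel_pair.Fubini_integrable)
       (auto simp: case_prod_beta abs_mult simp del: times_divide_eq_left times_divide_eq_right
        intro!: integrable_mult_right integrable_mult_left)
  then have h: "integrable lborel ?h"
    by (subst integrable_complex_iff_pair) (auto simp: case_prod_beta)
  \<comment> \<open>On the axes \<open>?h\<close> is 0 by the convention for division by 0, so there
    it does not bound the kernel; the axes are a null set.\<close>
  have ae: "AE w in lborel. Re w \<noteq> 0 \<and> Im w \<noteq> 0"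
  proof -
    have "AE w in lborel. w \<notin> {x::complex. x \<bullet> b = 0}" if "b \<in> Basis" for b
      using that by (intro negligible_imp_AE_lborel negligible_standard_hyperplane) auto
    from this[of 1] this[of \<i>] have "AE w in lborel. w \<notin> {x::complex. x \<bullet> 1 = 0}"
      "AE w in lborel. w \<notin> {x::complex. x \<bullet> \<i> = 0}" by (auto simp: Basis_complex_def)
    then show ?thesis by eventually_elim auto
  qed
  show ?thesis
  proof (rule Bochner_Integration.integrable_bound[OF h])
    show "AE w in lborel. norm (indicator (cball 0 R) w / norm w) \<le> norm (?h w)"
      using ae
    proof eventually_elim
      case (elim w)
      show ?case
      proof (cases "w \<in> cball 0 R")
        case True
        then have b: "\<bar>Re w\<bar> \<le> R" "\<bar>Im w\<bar> \<le> R"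
          using abs_Re_le_cmod[of w] abs_Im_le_cmod[of w] by auto
        have "sqrt \<bar>Re w\<bar> * sqrt \<bar>Im w\<bar> \<le> norm w"
          unfolding real_sqrt_mult[symmetric]
          using abs_Re_le_cmod[of w] abs_Im_le_cmod[of w]
          by (intro real_le_lsqrt) (simp_all add: power2_eq_square mult_mono)
        then have "1 / norm w \<le> 1 / (sqrt \<bar>Re w\<bar> * sqrt \<bar>Im w\<bar>)"
          using elim by (intro divide_left_mono mult_pos_pos) auto
        then show ?thesis using True b by (auto simp: indicator_def)
      qed simp
    qed
  qed simp
qed simp

subsection \<open>The Cauchy-Pompeiu formula\<close>

text \<open>The partial derivatives are arguments of the predicate, so that product and sum rules
  compute them and integrands can name them. The derivative is the full one at each point, not one
  within \<open>S\<close>.\<close>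

definition C1_on :: "complex set \<Rightarrow> (complex \<Rightarrow> real) \<Rightarrow> (complex \<Rightarrow> real) \<Rightarrow> (complex \<Rightarrow> real) \<Rightarrow> bool" where
  "C1_on S F Fx Fy \<longleftrightarrow> (\<forall>z\<in>S. (F has_derivative (\<lambda>h. Re h * Fx z + Im h * Fy z)) (at z)) \<and>
     continuous_on S Fx \<and> continuous_on S Fy"

lemma C1_onD: "C1_on S F Fx Fy \<Longrightarrow> z \<in> S \<Longrightarrow> (F has_derivative (\<lambda>h. Re h * Fx z + Im h * Fy z)) (at z)"
  by (simp add: C1_on_def)

lemma C1_on_continuous:
  assumes "C1_on S F Fx Fy"
  shows "continuous_on S F" "continuous_on S Fx" "continuous_on S Fy"
  using assms by (auto simp: C1_on_def intro!: continuous_at_imp_continuous_on intro: has_derivative_continuous)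

lemma C1_on_subset: "C1_on S F Fx Fy \<Longrightarrow> T \<subseteq> S \<Longrightarrow> C1_on T F Fx Fy"
  by (auto simp: C1_on_def intro: continuous_on_subset)

lemma C1_on_mult:
  assumes "C1_on S F Fx Fy" "C1_on S G Gx Gy"
  shows "C1_on S (\<lambda>z. F z * G z) (\<lambda>z. F z * Gx z + Fx z * G z) (\<lambda>z. F z * Gy z + Fy z * G z)"
  unfolding C1_on_def
proof (intro conjI ballI)
  fix z assume z: "z \<in> S"
  show "((\<lambda>z. F z * G z) has_derivative
     (\<lambda>h. Re h * (F z * Gx z + Fx z * G z) + Im h * (F z * Gy z + Fy z * G z))) (at z)"
    by (rule has_derivative_eq_rhs[OF has_derivative_mult[OF C1_onD[OF assms(1) z] C1_onD[OF assms(2) z]]])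
       (simp add: fun_eq_iff algebra_simps)
qed (intro continuous_intros C1_on_continuous[OF assms(1)] C1_on_continuous[OF assms(2)])+

lemma C1_on_add:
  assumes "C1_on S F Fx Fy" "C1_on S G Gx Gy"
  shows "C1_on S (\<lambda>z. F z + G z) (\<lambda>z. Fx z + Gx z) (\<lambda>z. Fy z + Gy z)"
  unfolding C1_on_def
proof (intro conjI ballI)
  fix z assume z: "z \<in> S"
  show "((\<lambda>z. F z + G z) has_derivative
     (\<lambda>h. Re h * (Fx z + Gx z) + Im h * (Fy z + Gy z))) (at z)"
    by (rule has_derivative_eq_rhs[OF has_derivative_add[OF C1_onD[OF assms(1) z] C1_onD[OF assms(2) z]]])
       (simp add: fun_eq_iff algebra_simps)
qed (intro continuous_intros C1_on_continuous[OF assms(1)] C1_on_continuous[OF assms(2)])+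

lemma C1_on_const: "C1_on S (\<lambda>z. c) (\<lambda>z. 0) (\<lambda>z. 0)"
  by (auto simp: C1_on_def)

lemma C1_on_Re: "C1_on S Re (\<lambda>z. 1) (\<lambda>z. 0)"
  by (auto simp: C1_on_def intro!: derivative_eq_intros)

lemma C1_on_Im: "C1_on S Im (\<lambda>z. 0) (\<lambda>z. 1)"
  by (auto simp: C1_on_def intro!: derivative_eq_intros)

lemma C1_on_compose:
  assumes F: "C1_on S F Fx Fy" and g: "\<And>x. DERIV g x :> g' x" "continuous_on UNIV g'"
  shows "C1_on S (\<lambda>z. g (F z)) (\<lambda>z. g' (F z) * Fx z) (\<lambda>z. g' (F z) * Fy z)"
  unfolding C1_on_def
proof (intro conjI ballI)
  fix z assume z: "z \<in> S"
  have "(g has_derivative (\<lambda>h. h * g' (F z))) (at (F z))"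
    by (rule has_derivative_eq_rhs[OF g(1)[of "F z", unfolded has_field_derivative_def]])
       (simp add: fun_eq_iff)
  from has_derivative_compose[OF C1_onD[OF F z] this]
  show "((\<lambda>z. g (F z)) has_derivative (\<lambda>h. Re h * (g' (F z) * Fx z) + Im h * (g' (F z) * Fy z))) (at z)"
    by (rule has_derivative_eq_rhs) (simp add: fun_eq_iff algebra_simps)
qed (intro continuous_intros continuous_on_compose2[OF g(2)] C1_on_continuous[OF F] subset_UNIV)+

lemma C1_on_outside_support:
  assumes F: "C1_on UNIV F Fx Fy" and supp: "\<forall>z. R < norm z \<longrightarrow> F z = 0"
  shows "\<forall>z. R < norm z \<longrightarrow> Fx z = 0" "\<forall>z. R < norm z \<longrightarrow> Fy z = 0"
proof -
  have "Fx z = 0 \<and> Fy z = 0" if z: "R < norm z" for z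
  proof -
  have "open {z::complex. R < norm z}"
    by (intro open_Collect_less continuous_intros)
  then have "(F has_derivative (\<lambda>h. 0)) (at z)"
    by (rule has_derivative_transform_within_open[OF has_derivative_const[of 0]]) (use z supp in auto)
  with C1_onD[OF F, of z] have e: "(\<lambda>h. Re h * Fx z + Im h * Fy z) = (\<lambda>h. 0)"
    using has_derivative_unique by blast
  show ?thesis
    using fun_cong[OF e, of 1] fun_cong[OF e, of \<i>] by auto
  qed
  then show "\<forall>z. R < norm z \<longrightarrow> Fx z = 0" "\<forall>z. R < norm z \<longrightarrow> Fy z = 0"
    by blast+
qed

text \<open>On each horizontal or vertical line the fundamental theorem of calculus applies, and
  both end points of a long enough segment lie outside the support.\<close>

lemma C1_on_integral_partials_eq_0:
  assumes F: "C1_on UNIV F Fx Fy" and supp: "\<forall>z. R < norm z \<longrightarrow> F z = 0"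
  shows "integral\<^sup>L lborel Fx = 0" "integral\<^sup>L lborel Fy = 0"
proof -
  note supp' = C1_on_outside_support[OF F supp]
  note cont = C1_on_continuous[OF F]
  have i: "integrable lborel Fx" "integrable lborel Fy"
    using supp' cont by (auto intro!: integrable_continuous_compact_support[where R = R])
  \<comment> \<open>The absolute value covers a negative \<open>R\<close>, and the 1 makes the
    inequality strict.\<close>
  have R: "R < norm (Complex x y)" if "\<bar>R\<bar> + 1 \<le> \<bar>x\<bar> \<or> \<bar>R\<bar> + 1 \<le> \<bar>y\<bar>" for x y
    using that abs_Re_le_cmod[of "Complex x y"] abs_Im_le_cmod[of "Complex x y"] by auto
  have *: "(\<integral>t. f' t \<partial>lborel) = 0"
    if f: "\<And>t. DERIV f t :> f' t" and c: "continuous_on UNIV f'"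
      and z: "\<And>t. \<bar>R\<bar> + 1 \<le> \<bar>t\<bar> \<Longrightarrow> f t = 0 \<and> f' t = 0" for f f' :: "real \<Rightarrow> real"
  proof -
    let ?a = "\<bar>R\<bar> + 1"
    have "(\<integral>t. f' t \<partial>lborel) = (\<integral>t. f' t * indicator {-?a..?a} t \<partial>lborel)"
    proof (rule Bochner_Integration.integral_cong[OF refl])
      fix t show "f' t = f' t * indicator {-?a..?a} t"
        using z[of t] by (cases "\<bar>t\<bar> \<le> ?a") (auto simp: indicator_def abs_le_iff)
    qed
    also have "\<dots> = f ?a - f (-?a)"
      using f c by (intro integral_FTC_Icc_real) (auto simp: continuous_on_eq_continuous_at)
    also have "\<dots> = 0" using z[of ?a] z[of "-?a"] by simp
    finally show ?thesis .
  qed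
  have cx: "continuous_on UNIV (\<lambda>x. Complex x y)" "continuous_on UNIV (\<lambda>x. Complex y x)" for y
    unfolding Complex_eq by (intro continuous_intros)+
  have "(\<integral>x. Fx (Complex x y) \<partial>lborel) = 0" for y
  proof (rule *[where f = "\<lambda>x. F (Complex x y)"])
    fix t
    have "((\<lambda>x. Complex x y) has_derivative (\<lambda>h. Complex h 0)) (at t)"
      unfolding Complex_eq by (auto intro!: derivative_eq_intros)
    from has_derivative_compose[OF this C1_onD[OF F UNIV_I]]
    show "DERIV (\<lambda>x. F (Complex x y)) t :> Fx (Complex t y)"
      by (simp add: has_field_derivative_def mult_commute_abs)
    show "F (Complex t y) = 0 \<and> Fx (Complex t y) = 0" if "\<bar>R\<bar> + 1 \<le> \<bar>t\<bar>"
      using supp supp' R that by blast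
  qed (intro continuous_on_compose2[OF cont(2)] cx subset_UNIV)
  then show "integral\<^sup>L lborel Fx = 0"
    by (simp add: integral_complex_Fubini'[OF i(1)])
  have "(\<integral>y. Fy (Complex x y) \<partial>lborel) = 0" for x
  proof (rule *[where f = "\<lambda>y. F (Complex x y)"])
    fix t
    have "((\<lambda>y. Complex x y) has_derivative (\<lambda>h. Complex 0 h)) (at t)"
      unfolding Complex_eq by (auto intro!: derivative_eq_intros)
    from has_derivative_compose[OF this C1_onD[OF F UNIV_I]]
    show "DERIV (\<lambda>y. F (Complex x y)) t :> Fy (Complex x t)"
      by (simp add: has_field_derivative_def mult_commute_abs)
    show "F (Complex x t) = 0 \<and> Fy (Complex x t) = 0" if "\<bar>R\<bar> + 1 \<le> \<bar>t\<bar>"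
      using supp supp' R that by blast
  qed (intro continuous_on_compose2[OF cont(3)] cx subset_UNIV)
  then show "integral\<^sup>L lborel Fy = 0"
    by (simp add: integral_complex_Fubini[OF i(2)])
qed

text \<open>The product with \<open>F\<close> vanishes far out whatever \<open>K\<close> is, so its
  partial derivatives integrate to 0.\<close>

lemma C1_on_integral_by_parts:
  assumes F: "C1_on UNIV F Fx Fy" and supp: "\<forall>z. R < norm z \<longrightarrow> F z = 0"
    and K: "C1_on UNIV K Kx Ky"
  shows "(\<integral>z. Fx z * K z \<partial>lborel) = - (\<integral>z. F z * Kx z \<partial>lborel)"
    and "(\<integral>z. Fy z * K z \<partial>lborel) = - (\<integral>z. F z * Ky z \<partial>lborel)"
proof -
  note supp' = C1_on_outside_support[OF F supp]
  note cont = C1_on_continuous[OF F] C1_on_continuous[OF K]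
  have FK: "C1_on UNIV (\<lambda>z. F z * K z) (\<lambda>z. F z * Kx z + Fx z * K z) (\<lambda>z. F z * Ky z + Fy z * K z)"
    by (rule C1_on_mult[OF F K])
  have i: "integrable lborel (\<lambda>z. F z * Kx z)" "integrable lborel (\<lambda>z. Fx z * K z)"
     "integrable lborel (\<lambda>z. F z * Ky z)" "integrable lborel (\<lambda>z. Fy z * K z)"
    using supp supp' by (auto intro!: integrable_continuous_compact_support[where R = R] continuous_intros cont)
  show "(\<integral>z. Fx z * K z \<partial>lborel) = - (\<integral>z. F z * Kx z \<partial>lborel)"
    "(\<integral>z. Fy z * K z \<partial>lborel) = - (\<integral>z. F z * Ky z \<partial>lborel)"
    using C1_on_integral_partials_eq_0[OF FK, of R] supp i by simp_all
qed

section \<open>Change of variables by scaling and translation\<close>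

lemma lborel_integral_scaleR:
  fixes f :: "'a::euclidean_space \<Rightarrow> real"
  assumes [measurable]: "f \<in> borel_measurable borel" and c: "c \<noteq> 0"
  shows "integral\<^sup>L lborel f = (\<integral>x. \<bar>c\<bar> ^ DIM('a) * f (c *\<^sub>R x) \<partial>lborel)"
  by (subst lborel_affine[OF c, of 0], subst integral_density) (simp_all add: integral_distr)

lemma lborel_integral_translate:
  fixes f :: "'a::euclidean_space \<Rightarrow> 'b::{banach, second_countable_topology}"
  assumes [measurable]: "f \<in> borel_measurable borel"
  shows "(\<integral>x. f (c + x) \<partial>lborel) = integral\<^sup>L lborel f"
  by (subst (2) lborel_distr_plus[of c, symmetric], subst integral_distr) simp_all

lemma lborel_integrable_translate:
  fixes f :: "'a::euclidean_space \<Rightarrow> 'b::{banach, second_countable_topology}"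
  assumes [measurable]: "f \<in> borel_measurable borel"
  shows "integrable lborel (\<lambda>x. f (c + x)) \<longleftrightarrow> integrable lborel f"
  by (subst (2) lborel_distr_plus[of c, symmetric], subst integrable_distr_eq) simp_all

lemma continuous_compact_support_bounded:
  fixes f :: "complex \<Rightarrow> real"
  assumes "continuous_on UNIV f" "\<forall>z. R < norm z \<longrightarrow> f z = 0"
  shows "\<exists>M>0. \<forall>z. \<bar>f z\<bar> \<le> M"
proof -
  have "bounded (f ` cball 0 R)"
    by (intro compact_imp_bounded compact_continuous_image continuous_on_subset[OF assms(1)]) auto
  then obtain M where M: "0 < M" "\<And>z. norm z \<le> R \<Longrightarrow> \<bar>f z\<bar> \<le> M"
    by (auto simp: bounded_pos)
  have "\<bar>f z\<bar> \<le> M" for z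
    using M(1) M(2)[of z] assms(2) by (cases "norm z \<le> R") auto
  with M(1) show ?thesis by blast
qed

text \<open>Up to the sign of the second, these are the real and the imaginary part of
  \<open>cnj z / N z\<close>. Two features matter: the diagonal partials add up to
  \<open>2 * d / (N z)\<^sup>2\<close>, which concentrates at 0, and the two mixed partials
  coincide, which makes the second integral of the regularised formula vanish.\<close>

lemma C1_on_regularized_kernel:
  assumes d: "0 < d" and N_def: "\<And>z. N z = (Re z)\<^sup>2 + (Im z)\<^sup>2 + d"
  shows "C1_on UNIV (\<lambda>z. Re z / N z) (\<lambda>z. (N z - 2 * (Re z)\<^sup>2) / (N z)\<^sup>2) (\<lambda>z. - 2 * Re z * Im z / (N z)\<^sup>2)"
    and "C1_on UNIV (\<lambda>z. Im z / N z) (\<lambda>z. - 2 * Re z * Im z / (N z)\<^sup>2) (\<lambda>z. (N z - 2 * (Im z)\<^sup>2) / (N z)\<^sup>2)"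
proof -
  have N: "N z \<noteq> 0" for z
    using d by (simp add: N_def add_nonneg_pos less_imp_neq[symmetric])
  have cN: "continuous_on UNIV N"
    unfolding N_def[abs_def] by (intro continuous_intros)
  have dN: "(N has_derivative (\<lambda>h. 2 * Re h * Re z + 2 * Im h * Im z)) (at z)" for z
    unfolding N_def[abs_def] by (auto intro!: derivative_eq_intros)
  have dR: "(Re has_derivative Re) (at z)" and dI: "(Im has_derivative Im) (at z)" for z
    by (auto intro!: derivative_eq_intros)
  show "C1_on UNIV (\<lambda>z. Re z / N z) (\<lambda>z. (N z - 2 * (Re z)\<^sup>2) / (N z)\<^sup>2) (\<lambda>z. - 2 * Re z * Im z / (N z)\<^sup>2)"
    unfolding C1_on_def
  proof (intro conjI ballI)
    fix z
    show "((\<lambda>z. Re z / N z) has_derivative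
      (\<lambda>h. Re h * ((N z - 2 * (Re z)\<^sup>2) / (N z)\<^sup>2) + Im h * (- 2 * Re z * Im z / (N z)\<^sup>2))) (at z)"
      by (rule has_derivative_eq_rhs[OF has_derivative_divide'[OF dR dN N]])
         (use N in \<open>simp add: fun_eq_iff field_simps power2_eq_square\<close>)
  qed (intro continuous_intros cN; simp add: N)+
  show "C1_on UNIV (\<lambda>z. Im z / N z) (\<lambda>z. - 2 * Re z * Im z / (N z)\<^sup>2) (\<lambda>z. (N z - 2 * (Im z)\<^sup>2) / (N z)\<^sup>2)"
    unfolding C1_on_def
  proof (intro conjI ballI)
    fix z
    show "((\<lambda>z. Im z / N z) has_derivative
      (\<lambda>h. Re h * (- 2 * Re z * Im z / (N z)\<^sup>2) + Im h * ((N z - 2 * (Im z)\<^sup>2) / (N z)\<^sup>2))) (at z)"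
      by (rule has_derivative_eq_rhs[OF has_derivative_divide'[OF dI dN N]])
         (use N in \<open>simp add: fun_eq_iff field_simps power2_eq_square\<close>)
  qed (intro continuous_intros cN; simp add: N)+
qed

text \<open>Integrate by parts against the regularisation \<open>cnj z / (\<bar>z\<bar>\<^sup>2 + d)\<close> of \<open>1 / z\<close>, split into real and
  imaginary part.\<close>

lemma regularized_Cauchy_Pompeiu:
  assumes F: "C1_on UNIV F Fx Fy" and supp: "\<forall>z. R < norm z \<longrightarrow> F z = 0" and d: "0 < d"
  shows "(\<integral>z. (Fx z * Re z + Fy z * Im z) / ((norm z)\<^sup>2 + d) \<partial>lborel)
       = - 2 * (\<integral>z. F z * (d / ((norm z)\<^sup>2 + d)\<^sup>2) \<partial>lborel)"
    and "(\<integral>z. (Fy z * Re z - Fx z * Im z) / ((norm z)\<^sup>2 + d) \<partial>lborel) = 0"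
proof -
  define N where "N z = (Re z)\<^sup>2 + (Im z)\<^sup>2 + d" for z
  note supp' = C1_on_outside_support[OF F supp]
  note K = C1_on_regularized_kernel[OF d N_def]
  note cont = C1_on_continuous[OF F] C1_on_continuous[OF K(1)] C1_on_continuous[OF K(2)]
  have normN: "(norm z)\<^sup>2 + d = N z" for z
    by (simp add: N_def cmod_power2)
  have i: "integrable lborel (\<lambda>z. f z * g z)"
    if "continuous_on UNIV f" "continuous_on UNIV g" "\<forall>z. R < norm z \<longrightarrow> f z = 0"
    for f g :: "complex \<Rightarrow> real"
    using that by (auto intro!: integrable_continuous_compact_support[where R = R] continuous_intros)
  note int = i[OF cont(1) cont(5) supp] i[OF cont(1) cont(6) supp] i[OF cont(1) cont(8) supp] i[OF cont(1) cont(9) supp]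
     i[OF cont(2) cont(4) supp'(1)] i[OF cont(2) cont(7) supp'(1)] i[OF cont(3) cont(4) supp'(2)] i[OF cont(3) cont(7) supp'(2)]
  note ibp = C1_on_integral_by_parts[OF F supp K(1)] C1_on_integral_by_parts[OF F supp K(2)]
  have "(\<integral>z. (Fx z * Re z + Fy z * Im z) / ((norm z)\<^sup>2 + d) \<partial>lborel)
      = (\<integral>z. Fx z * (Re z / N z) + Fy z * (Im z / N z) \<partial>lborel)"
    by (simp add: normN add_divide_distrib)
  also have "\<dots> = - (\<integral>z. F z * ((N z - 2 * (Re z)\<^sup>2) / (N z)\<^sup>2) + F z * ((N z - 2 * (Im z)\<^sup>2) / (N z)\<^sup>2) \<partial>lborel)"
    unfolding Bochner_Integration.integral_add[OF int(5) int(8)] Bochner_Integration.integral_add[OF int(1) int(4)]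
      ibp(1) ibp(4) by (rule minus_add_distrib[symmetric])
  also have "\<dots> = - (\<integral>z. 2 * (F z * (d / ((norm z)\<^sup>2 + d)\<^sup>2)) \<partial>lborel)"
  proof -
    have "F z * ((N z - 2 * (Re z)\<^sup>2) / (N z)\<^sup>2) + F z * ((N z - 2 * (Im z)\<^sup>2) / (N z)\<^sup>2)
      = 2 * (F z * (d / ((norm z)\<^sup>2 + d)\<^sup>2))" for z
      unfolding normN distrib_left[symmetric] add_divide_distrib[symmetric] by (simp add: N_def)
    then show ?thesis by (simp only:)
  qed
  also have "\<dots> = - 2 * (\<integral>z. F z * (d / ((norm z)\<^sup>2 + d)\<^sup>2) \<partial>lborel)"
    by (subst Bochner_Integration.integral_mult_right_zero) simp
  finally show "(\<integral>z. (Fx z * Re z + Fy z * Im z) / ((norm z)\<^sup>2 + d) \<partial>lborel)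
       = - 2 * (\<integral>z. F z * (d / ((norm z)\<^sup>2 + d)\<^sup>2) \<partial>lborel)" .
  have "(\<integral>z. (Fy z * Re z - Fx z * Im z) / ((norm z)\<^sup>2 + d) \<partial>lborel)
      = (\<integral>z. Fy z * (Re z / N z) - Fx z * (Im z / N z) \<partial>lborel)"
    by (simp add: normN diff_divide_distrib)
  also have "\<dots> = 0"
    unfolding Bochner_Integration.integral_diff[OF int(7) int(6)] ibp(2) ibp(3) by simp
  finally show "(\<integral>z. (Fy z * Re z - Fx z * Im z) / ((norm z)\<^sup>2 + d) \<partial>lborel) = 0" .
qed

text \<open>The bound is uniform in \<open>d\<close> and includes \<open>d = 0\<close>, so it both
  dominates the passage to the limit and shows the limit to be integrable.\<close>

lemma kernel_bound:
  fixes a b :: real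
  assumes "0 \<le> d" "\<bar>a\<bar> \<le> M" "\<bar>b\<bar> \<le> M"
  shows "\<bar>(a * Re z + b * Im z) / ((norm z)\<^sup>2 + d)\<bar> \<le> 2 * M / norm z"
    and "\<bar>(a * Re z - b * Im z) / ((norm z)\<^sup>2 + d)\<bar> \<le> 2 * M / norm z"
proof -
  have M: "0 \<le> M" using assms by linarith
  have "\<bar>a * Re z\<bar> \<le> M * norm z" "\<bar>b * Im z\<bar> \<le> M * norm z"
    using assms abs_Re_le_cmod[of z] abs_Im_le_cmod[of z] by (simp_all add: abs_mult mult_mono M)
  then have 1: "\<bar>a * Re z + b * Im z\<bar> \<le> 2 * M * norm z" "\<bar>a * Re z - b * Im z\<bar> \<le> 2 * M * norm z" by linarith+
  have *: "\<bar>x / ((norm z)\<^sup>2 + d)\<bar> \<le> 2 * M / norm z" if "\<bar>x\<bar> \<le> 2 * M * norm z" for x :: real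
  proof (cases "z = 0")
    case False
    then have p: "0 < (norm z)\<^sup>2" by simp
    have "\<bar>x / ((norm z)\<^sup>2 + d)\<bar> = \<bar>x\<bar> / ((norm z)\<^sup>2 + d)"
      using p assms(1) by (simp add: abs_div_pos)
    also have "\<dots> \<le> (2 * M * norm z) / (norm z)\<^sup>2"
      using that p assms(1) M by (intro frac_le) auto
    finally show ?thesis using False by (simp add: power2_eq_square)
  qed (use that in auto)
  show "\<bar>(a * Re z + b * Im z) / ((norm z)\<^sup>2 + d)\<bar> \<le> 2 * M / norm z"
    "\<bar>(a * Re z - b * Im z) / ((norm z)\<^sup>2 + d)\<bar> \<le> 2 * M / norm z"
    by (intro * 1)+
qed

text \<open>The regularisation \<open>d = (t n)\<^sup>2\<close> is sent to 0. The left-hand side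
  converges under the bound by a multiple of \<open>1 / norm z\<close>. On the right, the
  substitution of \<open>t n *\<^sub>R z\<close> for \<open>z\<close> turns the weight into the
  fixed profile of mass \<open>pi\<close>, while \<open>F (t n *\<^sub>R z)\<close> tends to
  \<open>F 0\<close>.\<close>

lemma Cauchy_Pompeiu_at_0_real:
  assumes F: "C1_on UNIV F Fx Fy" and supp: "\<forall>z. R < norm z \<longrightarrow> F z = 0"
  shows "has_bochner_integral lborel (\<lambda>z. (Fx z * Re z + Fy z * Im z) / (norm z)\<^sup>2) (- 2 * pi * F 0)"
    and "has_bochner_integral lborel (\<lambda>z. (Fy z * Re z - Fx z * Im z) / (norm z)\<^sup>2) 0"
proof -
  note supp' = C1_on_outside_support[OF F supp]
  note cont = C1_on_continuous[OF F]
  have [measurable]: "F \<in> borel_measurable borel" "Fx \<in> borel_measurable borel" "Fy \<in> borel_measurable borel"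
    using cont by (auto intro: borel_measurable_continuous_onI)
  obtain M0 where M0: "0 < M0" "\<forall>z. \<bar>F z\<bar> \<le> M0"
    using continuous_compact_support_bounded[OF cont(1) supp] by auto
  obtain M1 where M1: "0 < M1" "\<forall>z. \<bar>Fx z\<bar> \<le> M1"
    using continuous_compact_support_bounded[OF cont(2) supp'(1)] by auto
  obtain M2 where M2: "0 < M2" "\<forall>z. \<bar>Fy z\<bar> \<le> M2"
    using continuous_compact_support_bounded[OF cont(3) supp'(2)] by auto
  define M where "M = max M1 M2"
  have M: "\<bar>Fx z\<bar> \<le> M" "\<bar>Fy z\<bar> \<le> M" for z
    using M1(2) M2(2) by (simp_all add: M_def le_max_iff_disj)
  define t where "t n = 1 / real (Suc n)" for n
  have t0: "t n > 0" "t n \<noteq> 0" for n by (auto simp: t_def)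
  have t: "t \<longlonglongrightarrow> 0" unfolding t_def using LIMSEQ_inverse_real_of_nat by (simp add: inverse_eq_divide)
  let ?w = "\<lambda>z::complex. 2 * M * (indicator (cball 0 R) z / norm z)"
  have w: "integrable lborel ?w"
    by (intro integrable_mult_right integrable_inverse_norm_cball)
  have bound: "\<bar>(Fx z * Re z + Fy z * Im z) / ((norm z)\<^sup>2 + d)\<bar> \<le> ?w z"
    "\<bar>(Fy z * Re z - Fx z * Im z) / ((norm z)\<^sup>2 + d)\<bar> \<le> ?w z" if "0 \<le> d" for z d
    using kernel_bound[OF that M(1) M(2), of z] kernel_bound[OF that M(2) M(1), of z] supp'
    by (cases "norm z \<le> R"; simp add: indicator_def)+
  \<comment> \<open>At \<open>z = 0\<close> the limit quotient is 0 by the convention for division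
    by 0; the condition on \<open>c\<close> is met because the numerators contain
    \<open>Re z\<close> and \<open>Im z\<close>.\<close>
  have lim: "(\<lambda>n. c / ((norm z)\<^sup>2 + (t n)\<^sup>2)) \<longlonglongrightarrow> c / (norm z)\<^sup>2" if "z = 0 \<Longrightarrow> c = 0" for z :: complex and c :: real
  proof (cases "z = 0")
    case False
    have "(\<lambda>n. c / ((norm z)\<^sup>2 + (t n)\<^sup>2)) \<longlonglongrightarrow> c / ((norm z)\<^sup>2 + 0\<^sup>2)"
      using False by (intro tendsto_intros t) auto
    then show ?thesis by simp
  qed (use that in simp)
  have b0: "norm ((Fx z * Re z + Fy z * Im z) / (norm z)\<^sup>2) \<le> norm (?w z)"
    "norm ((Fy z * Re z - Fx z * Im z) / (norm z)\<^sup>2) \<le> norm (?w z)" for z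
    using order_trans[OF bound(1)[of 0 z] abs_ge_self] order_trans[OF bound(2)[of 0 z] abs_ge_self]
    by (simp_all only: real_norm_def add_0_right order_refl)
  have i1: "integrable lborel (\<lambda>z. (Fx z * Re z + Fy z * Im z) / (norm z)\<^sup>2)"
    by (rule Bochner_Integration.integrable_bound[OF w]) (use b0(1) in auto)
  have i2: "integrable lborel (\<lambda>z. (Fy z * Re z - Fx z * Im z) / (norm z)\<^sup>2)"
    by (rule Bochner_Integration.integrable_bound[OF w]) (use b0(2) in auto)
  have L1: "(\<lambda>n. \<integral>z. (Fx z * Re z + Fy z * Im z) / ((norm z)\<^sup>2 + (t n)\<^sup>2) \<partial>lborel) \<longlonglongrightarrow>
      (\<integral>z. (Fx z * Re z + Fy z * Im z) / (norm z)\<^sup>2 \<partial>lborel)"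
    by (rule integral_dominated_convergence[where w = ?w]) (use w bound lim in auto)
  have L2: "(\<lambda>n. \<integral>z. (Fy z * Re z - Fx z * Im z) / ((norm z)\<^sup>2 + (t n)\<^sup>2) \<partial>lborel) \<longlonglongrightarrow>
      (\<integral>z. (Fy z * Re z - Fx z * Im z) / (norm z)\<^sup>2 \<partial>lborel)"
    by (rule integral_dominated_convergence[where w = ?w]) (use w bound lim in auto)
  have scale: "(\<integral>z. F z * ((t n)\<^sup>2 / ((norm z)\<^sup>2 + (t n)\<^sup>2)\<^sup>2) \<partial>lborel)
      = (\<integral>z. F (t n *\<^sub>R z) * (1 / (1 + (norm z)\<^sup>2)\<^sup>2) \<partial>lborel)" for n
  proof -
    have eq: "\<bar>t n\<bar>\<^sup>2 * (F (t n *\<^sub>R z) * ((t n)\<^sup>2 / ((norm (t n *\<^sub>R z))\<^sup>2 + (t n)\<^sup>2)\<^sup>2))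
      = F (t n *\<^sub>R z) * (1 / (1 + (norm z)\<^sup>2)\<^sup>2)" for z :: complex
    proof -
      have "(norm (t n *\<^sub>R z))\<^sup>2 + (t n)\<^sup>2 = (t n)\<^sup>2 * (1 + (norm z)\<^sup>2)"
        by (simp add: power_mult_distrib algebra_simps)
      moreover have "T * (c * (T / (T * N)\<^sup>2)) = c * (1 / N\<^sup>2)" if "T \<noteq> 0" for T c N :: real
        using that by (cases "N = 0") (simp_all add: power2_eq_square)
      ultimately show ?thesis using t0[of n] by simp
    qed
    show ?thesis
      by (subst lborel_integral_scaleR[OF _ t0(2)[of n]]) (measurable, simp only: eq DIM_complex)
  qed
  have L3: "(\<lambda>n. \<integral>z. F (t n *\<^sub>R z) * (1 / (1 + (norm z)\<^sup>2)\<^sup>2) \<partial>lborel) \<longlonglongrightarrow>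
      (\<integral>z. F 0 * (1 / (1 + (norm (z::complex))\<^sup>2)\<^sup>2) \<partial>lborel)"
  proof (rule integral_dominated_convergence[where w = "\<lambda>z. M0 * (1 / (1 + (norm z)\<^sup>2)\<^sup>2)"])
    show "integrable lborel (\<lambda>z::complex. M0 * (1 / (1 + (norm z)\<^sup>2)\<^sup>2))"
      by (intro integrable_mult_right has_bochner_integral_inverse_square_norm[THEN integrable.intros])
    show "AE z in lborel. (\<lambda>n. F (t n *\<^sub>R z) * (1 / (1 + (norm z)\<^sup>2)\<^sup>2)) \<longlonglongrightarrow> F 0 * (1 / (1 + (norm z)\<^sup>2)\<^sup>2)"
    proof (rule AE_I2)
      fix z :: complex
      have "(\<lambda>n. t n *\<^sub>R z) \<longlonglongrightarrow> 0 *\<^sub>R z" by (intro tendsto_intros t)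
      then have "(\<lambda>n. F (t n *\<^sub>R z)) \<longlonglongrightarrow> F 0"
        using continuous_on_tendsto_compose[OF cont(1)] by fastforce
      then show "(\<lambda>n. F (t n *\<^sub>R z) * (1 / (1 + (norm z)\<^sup>2)\<^sup>2)) \<longlonglongrightarrow> F 0 * (1 / (1 + (norm z)\<^sup>2)\<^sup>2)"
        by (rule tendsto_mult_right)
    qed
    show "AE z in lborel. norm (F (t n *\<^sub>R z) * (1 / (1 + (norm z)\<^sup>2)\<^sup>2)) \<le> M0 * (1 / (1 + (norm z)\<^sup>2)\<^sup>2)" for n
    proof (rule AE_I2)
      fix z :: complex
      show "norm (F (t n *\<^sub>R z) * (1 / (1 + (norm z)\<^sup>2)\<^sup>2)) \<le> M0 * (1 / (1 + (norm z)\<^sup>2)\<^sup>2)"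
        unfolding real_norm_def abs_mult using M0 by (intro mult_mono) (auto simp: less_imp_le)
    qed
  qed simp_all
  have "(\<integral>z. F 0 * (1 / (1 + (norm (z::complex))\<^sup>2)\<^sup>2) \<partial>lborel) = F 0 * pi"
    by (intro has_bochner_integral_integral_eq has_bochner_integral_mult_right has_bochner_integral_inverse_square_norm)
  with L3 have L3': "(\<lambda>n. -2 * (\<integral>z. F (t n *\<^sub>R z) * (1 / (1 + (norm z)\<^sup>2)\<^sup>2) \<partial>lborel)) \<longlonglongrightarrow> -2 * (F 0 * pi)"
    by (intro tendsto_intros) simp
  have p: "0 < (t n)\<^sup>2" for n using t0 by simp
  \<comment> \<open>Folding rewrites the sequence of \<open>L3'\<close> backwards, through the
    scaling and the regularised formula, into the sequence of \<open>L1\<close>.\<close>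
  have "(\<integral>z. (Fx z * Re z + Fy z * Im z) / (norm z)\<^sup>2 \<partial>lborel) = -2 * (F 0 * pi)"
    using LIMSEQ_unique[OF L1 L3'[folded scale, folded regularized_Cauchy_Pompeiu(1)[OF F supp p]]] .
  with i1 show "has_bochner_integral lborel (\<lambda>z. (Fx z * Re z + Fy z * Im z) / (norm z)\<^sup>2) (- 2 * pi * F 0)"
    by (simp add: has_bochner_integral_iff)
  have "(\<integral>z. (Fy z * Re z - Fx z * Im z) / (norm z)\<^sup>2 \<partial>lborel) = 0"
    using L2 unfolding regularized_Cauchy_Pompeiu(2)[OF F supp p] by (simp add: LIMSEQ_const_iff)
  with i2 show "has_bochner_integral lborel (\<lambda>z. (Fy z * Re z - Fx z * Im z) / (norm z)\<^sup>2) 0"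
    by (simp add: has_bochner_integral_iff)
qed

text \<open>For real \<open>F\<close>, the number \<open>Complex (Fx w) (Fy w)\<close> is twice the
  derivative of \<open>F\<close> with respect to \<open>cnj w\<close>. The case of a general
  \<open>z\<close> follows by translation, and the two real integrals at 0 are the real and the
  imaginary part.\<close>

theorem Cauchy_Pompeiu_compact_support:
  assumes F: "C1_on UNIV F Fx Fy" and supp: "\<forall>z. R < norm z \<longrightarrow> F z = 0"
  shows "has_bochner_integral lborel (\<lambda>w. Complex (Fx w) (Fy w) / (w - z)) (- 2 * pi * F z)"
proof -
  have cplx: "Complex a b / w = complex_of_real ((a * Re w + b * Im w) / (norm w)\<^sup>2)
       + \<i> * complex_of_real ((b * Re w - a * Im w) / (norm w)\<^sup>2)" for a b w
    by (simp add: complex_eq_iff Re_divide Im_divide cmod_power2 del: of_real_divide)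
  have tr: "C1_on UNIV (\<lambda>w. F (z + w)) (\<lambda>w. Fx (z + w)) (\<lambda>w. Fy (z + w))"
    unfolding C1_on_def
  proof (intro conjI ballI)
    fix w
    have "((\<lambda>w. z + w) has_derivative (\<lambda>h. h)) (at w)" by (auto intro!: derivative_eq_intros)
    from has_derivative_compose[OF this C1_onD[OF F UNIV_I]]
    show "((\<lambda>w. F (z + w)) has_derivative (\<lambda>h. Re h * Fx (z + w) + Im h * Fy (z + w))) (at w)" .
  next
    have c: "continuous_on UNIV (\<lambda>w. z + w)" by (intro continuous_intros)
    show "continuous_on UNIV (\<lambda>w. Fx (z + w))" "continuous_on UNIV (\<lambda>w. Fy (z + w))"
      using continuous_on_compose2[OF C1_on_continuous(2)[OF F] c] continuous_on_compose2[OF C1_on_continuous(3)[OF F] c]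
      by simp_all
  qed
  have supp': "\<forall>w. R + norm z < norm (w::complex) \<longrightarrow> F (z + w) = 0"
  proof (intro allI impI)
    fix w :: complex assume "R + norm z < norm w"
    then have "R < norm (z + w)" using norm_triangle_ineq4[of "z + w" z] by simp
    then show "F (z + w) = 0" using supp by blast
  qed
  note CP = Cauchy_Pompeiu_at_0_real[OF tr supp']
  have [measurable]: "Fx \<in> borel_measurable borel" "Fy \<in> borel_measurable borel"
    using C1_on_continuous[OF F] by (auto intro: borel_measurable_continuous_onI)
  have [measurable]: "(\<lambda>w. Complex (Fx w) (Fy w)) \<in> borel_measurable borel"
    unfolding Complex_eq by measurable
  have "has_bochner_integral lborel (\<lambda>w. Complex (Fx (z + w)) (Fy (z + w)) / w) (- 2 * pi * F z)"
    using has_bochner_integral_add[OF has_bochner_integral_of_real[OF CP(1)]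
        has_bochner_integral_mult_right[OF has_bochner_integral_of_real[OF CP(2)], of \<i>]]
    by (simp add: cplx)
  then have "has_bochner_integral lborel (\<lambda>w. (\<lambda>w. Complex (Fx w) (Fy w) / (w - z)) (z + w)) (- 2 * pi * F z)"
    by simp
  then show ?thesis
    unfolding has_bochner_integral_iff
    by (subst (asm) lborel_integrable_translate, measurable) (subst (asm) lborel_integral_translate, measurable)
qed

subsection \<open>Green's theorem\<close>

lemma has_vector_derivative_imp_continuous_on:
  assumes "\<And>s. (f has_vector_derivative f' s) (at s)"
  shows "continuous_on S f"
  using has_vector_derivative_continuous[OF assms] by (intro continuous_at_imp_continuous_on ballI)

text \<open>Contour integrals are parametrised over \<open>{0..1}\<close>; after stretching to
  \<open>{0..L}\<close> the factor \<open>L\<close> from the chain rule cancels.\<close>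

lemma has_integral_winding_number:
  fixes \<gamma> \<gamma>' :: "real \<Rightarrow> complex"
  assumes L: "0 < L" and d: "\<And>s. (\<gamma> has_vector_derivative \<gamma>' s) (at s)" and c: "continuous_on UNIV \<gamma>'"
    and w: "w \<notin> \<gamma> ` {0..L}"
  shows "((\<lambda>s. \<gamma>' s / (\<gamma> s - w)) has_integral 2 * pi * \<i> * winding_number (\<lambda>t. \<gamma> (L * t)) w) {0..L}"
proof -
  let ?p = "\<lambda>t. \<gamma> (L * t)"
  have dp: "(?p has_vector_derivative L *\<^sub>R \<gamma>' (L * t)) (at t)" for t
    using vector_diff_chain_at[of "\<lambda>t. L * t" L t \<gamma>] d[of "L * t"]
    by (auto simp: o_def has_real_derivative_iff_has_vector_derivative[symmetric]
        intro!: derivative_eq_intros)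
  have "continuous_on UNIV (\<lambda>t. L *\<^sub>R \<gamma>' (L * t))"
    by (intro continuous_intros continuous_on_compose2[OF c]) auto
  then have "?p C1_differentiable_on {0..1}"
    unfolding C1_differentiable_on_def
    by (intro exI[of _ "\<lambda>t. L *\<^sub>R \<gamma>' (L * t)"] conjI ballI dp) (rule continuous_on_subset, auto)
  then have v: "valid_path ?p"
    by (simp add: valid_path_def C1_differentiable_imp_piecewise)
  have img: "path_image ?p = \<gamma> ` {0..L}"
  proof -
    have "(\<lambda>t. L * t) ` {0..1} = {0..L}"
      using L by (simp add: image_mult_atLeastAtMost)
    then show ?thesis unfolding path_image_def by (metis image_image)
  qed
  from has_contour_integral_winding_number[OF v] w
  have "((\<lambda>t. 1 / (?p t - w) * vector_derivative ?p (at t within {0..1})) has_integral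
      2 * pi * \<i> * winding_number ?p w) {0..1}"
    by (simp add: img has_contour_integral_def)
  then have "((\<lambda>t. 1 / (?p t - w) * (L *\<^sub>R \<gamma>' (L * t))) has_integral
      2 * pi * \<i> * winding_number ?p w) {0..1}"
    by (rule has_integral_eq[rotated]) (simp add: vector_derivative_at_within_ivl[OF dp])
  from has_integral_stretch_real[OF this, of "1 / L"] L
  have "((\<lambda>s. 1 / (\<gamma> s - w) * (L *\<^sub>R \<gamma>' s)) has_integral
      L *\<^sub>R (2 * pi * \<i> * winding_number ?p w)) {0..L}"
    by (simp add: image_mult_atLeastAtMost mult.commute[of _ L])
  from has_integral_cmul[OF this, of "1 / L"]
  have "((\<lambda>s. (1 / L) *\<^sub>R (1 / (\<gamma> s - w) * (L *\<^sub>R \<gamma>' s))) has_integral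
      (1 / L) *\<^sub>R (L *\<^sub>R (2 * pi * \<i> * winding_number ?p w))) {0..L}" .
  moreover have "(1 / L) *\<^sub>R (1 / (\<gamma> s - w) * (L *\<^sub>R \<gamma>' s)) = \<gamma>' s / (\<gamma> s - w)" for s
    using L by (simp add: scaleR_conv_of_real)
  moreover have "(1 / L) *\<^sub>R (L *\<^sub>R z) = z" for z :: complex
    using L by simp
  ultimately show ?thesis by (simp only:)
qed

lemma has_integral_imp_lborel_integral:
  fixes f :: "real \<Rightarrow> complex"
  assumes "continuous_on {a..b} f" "(f has_integral I) {a..b}"
  shows "has_bochner_integral lborel (\<lambda>s. indicator {a..b} s *\<^sub>R f s) I"
proof -
  have "set_integrable lborel {a..b} f"
    using assms(1) by (intro borel_integrable_atLeastAtMost') auto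
  from set_borel_integral_eq_integral[OF this] this assms(2) show ?thesis
    by (auto simp: has_bochner_integral_iff set_integrable_def set_lebesgue_integral_def integral_unique)
qed

text \<open>Insert the Cauchy-Pompeiu formula for \<open>F (\<gamma> s)\<close> into the contour integral and exchange the
  integrals: the inner one becomes the winding number.\<close>

theorem Green_winding_number:
  fixes \<gamma> \<gamma>' :: "real \<Rightarrow> complex" and W :: "complex \<Rightarrow> real"
  assumes F: "C1_on UNIV F Fx Fy" and supp: "\<forall>z. R < norm z \<longrightarrow> F z = 0"
    and L: "0 < L" and d: "\<And>s. (\<gamma> has_vector_derivative \<gamma>' s) (at s)" and c: "continuous_on UNIV \<gamma>'"
    and W: "\<And>w. w \<notin> \<gamma> ` {0..L} \<Longrightarrow> winding_number (\<lambda>t. \<gamma> (L * t)) w = of_real (W w)"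
    and [measurable]: "W \<in> borel_measurable borel"
  shows "((\<lambda>s. F (\<gamma> s) * Re (\<gamma>' s)) has_integral - (\<integral>w. Fy w * W w \<partial>lborel)) {0..L}"
    and "((\<lambda>s. F (\<gamma> s) * Im (\<gamma>' s)) has_integral (\<integral>w. Fx w * W w \<partial>lborel)) {0..L}"
proof -
  note supp' = C1_on_outside_support[OF F supp]
  note cont = C1_on_continuous[OF F]
  define G where "G w = Complex (Fx w) (Fy w)" for w
  have c\<gamma>: "continuous_on UNIV \<gamma>"
    by (rule has_vector_derivative_imp_continuous_on) (rule d)
  have cG: "continuous_on UNIV G"
    unfolding G_def Complex_eq by (intro continuous_intros cont)
  have [measurable]: "\<gamma> \<in> borel_measurable borel" "\<gamma>' \<in> borel_measurable borel" "G \<in> borel_measurable borel"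
    using c\<gamma> c cG by (auto intro: borel_measurable_continuous_onI)
  obtain M where M: "0 < M" "\<And>w. norm (G w) \<le> M"
  proof -
    obtain M1 where M1: "\<forall>z. \<bar>Fx z\<bar> \<le> M1"
      using continuous_compact_support_bounded[OF cont(2) supp'(1)] by blast
    obtain M2 where M2: "\<forall>z. \<bar>Fy z\<bar> \<le> M2"
      using continuous_compact_support_bounded[OF cont(3) supp'(2)] by blast
    have "norm (G w) \<le> \<bar>M1\<bar> + \<bar>M2\<bar> + 1" for w
    proof -
      have "norm (G w) \<le> \<bar>Fx w\<bar> + \<bar>Fy w\<bar>" using cmod_le[of "G w"] by (simp add: G_def)
      moreover have "\<bar>Fx w\<bar> \<le> M1" "\<bar>Fy w\<bar> \<le> M2" using M1 M2 by blast+
      ultimately show ?thesis by linarith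
    qed
    moreover have "0 < \<bar>M1\<bar> + \<bar>M2\<bar> + 1" by linarith
    ultimately show thesis using that by blast
  qed
  have "bounded (\<gamma> ` {0..L})" "bounded (\<gamma>' ` {0..L})"
    using c\<gamma> c by (auto intro!: compact_imp_bounded compact_continuous_image intro: continuous_on_subset)
  then obtain B B' where B: "\<And>s. s \<in> {0..L} \<Longrightarrow> norm (\<gamma> s) \<le> B"
    and B': "\<And>s. s \<in> {0..L} \<Longrightarrow> norm (\<gamma>' s) \<le> B'"
    unfolding bounded_iff by blast
  have B'0: "0 \<le> B'" using order_trans[OF norm_ge_zero B'[of 0]] L by simp
  define h where "h s w = (indicator {0..L} s *\<^sub>R \<gamma>' s) * (G w / (w - \<gamma> s))" for s w
  have [measurable]: "(\<lambda>x. h (fst x) (snd x)) \<in> borel_measurable (borel \<Otimes>\<^sub>M borel)"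
    unfolding h_def by measurable
  have CP: "has_bochner_integral lborel (\<lambda>w. G w / (w - z)) (- 2 * pi * F z)" for z
    unfolding G_def by (rule Cauchy_Pompeiu_compact_support[OF F supp])
  \<comment> \<open>A point of the disc of radius \<open>R\<close> is at distance at most
    \<open>R + B\<close> from any curve point. Hence translates of one integrable function dominate
    the kernel for all \<open>s\<close>, and the bound \<open>C\<close> is independent of
    \<open>s\<close>.\<close>
  let ?k = "\<lambda>v::complex. M * (indicator (cball 0 (R + B)) v / norm v)"
  have k: "integrable lborel ?k"
    by (intro integrable_mult_right integrable_inverse_norm_cball)
  have mk[measurable]: "?k \<in> borel_measurable borel"
    using borel_measurable_integrable[OF k] by simp
  define C where "C = integral\<^sup>L lborel ?k"
  have kb: "(\<integral>w. norm (G w / (w - \<gamma> s)) \<partial>lborel) \<le> C" if s: "s \<in> {0..L}" for s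
  proof -
    have ki: "integrable lborel (\<lambda>w. ?k (- \<gamma> s + w))"
      using k lborel_integrable_translate[OF mk] by blast
    have "(\<integral>w. norm (G w / (w - \<gamma> s)) \<partial>lborel) \<le> (\<integral>w. ?k (- \<gamma> s + w) \<partial>lborel)"
    proof (rule integral_mono[OF _ ki])
      show "integrable lborel (\<lambda>w. norm (G w / (w - \<gamma> s)))"
        using CP[of "\<gamma> s"] by (intro integrable_norm) (auto simp: has_bochner_integral_iff)
      fix w
      show "norm (G w / (w - \<gamma> s)) \<le> ?k (- \<gamma> s + w)"
      proof (cases "norm w \<le> R")
        case True
        then have "norm (- \<gamma> s + w) \<le> R + B"
          using B[OF s] norm_triangle_ineq4[of w "\<gamma> s"] by simp
        then show ?thesis
          using M(2)[of w] by (simp add: norm_divide divide_right_mono)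
      next
        case False
        then have "G w = 0" using supp' by (simp add: G_def complex_eq_iff)
        then show ?thesis using M by simp
      qed
    qed
    also have "\<dots> = C" unfolding C_def by (rule lborel_integral_translate[OF mk])
    finally show ?thesis .
  qed
  have "0 \<le> (\<integral>w. norm (G w / (w - \<gamma> 0)) \<partial>lborel)"
    by (rule Bochner_Integration.integral_nonneg) simp
  then have C0: "0 \<le> C"
    using order_trans[OF _ kb[of 0]] L by simp
  have int: "integrable (lborel \<Otimes>\<^sub>M lborel) (\<lambda>(s, w). h s w)"
  proof (rule lborel_pair.Fubini_integrable)
    show "(\<lambda>(s, w). h s w) \<in> borel_measurable (lborel \<Otimes>\<^sub>M lborel)"
      by (simp add: case_prod_beta')
    show "AE s in lborel. integrable lborel (\<lambda>w. case (s, w) of (s, w) \<Rightarrow> h s w)"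
      unfolding h_def split_conv
      by (intro AE_I2 integrable_mult_right CP[THEN integrable.intros])
    show "integrable lborel (\<lambda>s. \<integral>w. norm (case (s, w) of (s, w) \<Rightarrow> h s w) \<partial>lborel)"
    proof (rule Bochner_Integration.integrable_bound[where f = "\<lambda>s. indicator {0..L} s * (B' * C)"])
      show "integrable lborel (\<lambda>s::real. indicator {0..L} s * (B' * C))"
        using L by (intro integrable_mult_left) auto
      show "AE s in lborel. norm (\<integral>w. norm (case (s, w) of (s, w) \<Rightarrow> h s w) \<partial>lborel)
          \<le> norm (indicator {0..L} s * (B' * C))"
      proof (rule AE_I2)
        fix s :: real
        show "norm (\<integral>w. norm (case (s, w) of (s, w) \<Rightarrow> h s w) \<partial>lborel)
          \<le> norm (indicator {0..L} s * (B' * C))"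
        proof (cases "s \<in> {0..L}")
          case True
          then have "h s w = \<gamma>' s * (G w / (w - \<gamma> s))" for w
            by (simp add: h_def)
          then have "(\<integral>w. norm (h s w) \<partial>lborel) = norm (\<gamma>' s) * (\<integral>w. norm (G w / (w - \<gamma> s)) \<partial>lborel)"
            by (simp only: norm_mult integral_mult_right_zero)
          also have "\<dots> \<le> B' * C"
            using B'[OF True] kb[OF True] B'0 by (intro mult_mono) auto
          finally have "(\<integral>w. norm (h s w) \<partial>lborel) \<le> B' * C" .
          moreover have "0 \<le> (\<integral>w. norm (h s w) \<partial>lborel)" by simp
          ultimately show ?thesis using True B'0 C0 by simp
        qed (simp add: h_def)
      qed
    qed measurable
  qed
  define A where "A = integral {0..L} (\<lambda>s. \<gamma>' s * of_real (F (\<gamma> s)))"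
  have cA: "continuous_on {0..L} (\<lambda>s. \<gamma>' s * of_real (F (\<gamma> s)))"
    by (intro continuous_intros continuous_on_subset[OF c] continuous_on_compose2[OF cont(1)]
       continuous_on_subset[OF c\<gamma>]) auto
  have A: "((\<lambda>s. \<gamma>' s * of_real (F (\<gamma> s))) has_integral A) {0..L}"
    unfolding A_def by (intro integrable_integral integrable_continuous_interval cA)
  have 1: "(\<integral>s. (\<integral>w. h s w \<partial>lborel) \<partial>lborel) = - 2 * pi * A"
  proof -
    have "(\<integral>w. h s w \<partial>lborel) = - 2 * pi * (indicator {0..L} s *\<^sub>R (\<gamma>' s * of_real (F (\<gamma> s))))" for s
    proof -
      have "(\<integral>w. h s w \<partial>lborel) = (indicator {0..L} s *\<^sub>R \<gamma>' s) * (- 2 * pi * F (\<gamma> s))"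
        unfolding h_def by (intro has_bochner_integral_integral_eq has_bochner_integral_mult_right CP)
      then show ?thesis by (simp add: mult_ac scaleR_conv_of_real)
    qed
    moreover have "has_bochner_integral lborel (\<lambda>s. - 2 * pi * (indicator {0..L} s *\<^sub>R (\<gamma>' s * of_real (F (\<gamma> s)))))
        (- 2 * pi * A)"
      by (rule has_bochner_integral_mult_right[OF has_integral_imp_lborel_integral[OF cA A]])
    ultimately show ?thesis by (simp only: has_bochner_integral_integral_eq)
  qed
  \<comment> \<open>The curve is a null set of the plane, so \<open>W\<close> may be arbitrary on
    it.\<close>
  have "\<gamma> differentiable_on {0..L}"
    unfolding differentiable_on_def
    by (intro ballI differentiableI_vector[OF has_vector_derivative_at_within[OF d]])
  then have "negligible (\<gamma> ` {0..L})"
    by (rule negligible_differentiable_image_lowdim[rotated]) simp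
  moreover have "\<gamma> ` {0..L} \<in> sets borel"
    by (intro borel_compact compact_continuous_image continuous_on_subset[OF c\<gamma>]) auto
  ultimately have ae: "AE w in lborel. w \<notin> \<gamma> ` {0..L}"
    by (rule negligible_imp_AE_lborel)
  have hs: "(\<integral>s. h s w \<partial>lborel) = - 2 * pi * \<i> * (G w * of_real (W w))" if w: "w \<notin> \<gamma> ` {0..L}" for w
  proof -
    have cw: "continuous_on {0..L} (\<lambda>s. \<gamma>' s / (\<gamma> s - w))"
      using w by (intro continuous_intros continuous_on_subset[OF c] continuous_on_subset[OF c\<gamma>]) auto
    have "h s w = - G w * (indicator {0..L} s *\<^sub>R (\<gamma>' s / (\<gamma> s - w)))" for s
      unfolding h_def by (cases "\<gamma> s = w") (auto simp: field_simps scaleR_conv_of_real)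
    then have "(\<integral>s. h s w \<partial>lborel) = - G w * (2 * pi * \<i> * winding_number (\<lambda>t. \<gamma> (L * t)) w)"
      using has_bochner_integral_mult_right[OF has_integral_imp_lborel_integral[OF cw has_integral_winding_number[OF L d c w]], of "- G w"]
      by (simp only: has_bochner_integral_integral_eq)
    then show ?thesis unfolding W[OF w] by (simp add: mult_ac)
  qed
  have ae': "AE w in lborel. (\<integral>s. h s w \<partial>lborel) = - 2 * pi * \<i> * (G w * of_real (W w))"
    using ae by eventually_elim (rule hs)
  \<comment> \<open>No bound on \<open>W\<close> is assumed; integrability of \<open>G\<close> times
    \<open>W\<close> is read off from Fubini's theorem.\<close>
  have hi: "integrable lborel (\<lambda>w. \<integral>s. h s w \<partial>lborel)"
    by (rule lborel_pair.integrable_snd[OF int])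
  have GWm: "(\<lambda>w. - 2 * pi * \<i> * (G w * of_real (W w))) \<in> borel_measurable lborel"
    by measurable
  have "integrable lborel (\<lambda>w. - 2 * pi * \<i> * (G w * of_real (W w)))"
    by (rule integrable_cong_AE_imp[OF hi GWm ae'])
  from integrable_mult_right[OF this, of "1 / (- 2 * pi * \<i>)"]
  have GW: "integrable lborel (\<lambda>w. G w * of_real (W w))" by simp
  have "(\<integral>w. (\<integral>s. h s w \<partial>lborel) \<partial>lborel) = (\<integral>w. - 2 * pi * \<i> * (G w * of_real (W w)) \<partial>lborel)"
    by (rule integral_cong_AE[OF borel_measurable_integrable[OF hi] GWm ae'])
  also have "\<dots> = - 2 * pi * \<i> * (\<integral>w. G w * of_real (W w) \<partial>lborel)"
    by (rule Bochner_Integration.integral_mult_right) (use GW in simp)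
  finally have "- 2 * pi * A = - 2 * pi * \<i> * (\<integral>w. G w * of_real (W w) \<partial>lborel)"
    using lborel_pair.Fubini_integral[OF int] 1 by simp
  then have A_eq: "A = \<i> * (\<integral>w. G w * of_real (W w) \<partial>lborel)" by simp
  \<comment> \<open>Since \<open>F\<close> and \<open>W\<close> are real, the complex identity
    splits into the two real formulas.\<close>
  have "Re A = - (\<integral>w. Fy w * W w \<partial>lborel)" "Im A = (\<integral>w. Fx w * W w \<partial>lborel)"
    using integral_Im[OF GW] integral_Re[OF GW] by (simp_all add: A_eq G_def)
  with has_integral_linear[OF A bounded_linear_Re] has_integral_linear[OF A bounded_linear_Im]
  show "((\<lambda>s. F (\<gamma> s) * Re (\<gamma>' s)) has_integral - (\<integral>w. Fy w * W w \<partial>lborel)) {0..L}"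
    and "((\<lambda>s. F (\<gamma> s) * Im (\<gamma>' s)) has_integral (\<integral>w. Fx w * W w \<partial>lborel)) {0..L}"
    by (simp_all add: o_def mult.commute)
qed

section \<open>Cutoff functions of class C1\<close>

lemma C1_on_sum:
  assumes "finite T" "\<And>i. i \<in> T \<Longrightarrow> C1_on S (F i) (Fx i) (Fy i)"
  shows "C1_on S (\<lambda>z. \<Sum>i\<in>T. F i z) (\<lambda>z. \<Sum>i\<in>T. Fx i z) (\<lambda>z. \<Sum>i\<in>T. Fy i z)"
  using assms by (induction T) (simp_all add: C1_on_const C1_on_add)

text \<open>One continuous derivative is all that the integral formulas ask of a test function, so
  the square of the positive part is smooth enough to build cutoffs from.\<close>

lemma DERIV_max_0_square: "DERIV (\<lambda>x::real. (max 0 x)\<^sup>2) x :> 2 * max 0 x"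
proof -
  consider "x < 0" | "x = 0" | "0 < x" by linarith
  then show ?thesis
  proof cases
    case 1
    have "DERIV (\<lambda>x::real. 0) x :> 2 * max 0 x" using 1 by simp
    then show ?thesis
      by (rule has_field_derivative_transform_within_open[where S = "{..<0}"]) (use 1 in auto)
  next
    case 2
    have "(\<lambda>h::real. (max 0 h)\<^sup>2 / h) = (\<lambda>h. max 0 h)"
      by (auto simp: fun_eq_iff max_def power2_eq_square)
    moreover have "((\<lambda>h::real. max 0 h) \<longlongrightarrow> max 0 0) (at 0)"
      by (intro tendsto_intros)
    ultimately show ?thesis using 2 by (simp add: DERIV_def)
  next
    case 3
    have "DERIV (\<lambda>x::real. x\<^sup>2) x :> 2 * max 0 x"
      using 3 by (auto intro!: derivative_eq_intros)
    then show ?thesis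
      by (rule has_field_derivative_transform_within_open[where S = "{0<..}"]) (use 3 in auto)
  qed
qed

text \<open>Besides serving the cutoffs, it decreases radially, and the argument for the inward
  normal relies on that.\<close>

definition bump :: "complex \<Rightarrow> real \<Rightarrow> complex \<Rightarrow> real" where
  "bump c r z = (max 0 (1 - (norm (z - c))\<^sup>2 / r\<^sup>2))\<^sup>2"

lemma C1_on_bump:
  "C1_on S (bump c r) (\<lambda>z. 2 * max 0 (1 - (norm (z - c))\<^sup>2 / r\<^sup>2) * (- 2 * (Re z - Re c) / r\<^sup>2))
     (\<lambda>z. 2 * max 0 (1 - (norm (z - c))\<^sup>2 / r\<^sup>2) * (- 2 * (Im z - Im c) / r\<^sup>2))"
proof -
  have "C1_on S (\<lambda>z. 1 - (norm (z - c))\<^sup>2 / r\<^sup>2) (\<lambda>z. - 2 * (Re z - Re c) / r\<^sup>2) (\<lambda>z. - 2 * (Im z - Im c) / r\<^sup>2)"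
    unfolding C1_on_def
  proof (intro conjI ballI)
    fix z
    have "((\<lambda>z. 1 - ((Re z - Re c)\<^sup>2 + (Im z - Im c)\<^sup>2) * k) has_derivative
       (\<lambda>h. Re h * (- 2 * (Re z - Re c) * k) + Im h * (- 2 * (Im z - Im c) * k))) (at z)" for k
      by (auto intro!: derivative_eq_intros simp: fun_eq_iff algebra_simps)
    then show "((\<lambda>z. 1 - (norm (z - c))\<^sup>2 / r\<^sup>2) has_derivative
        (\<lambda>h. Re h * (- 2 * (Re z - Re c) / r\<^sup>2) + Im h * (- 2 * (Im z - Im c) / r\<^sup>2))) (at z)"
      by (simp only: cmod_power2 minus_complex.sel divide_inverse)
  next
    show "continuous_on S (\<lambda>z. - 2 * (Re z - Re c) / r\<^sup>2)" "continuous_on S (\<lambda>z. - 2 * (Im z - Im c) / r\<^sup>2)"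
      unfolding divide_inverse by (intro continuous_intros)+
  qed
  from C1_on_compose[OF this DERIV_max_0_square] show ?thesis
    unfolding bump_def by (simp add: continuous_intros)
qed

lemma bump_nonneg: "0 \<le> bump c r z"
  by (simp add: bump_def)

lemma bump_pos: "0 < r \<Longrightarrow> norm (z - c) < r \<Longrightarrow> 0 < bump c r z"
  by (simp add: bump_def field_simps power_strict_mono)

lemma bump_eq_0: "0 < r \<Longrightarrow> r \<le> norm (z - c) \<Longrightarrow> bump c r z = 0"
  by (simp add: bump_def field_simps power_mono)

text \<open>A finite sum of bumps over a cover of \<open>K\<close> attains a positive minimum
  \<open>m\<close> on \<open>K\<close>. Composition with
  \<open>1 - (max 0 (1 - t / m))\<^sup>2\<close>, which is 0 at \<open>t = 0\<close> and 1 from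
  \<open>m\<close> on, flattens the sum to 1 on \<open>K\<close>.\<close>

lemma C1_on_cutoff:
  assumes K: "compact K" and U: "open U" "K \<subseteq> U"
  obtains \<psi> \<psi>x \<psi>y C where "C1_on UNIV \<psi> \<psi>x \<psi>y" "compact C" "C \<subseteq> U" "\<And>z. z \<notin> C \<Longrightarrow> \<psi> z = 0"
    "\<And>z. z \<in> K \<Longrightarrow> \<psi> z = 1"
proof (cases "K = {}")
  case True
  show ?thesis by (rule that[of "\<lambda>_. 0" "\<lambda>_. 0" "\<lambda>_. 0" "{}"]) (simp_all add: True C1_on_const)
next
  case ne: False
  have "\<forall>x\<in>K. \<exists>r>0. cball x r \<subseteq> U"
    using U open_contains_cball by blast
  then obtain r where r: "\<And>x. x \<in> K \<Longrightarrow> 0 < r x" "\<And>x. x \<in> K \<Longrightarrow> cball x (r x) \<subseteq> U"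
    by metis
  have "K \<subseteq> (\<Union>x\<in>K. ball x (r x))"
    using r(1) by force
  from compactE_image[OF K _ this] obtain T where T: "T \<subseteq> K" "finite T" "K \<subseteq> (\<Union>x\<in>T. ball x (r x))"
    by auto
  define S where "S z = (\<Sum>x\<in>T. bump x (r x) z)" for z
  define Sx where "Sx z = (\<Sum>x\<in>T. 2 * max 0 (1 - (norm (z - x))\<^sup>2 / (r x)\<^sup>2) * (- 2 * (Re z - Re x) / (r x)\<^sup>2))" for z
  define Sy where "Sy z = (\<Sum>x\<in>T. 2 * max 0 (1 - (norm (z - x))\<^sup>2 / (r x)\<^sup>2) * (- 2 * (Im z - Im x) / (r x)\<^sup>2))" for z
  have CS: "C1_on UNIV S Sx Sy"
    unfolding S_def[abs_def] Sx_def[abs_def] Sy_def[abs_def]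
    by (intro C1_on_sum T C1_on_bump)
  have Spos: "0 < S z" if z: "z \<in> K" for z
  proof -
    obtain x where x: "x \<in> T" "z \<in> ball x (r x)" using T z by blast
    have "0 < bump x (r x) z"
      using x T r by (intro bump_pos) (auto simp: dist_norm norm_minus_commute)
    also have "\<dots> \<le> S z"
      unfolding S_def using x T by (intro member_le_sum) (auto simp: bump_nonneg)
    finally show ?thesis .
  qed
  obtain z0 where z0: "z0 \<in> K" "\<And>z. z \<in> K \<Longrightarrow> S z0 \<le> S z"
    using continuous_attains_inf[OF K ne continuous_on_subset[OF C1_on_continuous(1)[OF CS]]] by auto
  define m where "m = S z0"
  have m: "0 < m" using Spos z0 by (simp add: m_def)
  define C where "C = (\<Union>x\<in>T. cball x (r x))"
  have S0: "S z = 0" if "z \<notin> C" for z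
    unfolding S_def
  proof (intro sum.neutral ballI bump_eq_0)
    fix x assume x: "x \<in> T"
    show "0 < r x" using x T r by auto
    show "r x \<le> norm (z - x)" using that x by (force simp: C_def dist_norm norm_minus_commute)
  qed
  have d: "DERIV (\<lambda>t. 1 - (max 0 (1 - t / m))\<^sup>2) t :> 2 * max 0 (1 - t / m) * (1 / m)" for t
  proof -
    have "DERIV (\<lambda>t. 1 - t / m) t :> - (1 / m)"
      using m by (auto intro!: derivative_eq_intros)
    from DERIV_diff[OF DERIV_const[of 1] DERIV_chain2[where f = "\<lambda>x. (max 0 x)\<^sup>2", OF DERIV_max_0_square this]]
    show ?thesis by simp
  qed
  have "continuous_on UNIV (\<lambda>t. 2 * max 0 (1 - t / m) * (1 / m))"
    unfolding divide_inverse by (intro continuous_intros)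
  note C1_on_compose[OF CS d this]
  then show ?thesis
  proof (rule that)
    show "compact C" unfolding C_def using T by (intro compact_UN) auto
    show "C \<subseteq> U" unfolding C_def using T r by blast
    show "1 - (max 0 (1 - S z / m))\<^sup>2 = 0" if "z \<notin> C" for z
      using S0[OF that] by simp
    show "1 - (max 0 (1 - S z / m))\<^sup>2 = 1" if "z \<in> K" for z
      using z0(2)[OF that] m by (simp add: m_def[symmetric] max_def field_simps)
  qed
qed

text \<open>The open sets \<open>U\<close> and \<open>- C\<close> cover the plane: on the first the
  product rule applies, on the second the product with the cutoff vanishes identically.\<close>

lemma C1_on_extend_compact_support:
  assumes K: "compact K" and U: "open U" "K \<subseteq> U" and F: "C1_on U F Fx Fy"
  obtains G Gx Gy R where "C1_on UNIV G Gx Gy" "\<forall>z. R < norm z \<longrightarrow> G z = 0" "\<And>z. z \<in> K \<Longrightarrow> G z = F z"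
proof -
  obtain \<psi> \<psi>x \<psi>y C where \<psi>: "C1_on UNIV \<psi> \<psi>x \<psi>y" "compact C" "C \<subseteq> U" "\<And>z. z \<notin> C \<Longrightarrow> \<psi> z = 0"
    "\<And>z. z \<in> K \<Longrightarrow> \<psi> z = 1"
    using C1_on_cutoff[OF K U] by metis
  let ?G = "\<lambda>z. \<psi> z * F z" and ?Gx = "\<lambda>z. if z \<in> C then \<psi> z * Fx z + \<psi>x z * F z else 0"
    and ?Gy = "\<lambda>z. if z \<in> C then \<psi> z * Fy z + \<psi>y z * F z else 0"
  have oC: "open (- C)" using \<psi>(2) by (simp add: compact_imp_closed open_Compl)
  have z0: "\<psi>x z = 0 \<and> \<psi>y z = 0" if z: "z \<notin> C" for z
  proof -
    have "(\<psi> has_derivative (\<lambda>h. 0)) (at z)"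
      by (rule has_derivative_transform_within_open[OF has_derivative_const[of 0] oC]) (use z \<psi> in auto)
    with C1_onD[OF \<psi>(1), of z] have e: "(\<lambda>h. Re h * \<psi>x z + Im h * \<psi>y z) = (\<lambda>h. 0)"
      using has_derivative_unique by blast
    show ?thesis
      using fun_cong[OF e, of 1] fun_cong[OF e, of \<i>] by auto
  qed
  have on_U: "C1_on U ?G ?Gx ?Gy"
  proof -
    have eq: "?Gx = (\<lambda>z. \<psi> z * Fx z + \<psi>x z * F z)" "?Gy = (\<lambda>z. \<psi> z * Fy z + \<psi>y z * F z)"
      using z0 \<psi>(4) by (auto simp: fun_eq_iff)
    show ?thesis unfolding eq by (rule C1_on_mult[OF C1_on_subset[OF \<psi>(1)] F]) simp
  qed
  have on_C: "C1_on (- C) ?G ?Gx ?Gy"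
    unfolding C1_on_def
  proof (intro conjI ballI)
    fix z assume z: "z \<in> - C"
    have "(?G has_derivative (\<lambda>h. 0)) (at z)"
      by (rule has_derivative_transform_within_open[OF has_derivative_const[of 0] oC]) (use z \<psi> in auto)
    then show "(?G has_derivative (\<lambda>h. Re h * ?Gx z + Im h * ?Gy z)) (at z)"
      using z by simp
  next
    show "continuous_on (- C) ?Gx" "continuous_on (- C) ?Gy"
      by (rule continuous_on_cong[THEN iffD1, OF refl _ continuous_on_const[of _ 0]]; simp)+
  qed
  have un: "UNIV = U \<union> - C" using \<psi>(3) by blast
  have G: "C1_on UNIV ?G ?Gx ?Gy"
  proof -
    have "continuous_on (U \<union> - C) ?Gx" "continuous_on (U \<union> - C) ?Gy"
      using C1_on_continuous[OF on_U] C1_on_continuous[OF on_C]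
      by (auto intro!: continuous_on_open_Un U oC simp del: continuous_on_If)
    moreover have "(?G has_derivative (\<lambda>h. Re h * ?Gx z + Im h * ?Gy z)) (at z)" for z
    proof (cases "z \<in> U")
      case True
      show ?thesis by (rule C1_onD[OF on_U True])
    next
      case False
      then have "z \<in> - C" using un by blast
      from C1_onD[OF on_C this] show ?thesis .
    qed
    ultimately show ?thesis unfolding un[symmetric] C1_on_def by blast
  qed
  obtain R where R: "\<And>z. z \<in> C \<Longrightarrow> norm z \<le> R"
    using compact_imp_bounded[OF \<psi>(2)] by (auto simp: bounded_iff)
  show ?thesis
  proof (rule that[OF G])
    show "\<forall>z. R < norm z \<longrightarrow> \<psi> z * F z = 0" using R \<psi>(4) by force
    show "\<psi> z * F z = F z" if "z \<in> K" for z using \<psi>(5)[OF that] by simp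
  qed
qed

text \<open>Off the curve the winding number is the indicator function of \<open>D\<close>.
  Replacing \<open>F\<close> by a compactly supported extension changes neither its values on the
  curve nor, \<open>D\<close> being open, its partial derivatives in \<open>D\<close>.\<close>

theorem Green_domain:
  fixes \<gamma> \<gamma>' :: "real \<Rightarrow> complex"
  assumes L: "0 < L" and d: "\<And>s. (\<gamma> has_vector_derivative \<gamma>' s) (at s)" and c: "continuous_on UNIV \<gamma>'"
    and D: "open D" "bounded D" "frontier D = \<gamma> ` {0..L}"
    and W: "\<And>w. w \<in> D \<Longrightarrow> winding_number (\<lambda>t. \<gamma> (L * t)) w = 1"
      "\<And>w. w \<notin> closure D \<Longrightarrow> winding_number (\<lambda>t. \<gamma> (L * t)) w = 0"
    and U: "open U" "closure D \<subseteq> U" and F: "C1_on U F Fx Fy"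
  shows "((\<lambda>s. F (\<gamma> s) * Re (\<gamma>' s)) has_integral - (LINT w:D|lborel. Fy w)) {0..L}"
    and "((\<lambda>s. F (\<gamma> s) * Im (\<gamma>' s)) has_integral (LINT w:D|lborel. Fx w)) {0..L}"
proof -
  have "compact (closure D)" using D by simp
  from C1_on_extend_compact_support[OF this U F] obtain G Gx Gy R where
    G: "C1_on UNIV G Gx Gy" "\<forall>z. R < norm z \<longrightarrow> G z = 0" "\<And>z. z \<in> closure D \<Longrightarrow> G z = F z"
    by metis
  have eq: "Gx z = Fx z \<and> Gy z = Fy z" if z: "z \<in> D" for z
  proof -
    have zU: "z \<in> U" using z U closure_subset by blast
    have "(G has_derivative (\<lambda>h. Re h * Fx z + Im h * Fy z)) (at z)"
      by (rule has_derivative_transform_within_open[OF C1_onD[OF F zU] D(1) z])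
         (use G(3) closure_subset in force)
    with C1_onD[OF G(1), of z] have e: "(\<lambda>h. Re h * Gx z + Im h * Gy z) = (\<lambda>h. Re h * Fx z + Im h * Fy z)"
      using has_derivative_unique by blast
    show ?thesis using fun_cong[OF e, of 1] fun_cong[OF e, of \<i>] by auto
  qed
  have W': "winding_number (\<lambda>t. \<gamma> (L * t)) w = of_real (indicator D w)" if "w \<notin> \<gamma> ` {0..L}" for w
  proof (cases "w \<in> D")
    case False
    then have "w \<notin> D \<union> frontier D" using that D(3) by simp
    then have "w \<notin> closure D" by (metis closure_Un_frontier)
    then show ?thesis using W(2) False by simp
  qed (simp add: W(1))
  have m: "indicator D \<in> borel_measurable (borel :: complex measure)"
    using D(1) by (simp add: borel_open)
  note Gr = Green_winding_number[OF G(1,2) L d c W' m]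
  have bd: "G (\<gamma> s) = F (\<gamma> s)" if "s \<in> {0..L}" for s
    using G(3) D(3) that closure_Un_frontier by blast
  have "(LINT w|lborel. Gy w * indicator D w) = (LINT w:D|lborel. Fy w)"
    "(LINT w|lborel. Gx w * indicator D w) = (LINT w:D|lborel. Fx w)"
    unfolding set_lebesgue_integral_def
    by (rule Bochner_Integration.integral_cong; use eq in \<open>simp add: indicator_def\<close>)+
  with Gr has_integral_eq[of "{0..L}" "\<lambda>s. G (\<gamma> s) * Re (\<gamma>' s)" "\<lambda>s. F (\<gamma> s) * Re (\<gamma>' s)"]
     has_integral_eq[of "{0..L}" "\<lambda>s. G (\<gamma> s) * Im (\<gamma>' s)" "\<lambda>s. F (\<gamma> s) * Im (\<gamma>' s)"] bd
  show "((\<lambda>s. F (\<gamma> s) * Re (\<gamma>' s)) has_integral - (LINT w:D|lborel. Fy w)) {0..L}"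
    and "((\<lambda>s. F (\<gamma> s) * Im (\<gamma>' s)) has_integral (LINT w:D|lborel. Fx w)) {0..L}"
    by simp_all
qed

subsection \<open>The inward normal of a Jordan domain\<close>

text \<open>Division by \<open>\<gamma>' s0\<close> makes the tangent the real axis. If the linear
  approximation is off by at most a quarter of \<open>\<bar>s - s0\<bar>\<close>, then the real part
  is at least three quarters of it, and the slope is at most 1/3. The second claim is continuity of
  the velocity.\<close>

lemma eventually_curve_in_double_cone:
  fixes \<gamma> \<gamma>' :: "real \<Rightarrow> complex"
  assumes d: "(\<gamma> has_vector_derivative \<gamma>' s0) (at s0)" and c: "continuous (at s0) \<gamma>'" and nz: "\<gamma>' s0 \<noteq> 0"
  shows "\<forall>\<^sub>F s in nhds s0. \<bar>Im ((\<gamma> s - \<gamma> s0) / \<gamma>' s0)\<bar> \<le> \<bar>Re ((\<gamma> s - \<gamma> s0) / \<gamma>' s0)\<bar> / 2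
           \<and> 0 < Re (\<gamma>' s / \<gamma>' s0)"
proof -
  let ?v = "\<gamma>' s0"
  have "0 < norm ?v / 4" using nz by simp
  then obtain e where e: "0 < e" "\<And>s. norm (s - s0) < e \<Longrightarrow>
      norm (\<gamma> s - \<gamma> s0 - (s - s0) *\<^sub>R ?v) \<le> norm ?v / 4 * norm (s - s0)"
    using d unfolding has_vector_derivative_def has_derivative_at_alt by blast
  have "\<forall>\<^sub>F s in nhds s0. \<bar>Im ((\<gamma> s - \<gamma> s0) / ?v)\<bar> \<le> \<bar>Re ((\<gamma> s - \<gamma> s0) / ?v)\<bar> / 2"
    unfolding eventually_nhds_metric
  proof (intro exI[of _ e] conjI allI impI e(1))
    fix s assume "dist s s0 < e"
    then have b: "norm (\<gamma> s - \<gamma> s0 - (s - s0) *\<^sub>R ?v) \<le> norm ?v / 4 * \<bar>s - s0\<bar>"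
      using e(2)[of s] by (simp add: dist_real_def)
    define \<zeta> where "\<zeta> = (\<gamma> s - \<gamma> s0) / ?v"
    have "\<gamma> s - \<gamma> s0 = \<zeta> * ?v" using nz by (simp add: \<zeta>_def)
    then have "\<gamma> s - \<gamma> s0 - (s - s0) *\<^sub>R ?v = (\<zeta> - of_real (s - s0)) * ?v"
      by (simp only: left_diff_distrib scaleR_conv_of_real)
    with b nz have "norm (\<zeta> - of_real (s - s0)) \<le> \<bar>s - s0\<bar> / 4"
      by (simp add: norm_mult)
    then have "\<bar>Re \<zeta> - (s - s0)\<bar> \<le> \<bar>s - s0\<bar> / 4" "\<bar>Im \<zeta>\<bar> \<le> \<bar>s - s0\<bar> / 4"
      using abs_Re_le_cmod[of "\<zeta> - of_real (s - s0)"] abs_Im_le_cmod[of "\<zeta> - of_real (s - s0)"] by simp_all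
    moreover have "\<bar>s - s0\<bar> \<le> \<bar>Re \<zeta>\<bar> + \<bar>Re \<zeta> - (s - s0)\<bar>"
      using abs_triangle_ineq4[of "Re \<zeta>" "Re \<zeta> - (s - s0)"] by simp
    ultimately have "\<bar>Im \<zeta>\<bar> \<le> \<bar>Re \<zeta>\<bar> / 2"
      using abs_ge_zero[of "s - s0"] by linarith
    then show "\<bar>Im ((\<gamma> s - \<gamma> s0) / ?v)\<bar> \<le> \<bar>Re ((\<gamma> s - \<gamma> s0) / ?v)\<bar> / 2"
      by (simp add: \<zeta>_def)
  qed
  moreover have "\<forall>\<^sub>F s in nhds s0. 0 < Re (\<gamma>' s / ?v)"
  proof (rule order_tendstoD(1))
    have "(\<gamma>' \<longlongrightarrow> ?v) (nhds s0)"
      using c by (simp add: continuous_at tendsto_nhds_iff)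
    then show "((\<lambda>s. Re (\<gamma>' s / ?v)) \<longlongrightarrow> Re (?v / ?v)) (nhds s0)"
      using nz by (intro tendsto_intros)
    show "0 < Re (?v / ?v)" using nz by simp
  qed
  ultimately show ?thesis by eventually_elim simp
qed

text \<open>Since \<open>\<gamma>\<close> is only used on \<open>[0, L]\<close>, simplicity and smooth closing are expressed together: parameters
  of the same point, such as \<open>0\<close> and \<open>L\<close>, have the same velocity.\<close>

locale smooth_Jordan_domain =
  fixes L :: real and \<gamma> \<gamma>' :: "real \<Rightarrow> complex" and D :: "complex set"
  assumes L: "0 < L" and d: "(\<gamma> has_vector_derivative \<gamma>' s) (at s)" and c: "continuous_on UNIV \<gamma>'"
    and nz: "s \<in> {0..L} \<Longrightarrow> \<gamma>' s \<noteq> 0"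
    and simple: "\<lbrakk>s \<in> {0..L}; t \<in> {0..L}; \<gamma> s = \<gamma> t\<rbrakk> \<Longrightarrow> \<gamma>' s = \<gamma>' t"
    and D: "open D" "bounded D" "frontier D = \<gamma> ` {0..L}"
    and W: "\<And>w. w \<in> D \<Longrightarrow> winding_number (\<lambda>t. \<gamma> (L * t)) w = 1"
      "\<And>w. w \<notin> closure D \<Longrightarrow> winding_number (\<lambda>t. \<gamma> (L * t)) w = 0"
begin

lemma curve_continuous: "continuous_on UNIV \<gamma>"
  by (rule has_vector_derivative_imp_continuous_on) (rule d)

lemma curve_in_closure: "s \<in> {0..L} \<Longrightarrow> \<gamma> s \<in> closure D"
  using D(3) by (metis UnCI closure_Un_frontier imageI)

lemma set_integrable_continuous_on_closure:
  fixes f :: "complex \<Rightarrow> real"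
  assumes "continuous_on (closure D) f"
  shows "set_integrable lborel D f"
proof -
  have "set_integrable lborel (closure D) f"
    unfolding set_integrable_def using D(2) assms by (intro borel_integrable_compact) auto
  then show ?thesis
    by (rule set_integrable_subset) (use D closure_subset in \<open>auto simp: borel_open\<close>)
qed

text \<open>Closeness is measured in the plane, not in the parameter, so that distant parameters
  cannot bring the curve back at another angle. A sequence of violations would have a limit
  parameter \<open>l\<close> with the same point and, by \<open>simple\<close>, the same velocity;
  near \<open>l\<close> the cone condition holds.\<close>

lemma curve_near_point:
  assumes s0: "s0 \<in> {0..L}"
  shows "\<exists>r>0. \<forall>s\<in>{0..L}. norm (\<gamma> s - \<gamma> s0) < r \<longrightarrow>
     \<bar>Im ((\<gamma> s - \<gamma> s0) / \<gamma>' s0)\<bar> \<le> \<bar>Re ((\<gamma> s - \<gamma> s0) / \<gamma>' s0)\<bar> / 2 \<and> 0 < Re (\<gamma>' s / \<gamma>' s0)"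
    (is "\<exists>r>0. \<forall>s\<in>{0..L}. _ \<longrightarrow> ?P s")
proof (rule ccontr)
  assume neg: "\<not> ?thesis"
  have "\<forall>n. \<exists>s\<in>{0..L}. norm (\<gamma> s - \<gamma> s0) < inverse (real (Suc n)) \<and> \<not> ?P s"
  proof
    fix n
    have "0 < inverse (real (Suc n))" by simp
    then show "\<exists>s\<in>{0..L}. norm (\<gamma> s - \<gamma> s0) < inverse (real (Suc n)) \<and> \<not> ?P s"
      using neg by blast
  qed
  then obtain \<sigma> where \<sigma>: "\<And>n. \<sigma> n \<in> {0..L}" "\<And>n. norm (\<gamma> (\<sigma> n) - \<gamma> s0) < inverse (real (Suc n))"
      "\<And>n. \<not> ?P (\<sigma> n)"
    by metis
  obtain l \<rho> where l: "l \<in> {0..L}" "strict_mono \<rho>" "(\<sigma> \<circ> \<rho>) \<longlonglongrightarrow> l"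
    using compact_imp_seq_compact[OF compact_Icc, of 0 L] \<sigma>(1) unfolding seq_compact_def by blast
  have cont: "continuous (at l) \<gamma>" "continuous (at l) \<gamma>'"
    using curve_continuous c by (simp_all add: continuous_on_eq_continuous_at)
  have "(\<lambda>n. \<gamma> (\<sigma> (\<rho> n))) \<longlonglongrightarrow> \<gamma> l"
    using isCont_tendsto_compose[OF cont(1) l(3)] by (simp add: o_def)
  moreover have "(\<lambda>n. \<gamma> (\<sigma> n) - \<gamma> s0) \<longlonglongrightarrow> 0"
    by (rule Lim_null_comparison[OF always_eventually[OF allI[OF less_imp_le[OF \<sigma>(2)]]] LIMSEQ_inverse_real_of_nat])
  then have "(\<lambda>n. \<gamma> (\<sigma> n)) \<longlonglongrightarrow> \<gamma> s0" by (rule LIM_zero_cancel)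
  then have "(\<lambda>n. \<gamma> (\<sigma> (\<rho> n))) \<longlonglongrightarrow> \<gamma> s0"
    using LIMSEQ_subseq_LIMSEQ[OF _ l(2)] by (simp add: o_def)
  ultimately have eq: "\<gamma> l = \<gamma> s0" by (rule LIMSEQ_unique)
  then have eq': "\<gamma>' l = \<gamma>' s0" using simple l(1) s0 by blast
  have "\<forall>\<^sub>F s in nhds l. ?P s"
    using eventually_curve_in_double_cone[OF d[of l] cont(2) nz[OF l(1)]] unfolding eq eq' .
  then have "\<forall>\<^sub>F n in sequentially. ?P ((\<sigma> \<circ> \<rho>) n)"
    using l(3) filterlim_iff[of "\<sigma> \<circ> \<rho>" "nhds l" sequentially] by blast
  then have "\<exists>n. ?P ((\<sigma> \<circ> \<rho>) n)"
    by (rule eventually_happens'[OF sequentially_bot])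
  then show False using \<sigma>(3) by auto
qed

text \<open>The flux of a bump centred slightly to the left of the curve is positive, so the domain meets
  the set where the bump increases in the direction of the right normal; that set lies in a convex
  cone to the left of the curve, which the curve does not meet.\<close>

lemma inward_normal_in_domain:
  assumes s0: "s0 \<in> {0..L}"
  shows "\<exists>h>0. \<forall>t. 0 < t \<and> t < h \<longrightarrow> \<gamma> s0 + t *\<^sub>R (\<i> * (\<gamma>' s0 /\<^sub>R norm (\<gamma>' s0))) \<in> D"
proof -
  define p where "p = \<gamma> s0"
  define v where "v = \<gamma>' s0"
  have v: "v \<noteq> 0" using nz[OF s0] by (simp add: v_def)
  obtain r where r: "0 < r" "\<And>s. s \<in> {0..L} \<Longrightarrow> norm (\<gamma> s - p) < r \<Longrightarrow>
     \<bar>Im ((\<gamma> s - p) / v)\<bar> \<le> \<bar>Re ((\<gamma> s - p) / v)\<bar> / 2 \<and> 0 < Re (\<gamma>' s / v)"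
    using curve_near_point[OF s0] unfolding p_def v_def by blast
  \<comment> \<open>The bump is centred at distance \<open>h * norm v\<close> from \<open>p\<close>
    and has radius \<open>b = 2 * h * norm v\<close>. It thus contains \<open>p\<close> and stays
    within distance \<open>r\<close>, where the cone condition and the direction of the velocity are
    controlled.\<close>
  define h where "h = r / (3 * norm v)"
  have h: "0 < h" "3 * h * norm v = r" using r(1) v by (simp_all add: h_def)
  define z0 where "z0 = p + \<i> * of_real h * v"
  define b where "b = 2 * h * norm v"
  have b: "0 < b" using h v by (simp add: b_def)
  have z0p: "norm (z0 - p) = h * norm v" using h by (simp add: z0_def norm_mult)
  \<comment> \<open>In the coordinate \<open>\<zeta>\<close> the tangent is the real axis, and
    \<open>S\<close> is the part of the upper cone that lies strictly above the double cone
    containing the curve.\<close>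
  define S where "S = (\<lambda>\<zeta>. p + v * \<zeta>) ` (ball 0 (3 * h) \<inter> {\<zeta>. \<bar>Re \<zeta>\<bar> < 2 * Im \<zeta>})"
  have "{\<zeta>. \<bar>Re \<zeta>\<bar> < 2 * Im \<zeta>} = {\<zeta>. Complex 1 (-2) \<bullet> \<zeta> < 0} \<inter> {\<zeta>. Complex (-1) (-2) \<bullet> \<zeta> < 0}"
    by (auto simp: inner_complex_def)
  then have "convex {\<zeta>. \<bar>Re \<zeta>\<bar> < 2 * Im \<zeta>}"
    by (simp add: convex_Int convex_halfspace_lt)
  then have "connected S"
    unfolding S_def by (intro connected_continuous_image convex_connected convex_Int convex_ball continuous_intros)
  moreover have "S \<inter> frontier D = {}"
  proof -
    have False if s: "s \<in> {0..L}" and \<zeta>: "\<gamma> s = p + v * \<zeta>" "norm \<zeta> < 3 * h" "\<bar>Re \<zeta>\<bar> < 2 * Im \<zeta>" for s \<zeta>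
    proof -
      have "norm (\<gamma> s - p) = norm v * norm \<zeta>" using \<zeta>(1) by (simp add: norm_mult)
      also have "\<dots> < norm v * (3 * h)" using \<zeta>(2) v by simp
      finally have "norm (\<gamma> s - p) < r" using h(2) by (simp add: mult_ac)
      from r(2)[OF s this] have "\<bar>Im ((\<gamma> s - p) / v)\<bar> \<le> \<bar>Re ((\<gamma> s - p) / v)\<bar> / 2" by simp
      moreover have "(\<gamma> s - p) / v = \<zeta>" using \<zeta>(1) v by simp
      ultimately show False using \<zeta>(3) by simp
    qed
    then have "x \<notin> \<gamma> ` {0..L}" if "x \<in> S" for x
      using that unfolding S_def by force
    then show ?thesis unfolding D(3) by blast
  qed
  moreover have "S \<inter> D \<noteq> {}"
  proof -
    let ?\<phi> = "bump z0 b"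
    define m where "m w = 2 * max 0 (1 - (norm (w - z0))\<^sup>2 / b\<^sup>2)" for w
    define \<phi>x where "\<phi>x w = m w * (- 2 * (Re w - Re z0) / b\<^sup>2)" for w
    define \<phi>y where "\<phi>y w = m w * (- 2 * (Im w - Im z0) / b\<^sup>2)" for w
    have C1: "C1_on UNIV ?\<phi> \<phi>x \<phi>y"
      using C1_on_bump[of UNIV z0 b] unfolding \<phi>x_def[abs_def] \<phi>y_def[abs_def] m_def .
    note Gr = Green_domain[OF L d c D W open_UNIV subset_UNIV C1]
    \<comment> \<open>The second factor is the inner product of \<open>v\<close> and
      \<open>\<gamma>' s\<close>: this is the flux density of the bump times the constant vector
      \<open>- \<i> * v\<close>, whose components are \<open>Im v\<close> and
      \<open>- Re v\<close>.\<close>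
    define f where "f s = ?\<phi> (\<gamma> s) * (Im v * Im (\<gamma>' s) + Re v * Re (\<gamma>' s))" for s
    have si: "set_integrable lborel D \<phi>x" "set_integrable lborel D \<phi>y"
      by (intro set_integrable_continuous_on_closure continuous_on_subset[OF C1_on_continuous(2)[OF C1]]
         continuous_on_subset[OF C1_on_continuous(3)[OF C1]] subset_UNIV)+
    define J where "J = (LINT w:D|lborel. Im v * \<phi>x w - Re v * \<phi>y w)"
    have J_eq: "J = Im v * (LINT w:D|lborel. \<phi>x w) + Re v * - (LINT w:D|lborel. \<phi>y w)"
      unfolding J_def using si by (subst set_integral_diff) auto
    have fJ: "(f has_integral J) {0..L}"
      unfolding J_eq
      by (rule has_integral_eq[OF _ has_integral_add[OF has_integral_mult_right[OF Gr(2), of "Im v"]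
            has_integral_mult_right[OF Gr(1), of "Re v"]]])
         (simp add: f_def algebra_simps)
    have Re_div: "Re (x / v) = (Im v * Im x + Re v * Re x) / (norm v)\<^sup>2"
      and Im_div: "Im (x / v) = (Re v * Im x - Im v * Re x) / (norm v)\<^sup>2" for x
      by (simp_all add: Re_divide Im_divide cmod_power2 mult_ac add.commute)
    have f_nonneg: "0 \<le> f s" and f_pos: "norm (\<gamma> s - z0) < b \<Longrightarrow> 0 < f s" if s: "s \<in> {0..L}" for s
    proof -
      have pos: "0 < Im v * Im (\<gamma>' s) + Re v * Re (\<gamma>' s)" if "norm (\<gamma> s - z0) < b"
      proof -
        have "norm (\<gamma> s - p) \<le> norm (\<gamma> s - z0) + norm (z0 - p)"
          using norm_triangle_ineq[of "\<gamma> s - z0" "z0 - p"] by simp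
        also have "\<dots> < b + h * norm v" using that z0p by simp
        also have "\<dots> = r" using h(2) by (simp add: b_def)
        finally have "0 < Re (\<gamma>' s / v)" using r(2)[OF s] by simp
        then show ?thesis
          unfolding Re_div using v by (simp add: zero_less_divide_iff)
      qed
      show "0 < f s" if "norm (\<gamma> s - z0) < b"
        unfolding f_def using pos[OF that] bump_pos[OF b that] by simp
      then show "0 \<le> f s"
        using bump_eq_0[OF b, of "\<gamma> s" z0] by (cases "norm (\<gamma> s - z0) < b") (auto simp: f_def)
    qed
    have "norm (p - z0) < b"
      using z0p h v by (simp add: norm_minus_commute b_def)
    then have f0: "0 < f s0" using f_pos[OF s0] by (simp add: p_def)
    have "J \<ge> 0" by (rule has_integral_nonneg[OF fJ f_nonneg])
    moreover have "J \<noteq> 0"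
    proof
      assume "J = 0"
      have "continuous_on UNIV f"
        unfolding f_def[abs_def]
        by (intro continuous_intros c continuous_on_compose2[OF C1_on_continuous(1)[OF C1] curve_continuous] subset_UNIV)
      then have "continuous_on (cbox 0 L) f" by (rule continuous_on_subset) simp
      then have "f s0 = 0"
        by (rule has_integral_0_cbox_imp_0) (use f_nonneg fJ \<open>J = 0\<close> L s0 in auto)
      then show False using f0 by simp
    qed
    ultimately have "0 < J" by simp
    have "\<exists>w\<in>D. 0 < Im v * \<phi>x w - Re v * \<phi>y w"
    proof (rule ccontr)
      assume "\<not> ?thesis"
      then have "0 \<le> (\<integral>w. - (indicator D w *\<^sub>R (Im v * \<phi>x w - Re v * \<phi>y w)) \<partial>lborel)"
        by (intro Bochner_Integration.integral_nonneg) (force simp: indicator_def)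
      then show False using \<open>0 < J\<close> by (simp add: J_def set_lebesgue_integral_def)
    qed
    then obtain w where w: "w \<in> D" "0 < Im v * \<phi>x w - Re v * \<phi>y w" by blast
    \<comment> \<open>As the bump decreases away from its centre, an increase towards the right
      normal means that \<open>w\<close> lies on the far left of the centre,
      \<open>h < Im \<zeta>\<close>. Together with \<open>\<bar>Re \<zeta>\<bar> < 2 * h\<close>
      this puts \<open>w\<close> into the cone.\<close>
    define \<zeta> where "\<zeta> = (w - p) / v"
    have w_eq: "w = p + v * \<zeta>" using v by (simp add: \<zeta>_def)
    have wz: "w - z0 = v * (\<zeta> - \<i> * of_real h)" by (simp add: w_eq z0_def algebra_simps)
    have "Im v * \<phi>x w - Re v * \<phi>y w = 2 * m w / b\<^sup>2 * (Re v * Im (w - z0) - Im v * Re (w - z0))"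
      using b by (simp add: \<phi>x_def \<phi>y_def field_simps)
    also have "\<dots> = 2 * m w / b\<^sup>2 * ((norm v)\<^sup>2 * Im ((w - z0) / v))"
      unfolding Im_div using v by simp
    also have "(w - z0) / v = \<zeta> - \<i> * of_real h" using v by (simp add: wz)
    finally have pos: "0 < 2 * m w / b\<^sup>2 * ((norm v)\<^sup>2 * (Im \<zeta> - h))" using w(2) by simp
    have "0 \<le> m w" by (simp add: m_def)
    with pos have m: "0 < m w" by (cases "m w = 0") auto
    with pos b v have Im: "h < Im \<zeta>"
      by (simp add: zero_less_mult_iff zero_less_divide_iff)
    have "norm (w - z0) < b"
    proof (rule ccontr)
      assume "\<not> ?thesis"
      then have "b\<^sup>2 \<le> (norm (w - z0))\<^sup>2" using b by (intro power_mono) auto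
      then have "m w = 0" using b by (simp add: m_def field_simps)
      then show False using m by simp
    qed
    then have n: "norm (\<zeta> - \<i> * of_real h) < 2 * h"
      using v by (simp add: wz norm_mult b_def mult_ac)
    have "norm \<zeta> \<le> norm (\<zeta> - \<i> * of_real h) + norm (\<i> * of_real h)"
      using norm_triangle_ineq[of "\<zeta> - \<i> * of_real h" "\<i> * of_real h"] by simp
    then have "norm \<zeta> < 3 * h" using n h(1) by (simp add: norm_mult)
    moreover have "\<bar>Re \<zeta>\<bar> < 2 * Im \<zeta>"
      using abs_Re_le_cmod[of "\<zeta> - \<i> * of_real h"] n Im by simp
    ultimately have "w \<in> S" unfolding S_def w_eq by auto
    then show ?thesis using w(1) by blast
  qed
  ultimately have SD: "S \<subseteq> D"
    using connected_Int_frontier[of S D] by blast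
  show ?thesis
  proof (intro exI[of _ r] conjI allI impI r(1))
    fix t assume t: "0 < t \<and> t < r"
    define \<zeta> where "\<zeta> = \<i> * of_real (t / norm v)"
    have "norm \<zeta> = t / norm v" using t by (simp add: \<zeta>_def norm_mult norm_divide)
    also have "\<dots> < 3 * h" using t v by (simp add: h_def field_simps)
    finally have "norm \<zeta> < 3 * h" .
    moreover have "\<bar>Re \<zeta>\<bar> < 2 * Im \<zeta>" using t v by (simp add: \<zeta>_def)
    ultimately have "p + v * \<zeta> \<in> S" unfolding S_def by auto
    moreover have "p + v * \<zeta> = p + t *\<^sub>R (\<i> * (v /\<^sub>R norm v))"
      by (simp add: \<zeta>_def scaleR_conv_of_real divide_inverse)
    ultimately show "\<gamma> s0 + t *\<^sub>R (\<i> * (\<gamma>' s0 /\<^sub>R norm (\<gamma>' s0))) \<in> D"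
      using SD unfolding p_def v_def by auto
  qed
qed

text \<open>Points \<open>\<gamma> s0 + t *\<^sub>R n\<close> with small negative \<open>t\<close>
  lie in the domain, where \<open>u\<close> and its extension agree; so the one-sided derivative is
  the directional derivative of the extension.\<close>

lemma outward_derivative_eq:
  assumes s0: "s0 \<in> {0..L}" and g: "(g has_derivative g') (at (\<gamma> s0))" and u: "\<And>z. z \<in> closure D \<Longrightarrow> u z = g z"
  shows "outward_derivative u (\<gamma> s0) (- \<i> * (\<gamma>' s0 /\<^sub>R norm (\<gamma>' s0)))
       = g' (- \<i> * (\<gamma>' s0 /\<^sub>R norm (\<gamma>' s0)))"
proof -
  define n where "n = - \<i> * (\<gamma>' s0 /\<^sub>R norm (\<gamma>' s0))"
  obtain h where h: "0 < h" "\<And>t. 0 < t \<Longrightarrow> t < h \<Longrightarrow> \<gamma> s0 + t *\<^sub>R (\<i> * (\<gamma>' s0 /\<^sub>R norm (\<gamma>' s0))) \<in> D"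
    using inward_normal_in_domain[OF s0] by blast
  have lin: "linear g'" using g has_derivative_linear by blast
  have "((\<lambda>t. \<gamma> s0 + t *\<^sub>R n) has_derivative (\<lambda>t. t *\<^sub>R n)) (at 0 within {..0})"
    by (auto intro!: derivative_eq_intros)
  then have "((\<lambda>t. g (\<gamma> s0 + t *\<^sub>R n)) has_derivative (\<lambda>t. g' (t *\<^sub>R n))) (at 0 within {..0})"
    by (rule has_derivative_compose) (use g in simp)
  then have dg: "((\<lambda>t. g (\<gamma> s0 + t *\<^sub>R n)) has_vector_derivative g' n) (at 0 within {..0})"
    by (simp add: has_vector_derivative_def linear_scale[OF lin])
  have du: "((\<lambda>t. u (\<gamma> s0 + t *\<^sub>R n)) has_vector_derivative g' n) (at 0 within {..0})"
  proof (rule has_vector_derivative_transform_within[OF dg h(1)])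
    fix t :: real assume t: "t \<in> {..0}" "dist t 0 < h"
    have "\<gamma> s0 + t *\<^sub>R n \<in> closure D"
    proof (cases "t = 0")
      case True
      then show ?thesis using curve_in_closure[OF s0] by simp
    next
      case False
      then have "\<gamma> s0 + (- t) *\<^sub>R (\<i> * (\<gamma>' s0 /\<^sub>R norm (\<gamma>' s0))) \<in> D"
        using t by (intro h(2)) auto
      moreover have "(- t) *\<^sub>R (\<i> * (\<gamma>' s0 /\<^sub>R norm (\<gamma>' s0))) = t *\<^sub>R n"
        by (simp add: n_def)
      ultimately have "\<gamma> s0 + t *\<^sub>R n \<in> D" by (simp only:)
      then show ?thesis using closure_subset by blast
    qed
    then show "g (\<gamma> s0 + t *\<^sub>R n) = u (\<gamma> s0 + t *\<^sub>R n)" using u by simp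
  qed simp
  \<comment> \<open>The one-sided filter is nontrivial, which makes the derivative unique and
    \<open>vector_derivative\<close> meaningful.\<close>
  have "at_left (0::real) \<le> at 0 within {..0}" by (rule at_le) auto
  then have "at (0::real) within {..0} \<noteq> bot"
    using trivial_limit_at_left_real[of 0] by (metis bot.extremum_uniqueI)
  then show ?thesis
    unfolding outward_derivative_def n_def[symmetric] by (rule vector_derivative_within[OF _ du])
qed

end

subsection \<open>Rellich's identity\<close>

lemma C1_on_cong:
  assumes "C1_on S F Fx Fy" "\<And>z. F z = G z" "\<And>z. Fx z = Gx z" "\<And>z. Fy z = Gy z"
  shows "C1_on S G Gx Gy"
proof -
  have "F = G" "Fx = Gx" "Fy = Gy" using assms(2-4) by auto
  then show ?thesis using assms(1) by simp
qed

lemma C1_on_partial_derivatives: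
  assumes F: "C1_on S F Fx Fy" and z: "Complex x y \<in> S"
  shows "((\<lambda>t. F (Complex t y)) has_vector_derivative Fx (Complex x y)) (at x)"
    and "((\<lambda>t. F (Complex x t)) has_vector_derivative Fy (Complex x y)) (at y)"
proof -
  have "((\<lambda>t. Complex t y) has_derivative (\<lambda>h. Complex h 0)) (at x)"
    "((\<lambda>t. Complex x t) has_derivative (\<lambda>h. Complex 0 h)) (at y)"
    unfolding Complex_eq by (auto intro!: derivative_eq_intros)
  from has_derivative_compose[OF this(1) C1_onD[OF F z]] has_derivative_compose[OF this(2) C1_onD[OF F z]]
  show "((\<lambda>t. F (Complex t y)) has_vector_derivative Fx (Complex x y)) (at x)"
    and "((\<lambda>t. F (Complex x t)) has_vector_derivative Fy (Complex x y)) (at y)"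
    by (simp_all add: has_vector_derivative_def)
qed

text \<open>Differentiate \<open>F(x, y) - F(a, y) = \<integral>\<^sub>a\<^sup>x F\<^sub>x(t, y) dt\<close> first in \<open>y\<close>, then in \<open>x\<close>.\<close>

lemma C1_on_mixed_partials:
  assumes U: "open U" "z \<in> U" and F: "C1_on U F Fx Fy" and Fx: "C1_on U Fx Fxx Fxy" and Fy: "C1_on U Fy Fyx Fyy"
  shows "Fxy z = Fyx z"
proof -
  obtain e where e: "0 < e" "ball z e \<subseteq> U" using U openE by blast
  define a where "a = Re z"
  define b where "b = Im z"
  \<comment> \<open>With a third of the radius, \<open>\<bar>t - a\<bar> + \<bar>y - b\<bar>\<close>
    is at most \<open>2 * r\<close>, which is less than \<open>e\<close>.\<close>
  define r where "r = e / 3"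
  have r: "0 < r" using e by (simp add: r_def)
  have box: "Complex t y \<in> U" if "t \<in> {a..a+r}" "y \<in> {b-r..b+r}" for t y
  proof -
    have "norm (Complex t y - z) \<le> \<bar>t - a\<bar> + \<bar>y - b\<bar>"
      using cmod_le[of "Complex t y - z"] by (simp add: a_def b_def)
    also have "\<dots> < e" using that e by (auto simp: r_def abs_if)
    finally show ?thesis using e(2) by (auto simp: dist_norm norm_minus_commute)
  qed
  have cC: "continuous_on S (\<lambda>t. Complex t y)" for S y
    unfolding Complex_eq by (intro continuous_intros)
  have main: "Fy (Complex x b) - Fy (Complex a b) = integral {a..x} (\<lambda>t. Fxy (Complex t b))"
    if x: "x \<in> {a..a+r}" for x
  proof -
    have FTC: "integral (cbox a x) (\<lambda>t. Fx (Complex t y)) = F (Complex x y) - F (Complex a y)"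
      if y: "y \<in> {b-r..b+r}" for y
      unfolding cbox_interval
    proof (rule integral_unique, rule fundamental_theorem_of_calculus)
      show "a \<le> x" using x by simp
      show "((\<lambda>t. F (Complex t y)) has_vector_derivative Fx (Complex t y)) (at t within {a..x})" if "t \<in> {a..x}" for t
        using that x by (intro has_vector_derivative_at_within[OF C1_on_partial_derivatives(1)[OF F]] box y) auto
    qed
    have A: "((\<lambda>y. integral (cbox a x) (\<lambda>t. Fx (Complex t y))) has_vector_derivative
        integral (cbox a x) (\<lambda>t. Fxy (Complex t b))) (at b within {b-r..b+r})"
    proof (rule leibniz_rule_vector_derivative)
      show "((\<lambda>y. Fx (Complex t y)) has_vector_derivative Fxy (Complex t y)) (at y within {b-r..b+r})"
        if "y \<in> {b-r..b+r}" "t \<in> cbox a x" for y t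
        using that x by (intro has_vector_derivative_at_within[OF C1_on_partial_derivatives(2)[OF Fx]] box) auto
      show "(\<lambda>t. Fx (Complex t y)) integrable_on cbox a x" if "y \<in> {b-r..b+r}" for y
        using that x box
        by (intro integrable_continuous continuous_on_compose2[OF C1_on_continuous(1)[OF Fx] cC]) auto
      have "continuous_on ({b-r..b+r} \<times> cbox a x) (\<lambda>p. Complex (snd p) (fst p))"
        unfolding Complex_eq by (intro continuous_intros)
      moreover have "(\<lambda>p. Complex (snd p) (fst p)) ` ({b-r..b+r} \<times> cbox a x) \<subseteq> U"
        using box x by auto
      ultimately show "continuous_on ({b-r..b+r} \<times> cbox a x) (\<lambda>(y, t). Fxy (Complex t y))"
        unfolding case_prod_beta by (intro continuous_on_compose2[OF C1_on_continuous(3)[OF Fx]])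
    qed (use r in auto)
    have "((\<lambda>y. F (Complex x y) - F (Complex a y)) has_vector_derivative
        Fy (Complex x b) - Fy (Complex a b)) (at b within {b-r..b+r})"
      using x r by (intro has_vector_derivative_at_within[OF has_vector_derivative_diff] C1_on_partial_derivatives(2)[OF F] box) auto
    then have B: "((\<lambda>y. integral (cbox a x) (\<lambda>t. Fx (Complex t y))) has_vector_derivative
        Fy (Complex x b) - Fy (Complex a b)) (at b within {b-r..b+r})"
      by (rule has_vector_derivative_transform[rotated 2]) (use FTC r in auto)
    have "b - r < b + r" "b \<in> {b-r..b+r}" using r by auto
    note vector_derivative_unique_within_closed_interval[unfolded cbox_interval, OF this B[unfolded cbox_interval] A[unfolded cbox_interval]]
    then show ?thesis .
  qed
  have "continuous_on {a..a+r} (\<lambda>t. Fxy (Complex t b))"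
    using box r by (intro continuous_on_compose2[OF C1_on_continuous(3)[OF Fx] cC]) auto
  then have A: "((\<lambda>x. integral {a..x} (\<lambda>t. Fxy (Complex t b))) has_vector_derivative Fxy (Complex a b)) (at a within {a..a+r})"
    using r by (intro integral_has_vector_derivative) auto
  have "((\<lambda>x. Fy (Complex x b) - Fy (Complex a b)) has_vector_derivative Fyx (Complex a b) - 0) (at a within {a..a+r})"
    using r by (intro has_vector_derivative_at_within[OF has_vector_derivative_diff] C1_on_partial_derivatives(1)[OF Fy]
       has_vector_derivative_const box) auto
  then have B: "((\<lambda>x. integral {a..x} (\<lambda>t. Fxy (Complex t b))) has_vector_derivative Fyx (Complex a b) - 0) (at a within {a..a+r})"
    by (rule has_vector_derivative_transform[rotated 2]) (use main r in auto)
  have "a < a + r" "a \<in> {a..a+r}" using r by auto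
  from vector_derivative_unique_within_closed_interval[unfolded cbox_interval, OF this A B]
  show ?thesis by (simp add: a_def b_def)
qed

text \<open>Here \<open>(\<alpha>, \<beta>)\<close> is the gradient, \<open>(a, b)\<close> the
  velocity and \<open>(x, y)\<close> the position. A gradient orthogonal to the velocity has only a
  normal component, which makes the first product exactly twice the second.\<close>

lemma Rellich_boundary_term:
  fixes \<alpha> \<beta> a b x y :: real
  assumes "\<alpha> * a + \<beta> * b = 0" "a\<^sup>2 + b\<^sup>2 \<noteq> 0"
  shows "(x * \<alpha> + y * \<beta>) * (\<alpha> * b - \<beta> * a) - (\<alpha>\<^sup>2 + \<beta>\<^sup>2) / 2 * (x * b - y * a)
       = (\<alpha> * b - \<beta> * a)\<^sup>2 * (x * b - y * a) / (a\<^sup>2 + b\<^sup>2) / 2"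
proof -
  define q where "q = \<alpha> * b - \<beta> * a"
  define w where "w = x * b - y * a"
  define n where "n = a\<^sup>2 + b\<^sup>2"
  have n: "n \<noteq> 0" using assms(2) by (simp add: n_def)
  have "(x * \<alpha> + y * \<beta>) * n = q * w + (\<alpha> * a + \<beta> * b) * (x * a + y * b)"
    by (simp add: n_def q_def w_def power2_eq_square algebra_simps)
  then have 1: "x * \<alpha> + y * \<beta> = q * w / n" using n assms(1) by (simp add: eq_divide_eq)
  have "(\<alpha>\<^sup>2 + \<beta>\<^sup>2) * n = q\<^sup>2 + (\<alpha> * a + \<beta> * b)\<^sup>2"
    by (simp add: n_def q_def power2_eq_square algebra_simps)
  then have 2: "\<alpha>\<^sup>2 + \<beta>\<^sup>2 = q\<^sup>2 / n" using n assms(1) by (simp add: eq_divide_eq)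
  show ?thesis
    unfolding 1 2 q_def[symmetric] w_def[symmetric] n_def[symmetric]
    using n by (simp add: field_simps power2_eq_square)
qed

context smooth_Jordan_domain
begin

text \<open>Differentiation of the Dirichlet condition along the curve, within \<open>{0..L}\<close>
  because the condition is given there only.\<close>

lemma gradient_orthogonal_to_curve:
  assumes U: "closure D \<subseteq> U" and g: "C1_on U g gx gy" and g0: "\<And>s. s \<in> {0..L} \<Longrightarrow> g (\<gamma> s) = 0" and s: "s \<in> {0..L}"
  shows "gx (\<gamma> s) * Re (\<gamma>' s) + gy (\<gamma> s) * Im (\<gamma>' s) = 0"
proof -
  have "\<gamma> s \<in> U" using curve_in_closure[OF s] U by blast
  from has_derivative_compose[OF d[unfolded has_vector_derivative_def] C1_onD[OF g this]]
  have "((\<lambda>s. g (\<gamma> s)) has_vector_derivative gx (\<gamma> s) * Re (\<gamma>' s) + gy (\<gamma> s) * Im (\<gamma>' s)) (at s)"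
    by (simp add: has_vector_derivative_def algebra_simps)
  then have "((\<lambda>s. g (\<gamma> s)) has_vector_derivative gx (\<gamma> s) * Re (\<gamma>' s) + gy (\<gamma> s) * Im (\<gamma>' s)) (at s within {0..L})"
    by (rule has_vector_derivative_at_within)
  then have A: "((\<lambda>s. 0) has_vector_derivative gx (\<gamma> s) * Re (\<gamma>' s) + gy (\<gamma> s) * Im (\<gamma>' s)) (at s within {0..L})"
    by (rule has_vector_derivative_transform[rotated 2]) (use g0 s in auto)
  have "((\<lambda>s. 0) has_vector_derivative 0) (at s within {0..L})" by simp
  from vector_derivative_unique_within_closed_interval[unfolded cbox_interval, OF L s A this]
  show ?thesis .
qed

text \<open>No normal occurs: the squared bracket divided by the squared speed is the square of the
  normal derivative, and the other bracket is \<open>x \<bullet> n\<close> times the speed.\<close>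

theorem Rellich_identity:
  assumes U: "open U" "closure D \<subseteq> U"
    and g: "C1_on U g gx gy" and gx: "C1_on U gx gxx gxy" and gy: "C1_on U gy gyx gyy"
    and eq: "\<And>z. z \<in> D \<Longrightarrow> gxx z + gyy z + \<mu> * g z = 0"
    and g0: "\<And>s. s \<in> {0..L} \<Longrightarrow> g (\<gamma> s) = 0"
  shows "((\<lambda>s. (gx (\<gamma> s) * Im (\<gamma>' s) - gy (\<gamma> s) * Re (\<gamma>' s))\<^sup>2 *
      (Re (\<gamma> s) * Im (\<gamma>' s) - Im (\<gamma> s) * Re (\<gamma>' s)) / (norm (\<gamma>' s))\<^sup>2)
      has_integral 2 * \<mu> * (LINT z:D|lborel. (g z)\<^sup>2)) {0..L}"
proof -
  \<comment> \<open>\<open>E\<close> is the derivative of \<open>g\<close> in the direction of the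
    position vector, and \<open>H\<close> is half of \<open>\<mu> g\<^sup>2\<close> minus the
    squared gradient. The field \<open>(P, Q)\<close> is \<open>E\<close> times the gradient plus
    \<open>H\<close> times the position. Its divergence involves just \<open>Px\<close> and
    \<open>Qy\<close>, so the other two partials are left existential.\<close>
  note E = C1_on_add[OF C1_on_mult[OF C1_on_Re gx] C1_on_mult[OF C1_on_Im gy]]
  note H = C1_on_mult[OF C1_on_add[OF C1_on_mult[OF C1_on_const[of U \<mu>] C1_on_mult[OF g g]]
     C1_on_mult[OF C1_on_const[of U "-1"] C1_on_add[OF C1_on_mult[OF gx gx] C1_on_mult[OF gy gy]]]] C1_on_const[of U "1/2"]]
  define P where "P z = (Re z * gx z + Im z * gy z) * gx z + (\<mu> * (g z)\<^sup>2 - ((gx z)\<^sup>2 + (gy z)\<^sup>2)) / 2 * Re z" for z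
  define Px where "Px z = (Re z * gxx z + gx z + Im z * gyx z) * gx z + (Re z * gx z + Im z * gy z) * gxx z
      + (\<mu> * (g z)\<^sup>2 - ((gx z)\<^sup>2 + (gy z)\<^sup>2)) / 2 + (\<mu> * g z * gx z - gx z * gxx z - gy z * gyx z) * Re z" for z
  have "\<exists>Py. C1_on U P Px Py"
    by (rule exI, rule C1_on_cong[OF C1_on_add[OF C1_on_mult[OF E gx] C1_on_mult[OF H C1_on_Re]] _ _ refl])
       (simp_all add: P_def Px_def power2_eq_square field_simps)
  then obtain Py where P: "C1_on U P Px Py" by blast
  define Q where "Q z = (Re z * gx z + Im z * gy z) * gy z + (\<mu> * (g z)\<^sup>2 - ((gx z)\<^sup>2 + (gy z)\<^sup>2)) / 2 * Im z" for z
  define Qy where "Qy z = (Re z * gxy z + Im z * gyy z + gy z) * gy z + (Re z * gx z + Im z * gy z) * gyy z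
      + (\<mu> * (g z)\<^sup>2 - ((gx z)\<^sup>2 + (gy z)\<^sup>2)) / 2 + (\<mu> * g z * gy z - gx z * gxy z - gy z * gyy z) * Im z" for z
  have "\<exists>Qx. C1_on U Q Qx Qy"
    by (rule exI, rule C1_on_cong[OF C1_on_add[OF C1_on_mult[OF E gy] C1_on_mult[OF H C1_on_Im]] _ refl])
       (simp_all add: Q_def Qy_def power2_eq_square field_simps)
  then obtain Qx where Q: "C1_on U Q Qx Qy" by blast
  have si: "set_integrable lborel D f" if "continuous_on U f" for f :: "complex \<Rightarrow> real"
    by (rule set_integrable_continuous_on_closure[OF continuous_on_subset[OF that U(2)]])
  have DU: "D \<subseteq> U" using U(2) closure_subset by blast
  \<comment> \<open>The squared gradient cancels because the plane has dimension 2, and the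
    second-order terms outside the Laplacian cancel by symmetry of the mixed partials. What remains
    is the equation times \<open>x \<bullet> \<nabla>g\<close>, and
    \<open>\<mu> g\<^sup>2\<close>.\<close>
  have div: "Px z + Qy z = \<mu> * (g z)\<^sup>2" if z: "z \<in> D" for z
  proof -
    have "gxy z = gyx z"
      using C1_on_mixed_partials[OF U(1) _ g gx gy] DU z by blast
    then have "Px z + Qy z = (Re z * gx z + Im z * gy z) * (gxx z + gyy z + \<mu> * g z) + \<mu> * (g z)\<^sup>2"
      unfolding Px_def Qy_def by (simp add: power2_eq_square field_simps)
    then show ?thesis using eq[OF z] by simp
  qed
  have "(LINT z:D|lborel. Px z) + (LINT z:D|lborel. Qy z) = (LINT z:D|lborel. Px z + Qy z)"
    by (rule set_integral_add(2)[symmetric]) (intro si C1_on_continuous(2)[OF P] C1_on_continuous(3)[OF Q])+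
  also have "\<dots> = (LINT z:D|lborel. \<mu> * (g z)\<^sup>2)"
    unfolding set_lebesgue_integral_def
    by (rule Bochner_Integration.integral_cong) (simp_all add: indicator_def div)
  finally have int: "2 * ((LINT z:D|lborel. Px z) - - (LINT z:D|lborel. Qy z)) = 2 * \<mu> * (LINT z:D|lborel. (g z)\<^sup>2)"
    by simp
  note I = has_integral_mult_right[OF has_integral_diff[OF Green_domain(2)[OF L d c D W U P]
      Green_domain(1)[OF L d c D W U Q]], of 2]
  show ?thesis
    unfolding int[symmetric]
  proof (rule has_integral_eq[OF _ I])
    fix s assume s: "s \<in> {0..L}"
    define a where "a = Re (\<gamma>' s)"
    define b where "b = Im (\<gamma>' s)"
    define x where "x = Re (\<gamma> s)"
    define y where "y = Im (\<gamma> s)"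
    define \<alpha> where "\<alpha> = gx (\<gamma> s)"
    define \<beta> where "\<beta> = gy (\<gamma> s)"
    have ab: "(norm (\<gamma>' s))\<^sup>2 = a\<^sup>2 + b\<^sup>2" by (simp add: cmod_power2 a_def b_def)
    have "\<alpha> * a + \<beta> * b = 0"
      using gradient_orthogonal_to_curve[OF U(2) g g0 s] by (simp add: a_def b_def \<alpha>_def \<beta>_def)
    moreover have "a\<^sup>2 + b\<^sup>2 \<noteq> 0" using nz[OF s] by (simp flip: ab)
    ultimately have *: "(x * \<alpha> + y * \<beta>) * (\<alpha> * b - \<beta> * a) - (\<alpha>\<^sup>2 + \<beta>\<^sup>2) / 2 * (x * b - y * a)
       = (\<alpha> * b - \<beta> * a)\<^sup>2 * (x * b - y * a) / (a\<^sup>2 + b\<^sup>2) / 2"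
      by (rule Rellich_boundary_term)
    have "2 * (P (\<gamma> s) * b - Q (\<gamma> s) * a)
      = 2 * ((x * \<alpha> + y * \<beta>) * (\<alpha> * b - \<beta> * a) - (\<alpha>\<^sup>2 + \<beta>\<^sup>2) / 2 * (x * b - y * a))"
      unfolding P_def Q_def g0[OF s] x_def[symmetric] y_def[symmetric] \<alpha>_def[symmetric] \<beta>_def[symmetric]
      by (simp add: field_simps)
    then show "2 * (P (\<gamma> s) * Im (\<gamma>' s) - Q (\<gamma> s) * Re (\<gamma>' s)) =
       (gx (\<gamma> s) * Im (\<gamma>' s) - gy (\<gamma> s) * Re (\<gamma>' s))\<^sup>2 *
      (Re (\<gamma> s) * Im (\<gamma>' s) - Im (\<gamma> s) * Re (\<gamma>' s)) / (norm (\<gamma>' s))\<^sup>2"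
      unfolding * ab a_def[symmetric] b_def[symmetric] x_def[symmetric] y_def[symmetric] \<alpha>_def[symmetric] \<beta>_def[symmetric]
      by (simp only: mult_2 field_sum_of_halves)
  qed
qed

end

subsection \<open>Perturbation of the curve\<close>

text \<open>Parameters closer than \<open>\<delta>\<close> modulo \<open>L\<close> are separated by
  the mean value theorem, since the velocity barely turns between them. For the remaining pairs
  compactness gives a distance of at least \<open>c\<close> on the original curve, and a small
  deformation cannot close it.\<close>

lemma perturbed_closed_curve_injective:
  fixes \<gamma> \<gamma>' V V' :: "real \<Rightarrow> complex"
  assumes L: "0 < L"
    and d: "\<And>s. (\<gamma> has_vector_derivative \<gamma>' s) (at s)" "\<And>s. (V has_vector_derivative V' s) (at s)"
    and c: "continuous_on UNIV \<gamma>'" "continuous_on UNIV V'"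
    and per: "\<And>s. \<gamma> (s + L) = \<gamma> s" "\<And>s. V (s + L) = V s"
    and nz: "\<And>s. \<gamma>' s \<noteq> 0" and inj: "inj_on \<gamma> {0..<L}"
  shows "\<exists>\<eta>>0. \<forall>\<epsilon>. \<bar>\<epsilon>\<bar> < \<eta> \<longrightarrow> (\<forall>s\<in>{0..L}. \<gamma>' s + \<epsilon> *\<^sub>R V' s \<noteq> 0) \<and> inj_on (\<lambda>s. \<gamma> s + \<epsilon> *\<^sub>R V s) {0..<L}"
proof -
  \<comment> \<open>Two periods, so that \<open>t\<close> near \<open>L\<close> and \<open>s\<close>
    near 0 can be compared as the close parameters \<open>t\<close> and
    \<open>s + L\<close>.\<close>
  let ?I = "{0..2 * L}"
  have cV: "continuous_on UNIV V" and c\<gamma>: "continuous_on UNIV \<gamma>"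
    by (rule has_vector_derivative_imp_continuous_on, rule d)+
  obtain s1 where s1: "s1 \<in> ?I" "\<forall>s\<in>?I. norm (\<gamma>' s1) \<le> norm (\<gamma>' s)"
    using continuous_attains_inf[OF compact_Icc, of 0 "2 * L" "\<lambda>s. norm (\<gamma>' s)"] L
      continuous_on_norm[OF continuous_on_subset[OF c(1) subset_UNIV]] by auto
  define m where "m = norm (\<gamma>' s1)"
  have m: "0 < m" "\<And>s. s \<in> ?I \<Longrightarrow> m \<le> norm (\<gamma>' s)" using nz s1 by (auto simp: m_def)
  have "bounded (V ` ?I)" "bounded (V' ` ?I)"
    by (intro compact_imp_bounded compact_continuous_image continuous_on_subset[OF cV] continuous_on_subset[OF c(2)];
        simp)+
  then obtain M1 M2 where M12: "\<And>s. s \<in> ?I \<Longrightarrow> norm (V s) \<le> M1" "\<And>s. s \<in> ?I \<Longrightarrow> norm (V' s) \<le> M2"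
    unfolding bounded_iff by (metis imageI)
  define M where "M = max 1 (max M1 M2)"
  have M: "0 < M" "\<And>s. s \<in> ?I \<Longrightarrow> norm (V s) \<le> M" "\<And>s. s \<in> ?I \<Longrightarrow> norm (V' s) \<le> M"
    using M12 by (simp_all add: M_def le_max_iff_disj)
  have "uniformly_continuous_on ?I \<gamma>'"
    by (intro compact_uniformly_continuous continuous_on_subset[OF c(1)]) auto
  then obtain \<delta> where \<delta>: "0 < \<delta>" "\<And>a b. a \<in> ?I \<Longrightarrow> b \<in> ?I \<Longrightarrow> dist b a < \<delta> \<Longrightarrow> dist (\<gamma>' b) (\<gamma>' a) < m / 2"
    unfolding uniformly_continuous_on_def using m(1) by (meson half_gt_zero)
  have near: "\<gamma> t + \<epsilon> *\<^sub>R V t \<noteq> \<gamma> s + \<epsilon> *\<^sub>R V s"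
    if st: "s \<in> ?I" "t \<in> ?I" "s < t" "t - s < \<delta>" and \<epsilon>: "\<bar>\<epsilon>\<bar> * M < m / 2" for s t \<epsilon>
  proof
    assume eq: "\<gamma> t + \<epsilon> *\<^sub>R V t = \<gamma> s + \<epsilon> *\<^sub>R V s"
    \<comment> \<open>Were the two points equal, \<open>\<phi>\<close> would change by
      \<open>(t - s) * norm (\<gamma>' s)\<close>, at least \<open>(t - s) * m\<close>; its
      derivative, however, has norm less than \<open>m\<close>.\<close>
    define \<phi> where "\<phi> x = \<gamma> x + \<epsilon> *\<^sub>R V x - x *\<^sub>R \<gamma>' s" for x
    have d\<phi>: "(\<phi> has_derivative (\<lambda>h. h *\<^sub>R \<gamma>' x + \<epsilon> *\<^sub>R (h *\<^sub>R V' x) - h *\<^sub>R \<gamma>' s)) (at x)" for x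
      unfolding \<phi>_def[abs_def]
      by (intro has_derivative_diff has_derivative_add has_derivative_scaleR_right has_derivative_scaleR_left
          has_derivative_ident d[unfolded has_vector_derivative_def])
    have "continuous_on {s..t} \<phi>"
      unfolding \<phi>_def[abs_def] by (intro continuous_intros continuous_on_subset[OF cV] continuous_on_subset[OF c\<gamma>]) auto
    from mvt_general[OF st(3) this d\<phi>] obtain x where x: "x \<in> {s<..<t}"
      "norm (\<phi> t - \<phi> s) \<le> norm ((t - s) *\<^sub>R \<gamma>' x + \<epsilon> *\<^sub>R ((t - s) *\<^sub>R V' x) - (t - s) *\<^sub>R \<gamma>' s)"
      by blast
    have xI: "x \<in> ?I" using x(1) st by auto
    have "\<phi> t - \<phi> s = (s - t) *\<^sub>R \<gamma>' s"
      using eq by (simp add: \<phi>_def algebra_simps)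
    then have "(t - s) * norm (\<gamma>' s) = norm (\<phi> t - \<phi> s)"
      using st(3) by simp
    also have "\<dots> \<le> norm ((t - s) *\<^sub>R (\<gamma>' x - \<gamma>' s + \<epsilon> *\<^sub>R V' x))"
      using x(2) by (simp add: algebra_simps)
    also have "\<dots> = (t - s) * norm (\<gamma>' x - \<gamma>' s + \<epsilon> *\<^sub>R V' x)"
      using st(3) by simp
    also have "\<dots> < (t - s) * m"
    proof (rule mult_strict_left_mono)
      have "norm (\<gamma>' x - \<gamma>' s + \<epsilon> *\<^sub>R V' x) \<le> norm (\<gamma>' x - \<gamma>' s) + \<bar>\<epsilon>\<bar> * norm (V' x)"
        using norm_triangle_ineq[of "\<gamma>' x - \<gamma>' s" "\<epsilon> *\<^sub>R V' x"] by simp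
      also have "norm (\<gamma>' x - \<gamma>' s) < m / 2"
        using \<delta>(2)[OF st(1) xI] x(1) st(4) by (simp add: dist_norm)
      also have "\<bar>\<epsilon>\<bar> * norm (V' x) \<le> \<bar>\<epsilon>\<bar> * M"
        using M(3)[OF xI] by (intro mult_left_mono) auto
      finally show "norm (\<gamma>' x - \<gamma>' s + \<epsilon> *\<^sub>R V' x) < m" using \<epsilon> by simp
    qed (use st in simp)
    finally have "norm (\<gamma>' s) < m" using st(3) by simp
    then show False using m(2)[OF st(1)] by simp
  qed
  have "\<exists>c>0. \<forall>s t. s \<in> {0..L} \<and> t \<in> {0..L} \<and> \<delta> \<le> t - s \<and> t - s \<le> L - \<delta> \<longrightarrow> c \<le> norm (\<gamma> t - \<gamma> s)"
  proof -
    let ?K = "({0..L} \<times> {0..L}) \<inter> {p. \<delta> \<le> snd p - fst p} \<inter> {p. snd p - fst p \<le> L - \<delta>}"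
    show ?thesis
    proof (cases "?K = {}")
      case True
      then have "\<not> (s \<in> {0..L} \<and> t \<in> {0..L} \<and> \<delta> \<le> t - s \<and> t - s \<le> L - \<delta>)" for s t
        by (auto simp: set_eq_iff)
      then show ?thesis by (intro exI[of _ 1]) auto
    next
      case False
      have "compact ?K"
        by (intro compact_Int_closed compact_Times compact_Icc closed_Collect_le continuous_intros)
      moreover have "continuous_on ?K (\<lambda>p. norm (\<gamma> (snd p) - \<gamma> (fst p)))"
        by (intro continuous_intros continuous_on_compose2[OF c\<gamma>]) auto
      ultimately obtain p where p: "p \<in> ?K" "\<And>q. q \<in> ?K \<Longrightarrow> norm (\<gamma> (snd p) - \<gamma> (fst p)) \<le> norm (\<gamma> (snd q) - \<gamma> (fst q))"
        using continuous_attains_inf[OF _ False] by blast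
      have "\<gamma> (snd p) \<noteq> \<gamma> (fst p)"
      proof
        assume eq: "\<gamma> (snd p) = \<gamma> (fst p)"
        have f: "fst p \<in> {0..<L}" using p(1) \<delta>(1) by auto
        show False
        proof (cases "snd p = L")
          case True
          then have "\<gamma> (fst p) = \<gamma> 0" using eq per(1)[of 0] by simp
          then have "fst p = 0" using inj_onD[OF inj, of "fst p" 0] f L by auto
          then show False using True p(1) \<delta>(1) by auto
        next
          case False
          then have "snd p \<in> {0..<L}" using p(1) by auto
          then have "snd p = fst p" using inj_onD[OF inj eq] f by blast
          then show False using p(1) \<delta>(1) by auto
        qed
      qed
      then have "0 < norm (\<gamma> (snd p) - \<gamma> (fst p))" by simp
      moreover have "norm (\<gamma> (snd p) - \<gamma> (fst p)) \<le> norm (\<gamma> t - \<gamma> s)"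
        if "s \<in> {0..L} \<and> t \<in> {0..L} \<and> \<delta> \<le> t - s \<and> t - s \<le> L - \<delta>" for s t
        using p(2)[of "(s, t)"] that by simp
      ultimately show ?thesis by blast
    qed
  qed
  then obtain c where c: "0 < c"
    "\<And>s t. s \<in> {0..L} \<Longrightarrow> t \<in> {0..L} \<Longrightarrow> \<delta> \<le> t - s \<Longrightarrow> t - s \<le> L - \<delta> \<Longrightarrow> c \<le> norm (\<gamma> t - \<gamma> s)"
    by blast
  \<comment> \<open>The first bound serves the close pairs and keeps the velocity nonzero; the
    second keeps the displacement of a distant pair, at most
    \<open>2 * M * \<bar>\<epsilon>\<bar>\<close>, below \<open>c\<close>.\<close>
  define \<eta> where "\<eta> = min (m / (2 * M)) (c / (2 * M))"
  show ?thesis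
  proof (intro exI[of _ \<eta>] conjI allI impI)
    show "0 < \<eta>" using m c(1) M(1) by (simp add: \<eta>_def)
    fix \<epsilon> assume \<epsilon>: "\<bar>\<epsilon>\<bar> < \<eta>"
    have \<epsilon>1: "\<bar>\<epsilon>\<bar> * M < m / 2" and \<epsilon>2: "\<bar>\<epsilon>\<bar> * M < c / 2"
      using \<epsilon> M(1) by (simp_all add: \<eta>_def field_simps)
    show "\<forall>s\<in>{0..L}. \<gamma>' s + \<epsilon> *\<^sub>R V' s \<noteq> 0"
    proof
      fix s assume "s \<in> {0..L}"
      then have s: "s \<in> ?I" using L by auto
      have "norm (\<epsilon> *\<^sub>R V' s) \<le> \<bar>\<epsilon>\<bar> * M" using M(3)[OF s] by (simp add: mult_left_mono)
      also have "\<dots> < m" using \<epsilon>1 m(1) by simp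
      also have "\<dots> \<le> norm (\<gamma>' s)" by (rule m(2)[OF s])
      finally have "norm (\<epsilon> *\<^sub>R V' s) < norm (\<gamma>' s)" .
      then show "\<gamma>' s + \<epsilon> *\<^sub>R V' s \<noteq> 0"
        by (metis add_eq_0_iff norm_minus_cancel order_less_irrefl)
    qed
    have "\<gamma> t + \<epsilon> *\<^sub>R V t \<noteq> \<gamma> s + \<epsilon> *\<^sub>R V s" if st: "s \<in> {0..<L}" "t \<in> {0..<L}" "s < t" for s t
    proof -
      have I: "s \<in> ?I" "t \<in> ?I" "s + L \<in> ?I" using st by auto
      consider "t - s < \<delta>" | "\<delta> \<le> t - s" "t - s \<le> L - \<delta>" | "L - \<delta> < t - s" by linarith
      then show ?thesis
      proof cases
        case 1
        then show ?thesis using near I st \<epsilon>1 by blast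
      next
        case 2
        have "c \<le> norm (\<gamma> t - \<gamma> s)" using c(2)[OF _ _ 2] st by simp
        moreover have "norm (\<epsilon> *\<^sub>R (V t - V s)) < c"
        proof -
          have "norm (V t - V s) \<le> M + M"
            using norm_triangle_ineq4[of "V t" "V s"] M(2)[OF I(1)] M(2)[OF I(2)] by linarith
          then have "\<bar>\<epsilon>\<bar> * norm (V t - V s) \<le> \<bar>\<epsilon>\<bar> * (M + M)" by (rule mult_left_mono) simp
          then have "\<bar>\<epsilon>\<bar> * norm (V t - V s) < c" using \<epsilon>2 by (simp add: distrib_left)
          then show ?thesis by simp
        qed
        moreover have "norm (\<gamma> t - \<gamma> s) = norm (\<epsilon> *\<^sub>R (V t - V s))"
          if "\<gamma> t + \<epsilon> *\<^sub>R V t = \<gamma> s + \<epsilon> *\<^sub>R V s"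
        proof -
          have "\<gamma> t - \<gamma> s = - (\<epsilon> *\<^sub>R (V t - V s))"
            using that by (simp add: algebra_simps)
          then show ?thesis by simp
        qed
        ultimately show ?thesis by force
      next
        case 3
        have "\<gamma> (s + L) + \<epsilon> *\<^sub>R V (s + L) \<noteq> \<gamma> t + \<epsilon> *\<^sub>R V t"
          by (rule near[OF I(2) I(3) _ _ \<epsilon>1]) (use 3 st in auto)
        then show ?thesis by (simp add: per eq_commute)
      qed
    qed
    then have *: "\<gamma> t + \<epsilon> *\<^sub>R V t \<noteq> \<gamma> s + \<epsilon> *\<^sub>R V s" if "s \<in> {0..<L}" "t \<in> {0..<L}" "s \<noteq> t" for s t
      using that by (cases "s < t") (force simp: not_less less_le)+
    show "inj_on (\<lambda>s. \<gamma> s + \<epsilon> *\<^sub>R V s) {0..<L}"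
      by (rule inj_onI) (use * in blast)
  qed
qed

text \<open>Inside and outside of the curve are connected and miss the frontier of \<open>D\<close>,
  so each is contained in \<open>D\<close> or disjoint from it. Boundedness rules out the outside,
  hence \<open>D\<close> is the inside. There the winding number is constantly 1 or constantly -1,
  and the single point \<open>z0\<close> decides the sign.\<close>

lemma winding_number_of_Jordan_domain:
  assumes p: "simple_path p" "pathfinish p = pathstart p"
    and D: "open D" "connected D" "D \<noteq> {}" "bounded D" "frontier D = path_image p"
    and z0: "winding_number p z0 = 1" "z0 \<notin> path_image p"
  shows "w \<in> D \<Longrightarrow> winding_number p w = 1" and "w \<notin> closure D \<Longrightarrow> winding_number p w = 0"
proof -
  have conn: "connected (inside (path_image p))" "connected (outside (path_image p))"
    and unb: "\<not> bounded (outside (path_image p))"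
    and un: "inside (path_image p) \<union> outside (path_image p) = - path_image p"
    using Jordan_inside_outside[OF p] by simp_all
  have disj: "D \<inter> path_image p = {}"
    using D(1) unfolding D(5)[symmetric] frontier_def by (auto simp: interior_open)
  have "outside (path_image p) \<inter> D = {}"
  proof (rule ccontr)
    assume "outside (path_image p) \<inter> D \<noteq> {}"
    from connected_Int_frontier[OF conn(2) this] have "outside (path_image p) - D = {}"
      using outside_no_overlap unfolding D(5) by blast
    then show False using unb D(4) bounded_subset by blast
  qed
  then have sub: "D \<subseteq> inside (path_image p)" using un disj by blast
  then have "inside (path_image p) \<inter> D \<noteq> {}" using D(3) by blast
  from connected_Int_frontier[OF conn(1) this] have "inside (path_image p) - D = {}"
    using inside_no_overlap unfolding D(5) by blast
  with sub have D_eq: "D = inside (path_image p)" by blast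
  have "z0 \<notin> outside (path_image p)"
    using winding_number_zero_in_outside[OF simple_path_imp_path[OF p(1)] p(2)] z0(1) by fastforce
  then have "z0 \<in> inside (path_image p)" using un z0(2) by blast
  then show "winding_number p w = 1" if "w \<in> D" for w
    using simple_closed_path_winding_number_inside[OF p(1)] z0(1) that unfolding D_eq
    by (metis one_neq_neg_one)
  show "winding_number p w = 0" if "w \<notin> closure D" for w
  proof -
    have "w \<notin> D \<union> frontier D" using that by (metis closure_Un_frontier)
    then have "w \<notin> inside (path_image p)" "w \<notin> path_image p" using D(5) D_eq by simp_all
    then have "w \<in> outside (path_image p)" using un by blast
    then show ?thesis by (rule winding_number_zero_in_outside[OF simple_path_imp_path[OF p(1)] p(2)])
  qed
qed

text \<open>Injectivity on a half-open period leaves only 0 and \<open>L\<close> as distinct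
  parameters of one point, and \<open>closed\<close> equates their velocities. Orientation is tested
  at one point, which need not be known to lie in \<open>D\<close>; this suits a deformed
  domain.\<close>

lemma smooth_Jordan_domainI:
  fixes \<gamma> \<gamma>' :: "real \<Rightarrow> complex"
  assumes L: "0 < L" and d: "\<And>s. (\<gamma> has_vector_derivative \<gamma>' s) (at s)" and c: "continuous_on UNIV \<gamma>'"
    and nz: "\<And>s. s \<in> {0..L} \<Longrightarrow> \<gamma>' s \<noteq> 0" and inj: "inj_on \<gamma> {0..<L}"
    and closed: "\<gamma> L = \<gamma> 0" "\<gamma>' L = \<gamma>' 0"
    and D: "bounded_domain_with_boundary L \<gamma> D"
    and z0: "winding_number (\<lambda>t. \<gamma> (L * t)) z0 = 1" "z0 \<notin> \<gamma> ` {0..L}"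
  shows "smooth_Jordan_domain L \<gamma> \<gamma>' D"
proof -
  let ?p = "\<lambda>t. \<gamma> (L * t)"
  note D' = D[unfolded bounded_domain_with_boundary_def]
  have eq: "s = t \<or> s = 0 \<and> t = L \<or> s = L \<and> t = 0" if st: "s \<in> {0..L}" "t \<in> {0..L}" "\<gamma> s = \<gamma> t" for s t
  proof -
    have *: "t = 0" if "t \<in> {0..<L}" "\<gamma> t = \<gamma> 0" for t
      using inj_onD[OF inj that(2) that(1)] L by simp
    consider "s \<in> {0..<L}" "t \<in> {0..<L}" | "s = L" "t = L" | "s = L" "t \<in> {0..<L}" | "t = L" "s \<in> {0..<L}"
      using st by fastforce
    then show ?thesis
    proof cases
      case 1
      then show ?thesis using inj_onD[OF inj st(3)] by blast
    next
      case 3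
      then show ?thesis using *[of t] st(3) closed(1) by simp
    next
      case 4
      then show ?thesis using *[of s] st(3) closed(1) by simp
    qed simp
  qed
  have cont: "continuous_on UNIV \<gamma>"
    by (rule has_vector_derivative_imp_continuous_on) (rule d)
  have "path ?p"
    unfolding path_def by (intro continuous_on_compose2[OF cont] continuous_intros) auto
  moreover have "loop_free ?p"
    unfolding loop_free_def
  proof (intro ballI impI)
    fix x y :: real assume xy: "x \<in> {0..1}" "y \<in> {0..1}" "?p x = ?p y"
    have "L * x \<in> {0..L}" "L * y \<in> {0..L}" using xy L by (auto simp: mult_le_cancel_left1)
    from eq[OF this xy(3)] show "x = y \<or> x = 0 \<and> y = 1 \<or> x = 1 \<and> y = 0" using L by auto
  qed
  ultimately have sp: "simple_path ?p" by (simp add: simple_path_def)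
  have "(\<lambda>t. L * t) ` {0..1} = {0..L}" using L by (simp add: image_mult_atLeastAtMost)
  then have img: "path_image ?p = \<gamma> ` {0..L}" unfolding path_image_def by (metis image_image)
  have fin: "pathfinish ?p = pathstart ?p" using closed(1) by (simp add: pathfinish_def pathstart_def)
  have fr: "frontier D = path_image ?p" and z0': "z0 \<notin> path_image ?p" using D' z0(2) img by auto
  note wn = winding_number_of_Jordan_domain[OF sp fin _ _ _ _ fr z0(1) z0']
  show ?thesis
  proof unfold_locales
    show "\<gamma>' s = \<gamma>' t" if "s \<in> {0..L}" "t \<in> {0..L}" "\<gamma> s = \<gamma> t" for s t
      using eq[OF that] closed(2) by fastforce
  qed (use assms D' wn in auto)
qed

subsection \<open>Differentiation under the boundary integral\<close>

lemma smooth_on_has_derivative: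
  assumes "smooth_on f S" "x \<in> S"
  shows "(f has_derivative frechet_derivative f (at x)) (at x)"
proof -
  have "Ck_on (Suc 0) f S" using assms(1) unfolding smooth_on_def by blast
  then show ?thesis using assms(2) by (simp add: frechet_derivative_works[symmetric])
qed

lemma smooth_on_continuous: "smooth_on f S \<Longrightarrow> continuous_on S f"
  unfolding smooth_on_def by (metis Ck_on.simps(1))

lemma smooth_on_directional_derivative:
  assumes "smooth_on f S"
  shows "smooth_on (\<lambda>x. frechet_derivative f (at x) v) S"
  unfolding smooth_on_def
proof
  fix k
  have "Ck_on (Suc k) f S" using assms unfolding smooth_on_def by blast
  then show "Ck_on k (\<lambda>x. frechet_derivative f (at x) v) S" by simp
qed

lemma smooth_on_UNIV_velocity:
  assumes "smooth_on f UNIV"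
  shows "(f has_vector_derivative velocity f s) (at s)" and "continuous_on UNIV (velocity f)"
proof -
  have d: "(f has_derivative frechet_derivative f (at s)) (at s)" for s
    by (rule smooth_on_has_derivative[OF assms UNIV_I])
  have v: "(f has_vector_derivative velocity f s) (at s)" for s
    unfolding velocity_def by (rule vector_derivative_works[THEN iffD1, OF differentiableI[OF d]])
  then show "(f has_vector_derivative velocity f s) (at s)" .
  have "velocity f s = frechet_derivative f (at s) 1" for s
    using has_derivative_unique[OF d[of s] v[of s, unfolded has_vector_derivative_def]] by (simp add: fun_eq_iff)
  then have "velocity f = (\<lambda>s. frechet_derivative f (at s) 1)" by blast
  with smooth_on_continuous[OF smooth_on_directional_derivative[OF assms, of 1]]
  show "continuous_on UNIV (velocity f)" by simp
qed

lemma velocity_periodic: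
  assumes "smooth_periodic L f"
  shows "velocity f (s + L) = velocity f s"
proof -
  have per: "\<And>t. f (t + L) = f t" and sm: "smooth_on f UNIV"
    using assms by (auto simp: smooth_periodic_def)
  have "((\<lambda>t. t + L) has_vector_derivative 1) (at s)"
    by (auto intro!: derivative_eq_intros)
  from vector_diff_chain_at[OF this smooth_on_UNIV_velocity(1)[OF sm]]
  have "(f has_vector_derivative velocity f (s + L)) (at s)"
    by (simp add: o_def per)
  with smooth_on_UNIV_velocity(1)[OF sm, of s] show ?thesis
    by (rule vector_derivative_unique_at[rotated])
qed

lemma velocity_deformed_curve:
  assumes "smooth_on \<gamma> UNIV" "smooth_on V UNIV"
  shows "velocity (deformed_curve \<gamma> V \<epsilon>) s = velocity \<gamma> s + \<epsilon> *\<^sub>R velocity V s"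
    and "(deformed_curve \<gamma> V \<epsilon> has_vector_derivative velocity \<gamma> s + \<epsilon> *\<^sub>R velocity V s) (at s)"
proof -
  have "((\<lambda>s. \<gamma> s + \<epsilon> *\<^sub>R V s) has_vector_derivative velocity \<gamma> s + \<epsilon> *\<^sub>R velocity V s) (at s)"
    by (intro has_vector_derivative_add bounded_linear.has_vector_derivative[OF bounded_linear_scaleR_right]
        smooth_on_UNIV_velocity(1) assms)
  then show "(deformed_curve \<gamma> V \<epsilon> has_vector_derivative velocity \<gamma> s + \<epsilon> *\<^sub>R velocity V s) (at s)"
    by (simp add: deformed_curve_def[abs_def])
  then show "velocity (deformed_curve \<gamma> V \<epsilon>) s = velocity \<gamma> s + \<epsilon> *\<^sub>R velocity V s"
    unfolding velocity_def by (rule vector_derivative_at)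
qed

lemma frechet_derivative_pair_expand:
  fixes f :: "real \<times> complex \<Rightarrow> real"
  assumes "(f has_derivative f') (at x)"
  shows "f' (t, z) = t * f' (1, 0) + Re z * f' (0, 1) + Im z * f' (0, \<i>)"
proof -
  have l: "linear f'" using assms by (rule has_derivative_linear)
  have "(t, z) = t *\<^sub>R (1, 0) + Re z *\<^sub>R (0, 1) + Im z *\<^sub>R (0, \<i>)"
    by (simp add: complex_eq_iff)
  then have "f' (t, z) = f' (t *\<^sub>R (1, 0) + Re z *\<^sub>R (0, 1) + Im z *\<^sub>R (0, \<i>))" by simp
  also have "\<dots> = t * f' (1, 0) + Re z * f' (0, 1) + Im z * f' (0, \<i>)"
    by (simp only: linear_add[OF l] linear_scale[OF l] real_scaleR_def)
  finally show ?thesis .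
qed

text \<open>Connects joint smoothness in \<open>(\<epsilon>, z)\<close> with the calculus of
  \<open>C1_on\<close>, in which Rellich's identity treats one \<open>\<epsilon>\<close> at a
  time.\<close>

lemma smooth_on_slice_C1_on:
  fixes f :: "real \<times> complex \<Rightarrow> real"
  assumes f: "smooth_on f U"
  shows "C1_on {z. (\<epsilon>, z) \<in> U} (\<lambda>z. f (\<epsilon>, z)) (\<lambda>z. frechet_derivative f (at (\<epsilon>, z)) (0, 1))
     (\<lambda>z. frechet_derivative f (at (\<epsilon>, z)) (0, \<i>))"
  unfolding C1_on_def
proof (intro conjI ballI)
  fix z assume "z \<in> {z. (\<epsilon>, z) \<in> U}"
  then have df: "(f has_derivative frechet_derivative f (at (\<epsilon>, z))) (at (\<epsilon>, z))"
    using smooth_on_has_derivative[OF f] by blast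
  have "((\<lambda>z. (\<epsilon>, z)) has_derivative (\<lambda>h. (0, h))) (at z)"
    by (auto intro!: derivative_eq_intros)
  have e: "frechet_derivative f (at (\<epsilon>, z)) (0, h) = Re h * frechet_derivative f (at (\<epsilon>, z)) (0, 1) +
      Im h * frechet_derivative f (at (\<epsilon>, z)) (0, \<i>)" for h
    by (rule trans[OF frechet_derivative_pair_expand[OF df]]) simp
  from has_derivative_compose[OF \<open>((\<lambda>z. (\<epsilon>, z)) has_derivative (\<lambda>h. (0, h))) (at z)\<close> df]
  show "((\<lambda>z. f (\<epsilon>, z)) has_derivative (\<lambda>h. Re h * frechet_derivative f (at (\<epsilon>, z)) (0, 1) +
      Im h * frechet_derivative f (at (\<epsilon>, z)) (0, \<i>))) (at z)"
    by (rule has_derivative_eq_rhs) (rule ext, rule e)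
next
  have c: "continuous_on {z. (\<epsilon>, z) \<in> U} (\<lambda>z. (\<epsilon>, z))" by (intro continuous_intros)
  show "continuous_on {z. (\<epsilon>, z) \<in> U} (\<lambda>z. frechet_derivative f (at (\<epsilon>, z)) (0, 1))"
    "continuous_on {z. (\<epsilon>, z) \<in> U} (\<lambda>z. frechet_derivative f (at (\<epsilon>, z)) (0, \<i>))"
    by (rule continuous_on_compose2[OF smooth_on_continuous[OF smooth_on_directional_derivative[OF f]] c], blast)+
qed

text \<open>\<open>D\<close> is open, so the nested derivatives in \<open>laplacian\<close> see only
  the values in \<open>D\<close>, where \<open>u\<close> may be exchanged for its extension.\<close>

lemma laplacian_eq_C1_on:
  assumes D: "open D" "x \<in> D" and g: "C1_on D g gx gy" and gx: "C1_on D gx gxx gxy" and gy: "C1_on D gy gyx gyy"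
    and u: "\<And>z. z \<in> D \<Longrightarrow> u z = g z"
  shows "laplacian u x = gxx x + gyy x"
proof -
  have "(u has_derivative (\<lambda>h. Re h * gx z + Im h * gy z)) (at z)" if "z \<in> D" for z
    by (rule has_derivative_transform_within_open[OF C1_onD[OF g that] D(1) that]) (simp add: u)
  from frechet_derivative_at[OF this]
  have f: "frechet_derivative u (at z) = (\<lambda>h. Re h * gx z + Im h * gy z)" if "z \<in> D" for z
    using that by metis
  have "((\<lambda>y. frechet_derivative u (at y) 1) has_derivative (\<lambda>h. Re h * gxx x + Im h * gxy x)) (at x)"
    by (rule has_derivative_transform_within_open[OF C1_onD[OF gx D(2)] D]) (simp add: f)
  moreover have "((\<lambda>y. frechet_derivative u (at y) \<i>) has_derivative (\<lambda>h. Re h * gyx x + Im h * gyy x)) (at x)"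
    by (rule has_derivative_transform_within_open[OF C1_onD[OF gy D(2)] D]) (simp add: f)
  ultimately show ?thesis
    unfolding laplacian_def Basis_complex_def
    by (simp add: frechet_derivative_at[symmetric])
qed

text \<open>Smoothness in \<open>\<epsilon>\<close> and \<open>z\<close> jointly allows the function
  and the boundary point at which it is evaluated to vary together.\<close>

locale smooth_deformation =
  fixes L \<eta> :: real and \<gamma> \<gamma>' V V' :: "real \<Rightarrow> complex" and U :: "(real \<times> complex) set"
    and f1 f2 :: "real \<times> complex \<Rightarrow> real"
  assumes \<eta>: "0 < \<eta>"
    and cont: "continuous_on UNIV \<gamma>" "continuous_on UNIV \<gamma>'" "continuous_on UNIV V" "continuous_on UNIV V'"
    and nz: "\<bar>\<epsilon>\<bar> < \<eta> \<Longrightarrow> s \<in> {0..L} \<Longrightarrow> \<gamma>' s + \<epsilon> *\<^sub>R V' s \<noteq> 0"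
    and inU: "\<bar>\<epsilon>\<bar> < \<eta> \<Longrightarrow> s \<in> {0..L} \<Longrightarrow> (\<epsilon>, \<gamma> s + \<epsilon> *\<^sub>R V s) \<in> U"
    and f1: "smooth_on f1 U" and f2: "smooth_on f2 U"
begin

text \<open>\<open>sig\<close> is \<open>\<sigma>\<close>, once the one-sided normal derivative is expressed by a smooth extension of \<open>u\<close> with
  gradient \<open>(f1, f2)\<close>; \<open>flux\<close> is \<open>\<partial>\<^sub>n u\<close> times the speed and \<open>support\<close> is \<open>x \<bullet> n\<close> times the speed. A prime
  denotes the derivative with respect to \<open>\<epsilon>\<close>.\<close>

definition "along f \<epsilon> s = (f (\<epsilon>, \<gamma> s + \<epsilon> *\<^sub>R V s) :: real)" for f :: "real \<times> complex \<Rightarrow> real"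

definition "along' f \<epsilon> s = along (\<lambda>x. frechet_derivative f (at x) (1, 0)) \<epsilon> s
   + Re (V s) * along (\<lambda>x. frechet_derivative f (at x) (0, 1)) \<epsilon> s
   + Im (V s) * along (\<lambda>x. frechet_derivative f (at x) (0, \<i>)) \<epsilon> s"

definition "speed \<epsilon> s = norm (\<gamma>' s + \<epsilon> *\<^sub>R V' s)"

definition "speed' \<epsilon> s = ((Re (\<gamma>' s) + \<epsilon> * Re (V' s)) * Re (V' s) + (Im (\<gamma>' s) + \<epsilon> * Im (V' s)) * Im (V' s)) / speed \<epsilon> s"

definition "flux \<epsilon> s = along f1 \<epsilon> s * (Im (\<gamma>' s) + \<epsilon> * Im (V' s)) - along f2 \<epsilon> s * (Re (\<gamma>' s) + \<epsilon> * Re (V' s))"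

definition "flux' \<epsilon> s = along' f1 \<epsilon> s * (Im (\<gamma>' s) + \<epsilon> * Im (V' s)) + along f1 \<epsilon> s * Im (V' s)
   - (along' f2 \<epsilon> s * (Re (\<gamma>' s) + \<epsilon> * Re (V' s)) + along f2 \<epsilon> s * Re (V' s))"

definition "sig \<epsilon> s = - (flux \<epsilon> s / speed \<epsilon> s)"

definition "sig' \<epsilon> s = - ((flux' \<epsilon> s * speed \<epsilon> s - flux \<epsilon> s * speed' \<epsilon> s) / (speed \<epsilon> s * speed \<epsilon> s))"

definition "support \<epsilon> s = (Re (\<gamma> s) + \<epsilon> * Re (V s)) * (Im (\<gamma>' s) + \<epsilon> * Im (V' s))
   - (Im (\<gamma> s) + \<epsilon> * Im (V s)) * (Re (\<gamma>' s) + \<epsilon> * Re (V' s))"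

definition "support' \<epsilon> s = Re (V s) * (Im (\<gamma>' s) + \<epsilon> * Im (V' s)) + (Re (\<gamma> s) + \<epsilon> * Re (V s)) * Im (V' s)
   - (Im (V s) * (Re (\<gamma>' s) + \<epsilon> * Re (V' s)) + (Im (\<gamma> s) + \<epsilon> * Im (V s)) * Re (V' s))"

lemma speed_pos: "\<bar>\<epsilon>\<bar> < \<eta> \<Longrightarrow> s \<in> {0..L} \<Longrightarrow> 0 < speed \<epsilon> s"
  using nz by (simp add: speed_def)

lemma speed_nonzero: "p \<in> {-\<eta><..<\<eta>} \<times> {0..L} \<Longrightarrow> speed (fst p) (snd p) \<noteq> 0"
  using speed_pos[of "fst p" "snd p"] by (auto simp: abs_less_iff)

lemma speed_eq_sqrt: "speed \<epsilon> s = sqrt ((Re (\<gamma>' s) + \<epsilon> * Re (V' s))\<^sup>2 + (Im (\<gamma>' s) + \<epsilon> * Im (V' s))\<^sup>2)"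
  by (simp add: speed_def cmod_def)

text \<open>The chain rule along \<open>(\<epsilon>, \<gamma> s + \<epsilon> *\<^sub>R V s)\<close>:
  a variation at fixed \<open>s\<close> includes transport by all of \<open>V\<close>, its
  tangential part too.\<close>

lemma DERIV_along:
  assumes f: "smooth_on f U" and \<epsilon>: "\<bar>\<epsilon>\<bar> < \<eta>" and s: "s \<in> {0..L}"
  shows "DERIV (\<lambda>\<epsilon>. along f \<epsilon> s) \<epsilon> :> along' f \<epsilon> s"
proof -
  note df = smooth_on_has_derivative[OF f inU[OF \<epsilon> s]]
  have "((\<lambda>\<epsilon>. (\<epsilon>, \<gamma> s + \<epsilon> *\<^sub>R V s)) has_derivative (\<lambda>h. (h, h *\<^sub>R V s))) (at \<epsilon>)"
    by (auto intro!: derivative_eq_intros)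
  from has_derivative_compose[OF this df]
  show ?thesis
    unfolding has_field_derivative_def along_def along'_def
    by (rule has_derivative_eq_rhs) (rule ext, rule trans[OF frechet_derivative_pair_expand[OF df]], simp add: algebra_simps)
qed

lemma DERIV_speed:
  assumes \<epsilon>: "\<bar>\<epsilon>\<bar> < \<eta>" and s: "s \<in> {0..L}"
  shows "DERIV (\<lambda>\<epsilon>. speed \<epsilon> s) \<epsilon> :> speed' \<epsilon> s"
proof -
  let ?q = "\<lambda>\<epsilon>. (Re (\<gamma>' s) + \<epsilon> * Re (V' s))\<^sup>2 + (Im (\<gamma>' s) + \<epsilon> * Im (V' s))\<^sup>2"
  have "0 < sqrt (?q \<epsilon>)" using speed_pos[OF assms] by (simp only: speed_eq_sqrt)
  then have q: "0 < ?q \<epsilon>" by simp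
  have "DERIV ?q \<epsilon> :> 2 * (Re (\<gamma>' s) + \<epsilon> * Re (V' s)) * Re (V' s) + 2 * (Im (\<gamma>' s) + \<epsilon> * Im (V' s)) * Im (V' s)"
    by (auto intro!: derivative_eq_intros simp: algebra_simps)
  note d = this
  have e: "inverse r / 2 * (2 * a * a' + 2 * b * b') = (a * a' + b * b') / r" for r a a' b b' :: real
    by (cases "r = 0") (simp_all add: field_simps)
  from DERIV_chain2[where f = sqrt and g = ?q, OF DERIV_real_sqrt[OF q] d]
  show ?thesis
    unfolding speed_eq_sqrt speed'_def by (rule DERIV_cong) (rule e)
qed

lemma DERIV_affine: "DERIV (\<lambda>\<epsilon>. a + \<epsilon> * b) \<epsilon> :> (b::real)"
  by (auto intro!: derivative_eq_intros)

lemma DERIV_sig: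
  assumes \<epsilon>: "\<bar>\<epsilon>\<bar> < \<eta>" and s: "s \<in> {0..L}"
  shows "DERIV (\<lambda>\<epsilon>. sig \<epsilon> s) \<epsilon> :> sig' \<epsilon> s"
proof -
  have "DERIV (\<lambda>\<epsilon>. flux \<epsilon> s) \<epsilon> :> flux' \<epsilon> s"
    unfolding flux_def flux'_def
    by (rule DERIV_cong[OF DERIV_diff[OF DERIV_mult[OF DERIV_along[OF f1 assms] DERIV_affine]
          DERIV_mult[OF DERIV_along[OF f2 assms] DERIV_affine]]]) (simp add: algebra_simps)
  from DERIV_minus[OF DERIV_divide[OF this DERIV_speed[OF assms]]] speed_pos[OF assms]
  show ?thesis unfolding sig_def sig'_def by simp
qed

lemma DERIV_support: "DERIV (\<lambda>\<epsilon>. support \<epsilon> s) \<epsilon> :> support' \<epsilon> s"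
  unfolding support_def support'_def
  by (rule DERIV_cong[OF DERIV_diff[OF DERIV_mult[OF DERIV_affine DERIV_affine] DERIV_mult[OF DERIV_affine DERIV_affine]]])
     (simp add: algebra_simps)

abbreviation "W \<equiv> {-\<eta><..<\<eta>} \<times> {0..L}"

lemma continuous_snd:
  fixes h :: "real \<Rightarrow> complex"
  shows "continuous_on UNIV h \<Longrightarrow> continuous_on T (\<lambda>p. h (snd p))"
  by (rule continuous_on_compose2[of UNIV h]) (auto intro: continuous_intros)

lemma continuous_along:
  assumes f: "smooth_on f U"
  shows "continuous_on W (\<lambda>p. along f (fst p) (snd p))"
  unfolding along_def
  by (rule continuous_on_compose2[OF smooth_on_continuous[OF f]])
     (intro continuous_intros continuous_snd cont, use inU in auto)

lemma continuous_along':
  assumes f: "smooth_on f U"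
  shows "continuous_on W (\<lambda>p. along' f (fst p) (snd p))"
  unfolding along'_def
  by (intro continuous_intros continuous_snd cont continuous_along smooth_on_directional_derivative f)

lemma continuous_speed: "continuous_on W (\<lambda>p. speed (fst p) (snd p))"
  unfolding speed_def by (intro continuous_intros continuous_snd cont)

lemma continuous_speed': "continuous_on W (\<lambda>p. speed' (fst p) (snd p))"
  unfolding speed'_def
  by (intro continuous_intros continuous_snd cont continuous_speed) (use speed_nonzero in simp)

lemma continuous_sig: "continuous_on W (\<lambda>p. sig (fst p) (snd p))"
  unfolding sig_def flux_def
  by (intro continuous_intros continuous_snd cont continuous_speed continuous_along f1 f2) (use speed_nonzero in simp)

lemma continuous_sig': "continuous_on W (\<lambda>p. sig' (fst p) (snd p))"
  unfolding sig'_def flux_def flux'_def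
  by (intro continuous_intros continuous_snd cont continuous_speed continuous_speed' continuous_along continuous_along' f1 f2)
     (use speed_nonzero in simp)

lemma continuous_support: "continuous_on W (\<lambda>p. support (fst p) (snd p))"
  unfolding support_def by (intro continuous_intros continuous_snd cont)

lemma continuous_support': "continuous_on W (\<lambda>p. support' (fst p) (snd p))"
  unfolding support'_def by (intro continuous_intros continuous_snd cont)

lemma continuous_section:
  fixes h :: "real \<Rightarrow> real \<Rightarrow> real"
  assumes "continuous_on W (\<lambda>p. h (fst p) (snd p))" "\<bar>\<epsilon>\<bar> < \<eta>"
  shows "continuous_on {0..L} (h \<epsilon>)"
proof -
  have "continuous_on {0..L} (\<lambda>s. (\<epsilon>, s))" by (intro continuous_intros)
  moreover have "Pair \<epsilon> ` {0..L} \<subseteq> W" using assms(2) by (auto simp: abs_less_iff)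
  ultimately show ?thesis using continuous_on_compose2[OF assms(1)] by fastforce
qed

text \<open>The Leibniz rule on a fixed parameter interval, for which the joint continuity
  statements above were prepared; the factor 2 comes from the square of \<open>sig\<close>.\<close>

lemma DERIV_integral_sig_support:
  "DERIV (\<lambda>\<epsilon>. integral {0..L} (\<lambda>s. (sig \<epsilon> s)\<^sup>2 * support \<epsilon> s)) 0 :>
     2 * integral {0..L} (\<lambda>s. sig 0 s * sig' 0 s * support 0 s) + integral {0..L} (\<lambda>s. (sig 0 s)\<^sup>2 * support' 0 s)"
proof -
  let ?h = "\<lambda>\<epsilon> s. (sig \<epsilon> s)\<^sup>2 * support \<epsilon> s"
  let ?h' = "\<lambda>\<epsilon> s. 2 * (sig \<epsilon> s * sig' \<epsilon> s * support \<epsilon> s) + (sig \<epsilon> s)\<^sup>2 * support' \<epsilon> s"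
  have ch: "continuous_on W (\<lambda>p. ?h (fst p) (snd p))" and ch': "continuous_on W (\<lambda>p. ?h' (fst p) (snd p))"
    and c1: "continuous_on W (\<lambda>p. sig (fst p) (snd p) * sig' (fst p) (snd p) * support (fst p) (snd p))"
    and c2: "continuous_on W (\<lambda>p. (sig (fst p) (snd p))\<^sup>2 * support' (fst p) (snd p))"
    by (intro continuous_intros continuous_sig continuous_sig' continuous_support continuous_support')+
  have "((\<lambda>\<epsilon>. integral (cbox 0 L) (?h \<epsilon>)) has_field_derivative integral (cbox 0 L) (?h' 0)) (at 0 within {-\<eta><..<\<eta>})"
  proof (rule leibniz_rule_field_derivative)
    fix \<epsilon> s assume "\<epsilon> \<in> {-\<eta><..<\<eta>}" "s \<in> cbox 0 L"
    then have \<epsilon>: "\<bar>\<epsilon>\<bar> < \<eta>" and s: "s \<in> {0..L}" by auto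
    have "DERIV (\<lambda>\<epsilon>. ?h \<epsilon> s) \<epsilon> :> ?h' \<epsilon> s"
      unfolding power2_eq_square
      by (rule DERIV_cong[OF DERIV_mult[OF DERIV_mult[OF DERIV_sig[OF \<epsilon> s] DERIV_sig[OF \<epsilon> s]] DERIV_support]])
         (simp add: algebra_simps)
    then show "((\<lambda>\<epsilon>. ?h \<epsilon> s) has_field_derivative ?h' \<epsilon> s) (at \<epsilon> within {-\<eta><..<\<eta>})"
      by (rule has_field_derivative_at_within)
  next
    fix \<epsilon> assume "\<epsilon> \<in> {-\<eta><..<\<eta>}"
    then have "\<bar>\<epsilon>\<bar> < \<eta>" by auto
    from continuous_section[OF ch this]
    show "?h \<epsilon> integrable_on cbox 0 L"
      unfolding cbox_interval by (rule integrable_continuous_interval)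
  next
    show "continuous_on ({-\<eta><..<\<eta>} \<times> cbox 0 L) (\<lambda>(\<epsilon>, s). ?h' \<epsilon> s)"
      using ch' by (simp add: case_prod_beta)
  qed (use \<eta> in auto)
  then have "DERIV (\<lambda>\<epsilon>. integral {0..L} (?h \<epsilon>)) 0 :> integral {0..L} (?h' 0)"
    using \<eta> by (simp add: at_within_open[of 0 "{-\<eta><..<\<eta>}"])
  moreover have "integral {0..L} (?h' 0) =
     2 * integral {0..L} (\<lambda>s. sig 0 s * sig' 0 s * support 0 s) + integral {0..L} (\<lambda>s. (sig 0 s)\<^sup>2 * support' 0 s)"
    using \<eta> continuous_section[OF c1, of 0] continuous_section[OF c2, of 0]
    by (subst Henstock_Kurzweil_Integration.integral_add)
       (auto intro!: integrable_continuous_interval continuous_intros)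
  ultimately show ?thesis by simp
qed

end

section \<open>The variation formula\<close>

theorem lemma14:
  fixes L \<epsilon>\<^sub>0 :: real
    and \<gamma> V :: "real \<Rightarrow> complex"
    and \<Omega> :: "real \<Rightarrow> complex set"
    and u :: "real \<Rightarrow> complex \<Rightarrow> real"
    and k :: "real \<Rightarrow> real"
    and \<sigma> :: "real \<Rightarrow> real \<Rightarrow> real"
    and \<N> :: "real \<Rightarrow> real"
  assumes "0 < \<epsilon>\<^sub>0"
    and "smooth_regular_simple_closed L \<gamma>"
    and "smooth_periodic L V"
    and "\<And>\<epsilon>. \<bar>\<epsilon>\<bar> < \<epsilon>\<^sub>0 \<Longrightarrow> bounded_domain_with_boundary L (deformed_curve \<gamma> V \<epsilon>) (\<Omega> \<epsilon>)"
    and "counterclockwise_around L \<gamma> (\<Omega> 0)"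
    and "\<And>\<epsilon>. \<bar>\<epsilon>\<bar> < \<epsilon>\<^sub>0 \<Longrightarrow> 0 < k \<epsilon>"
    and "\<And>\<epsilon>. \<bar>\<epsilon>\<bar> < \<epsilon>\<^sub>0 \<Longrightarrow> dirichlet_eigenfunction (\<Omega> \<epsilon>) ((k \<epsilon>)\<^sup>2) (u \<epsilon>)"
    and "smooth_on k {-\<epsilon>\<^sub>0<..<\<epsilon>\<^sub>0}"
    and "smooth_up_to (\<lambda>(\<epsilon>, x). u \<epsilon> x) (SIGMA \<epsilon>:{-\<epsilon>\<^sub>0<..<\<epsilon>\<^sub>0}. closure (\<Omega> \<epsilon>))"
  defines "\<sigma> \<equiv> \<lambda>\<epsilon> s. - outward_derivative (u \<epsilon>) (deformed_curve \<gamma> V \<epsilon> s)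
                          (unit_normal (deformed_curve \<gamma> V \<epsilon>) s)"
    and "\<N> \<equiv> \<lambda>\<epsilon>. LINT x:\<Omega> \<epsilon>|lborel. (u \<epsilon> x)\<^sup>2"
  shows "(\<N> has_real_derivative
           - 2 * (deriv k 0 / k 0) * \<N> 0
           + 1 / (k 0)\<^sup>2 * arc_length_integral L \<gamma>
               (\<lambda>s. \<sigma> 0 s * deriv (\<lambda>\<epsilon>. \<sigma> \<epsilon> s) 0 * (\<gamma> s \<bullet> unit_normal \<gamma> s))
           + 1 / (2 * (k 0)\<^sup>2) * arc_length_integral L \<gamma>
               (\<lambda>s. (\<sigma> 0 s)\<^sup>2 *
                  (V s \<bullet> unit_normal \<gamma> s
                   + \<gamma> s \<bullet> clockwise_rotation (tangential_derivative \<gamma> V s)))) (at 0)"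
proof -
  have L: "0 < L" and per\<gamma>: "smooth_periodic L \<gamma>" and reg: "\<And>s. velocity \<gamma> s \<noteq> 0" and inj: "inj_on \<gamma> {0..<L}"
    using assms(2) by (auto simp: smooth_regular_simple_closed_def)
  have sm\<gamma>: "smooth_on \<gamma> UNIV" and p\<gamma>: "\<And>s. \<gamma> (s + L) = \<gamma> s"
    using per\<gamma> by (auto simp: smooth_periodic_def)
  have smV: "smooth_on V UNIV" and pV: "\<And>s. V (s + L) = V s"
    using assms(3) by (auto simp: smooth_periodic_def)
  note d = smooth_on_UNIV_velocity(1)[OF sm\<gamma>] smooth_on_UNIV_velocity(1)[OF smV]
  note c' = smooth_on_UNIV_velocity(2)[OF sm\<gamma>] smooth_on_UNIV_velocity(2)[OF smV]
  have c\<gamma>: "continuous_on S \<gamma>" and cV: "continuous_on S V" for S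
    using continuous_on_subset[OF smooth_on_continuous[OF sm\<gamma>]] continuous_on_subset[OF smooth_on_continuous[OF smV]] by auto
  obtain U g where U: "open U" "(SIGMA \<epsilon>:{-\<epsilon>\<^sub>0<..<\<epsilon>\<^sub>0}. closure (\<Omega> \<epsilon>)) \<subseteq> U" and g: "smooth_on g U"
    and gu': "\<forall>x\<in>(SIGMA \<epsilon>:{-\<epsilon>\<^sub>0<..<\<epsilon>\<^sub>0}. closure (\<Omega> \<epsilon>)). g x = (case x of (\<epsilon>, x) \<Rightarrow> u \<epsilon> x)"
    using assms(9) unfolding smooth_up_to_def by (elim exE conjE)
  have domU: "(\<epsilon>, z) \<in> U" and gu: "u \<epsilon> z = g (\<epsilon>, z)" if "\<bar>\<epsilon>\<bar> < \<epsilon>\<^sub>0" "z \<in> closure (\<Omega> \<epsilon>)" for \<epsilon> z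
    using that U(2) gu' by (auto simp: abs_less_iff)
  obtain \<eta>1 where \<eta>1_pos: "0 < \<eta>1" and \<eta>1': "\<forall>\<epsilon>. \<bar>\<epsilon>\<bar> < \<eta>1 \<longrightarrow>
      (\<forall>s\<in>{0..L}. velocity \<gamma> s + \<epsilon> *\<^sub>R velocity V s \<noteq> 0) \<and> inj_on (\<lambda>s. \<gamma> s + \<epsilon> *\<^sub>R V s) {0..<L}"
    using perturbed_closed_curve_injective[OF L d c' p\<gamma> pV reg inj] by (elim exE conjE)
  have \<eta>1: "\<And>s. s \<in> {0..L} \<Longrightarrow> velocity \<gamma> s + \<epsilon> *\<^sub>R velocity V s \<noteq> 0"
    "inj_on (\<lambda>s. \<gamma> s + \<epsilon> *\<^sub>R V s) {0..<L}" if "\<bar>\<epsilon>\<bar> < \<eta>1" for \<epsilon>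
    using \<eta>1' that by blast+
  have dc0: "deformed_curve \<gamma> V 0 = \<gamma>" by (simp add: deformed_curve_def[abs_def])
  have \<Omega>0: "open (\<Omega> 0)" "\<Omega> 0 \<noteq> {}" "frontier (\<Omega> 0) = \<gamma> ` {0..L}"
    using assms(4)[of 0] assms(1) by (auto simp: bounded_domain_with_boundary_def dc0)
  then obtain z0 where z0: "z0 \<in> \<Omega> 0" by blast
  have z0_curve: "z0 \<notin> \<gamma> ` {0..L}"
    using z0 \<Omega>0(1) unfolding \<Omega>0(3)[symmetric] by (simp add: frontier_def interior_open)
  have wn0: "winding_number (\<lambda>t. \<gamma> (L * t)) z0 = 1"
    using assms(5) z0 by (simp add: counterclockwise_around_def)
  obtain s1 where s1: "s1 \<in> {0..L}" "\<And>s. s \<in> {0..L} \<Longrightarrow> norm (\<gamma> s1 - z0) \<le> norm (\<gamma> s - z0)"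
    using continuous_attains_inf[OF compact_Icc, of 0 L "\<lambda>s. norm (\<gamma> s - z0)"] L
      continuous_on_norm[OF continuous_on_diff[OF c\<gamma> continuous_on_const]] by auto
  define \<rho> where "\<rho> = norm (\<gamma> s1 - z0)"
  have \<rho>: "0 < \<rho>" using s1(1) z0_curve by (auto simp: \<rho>_def)
  have "bounded (V ` {0..L})"
    by (intro compact_imp_bounded compact_continuous_image cV compact_Icc)
  then obtain M where M: "0 < M" "\<And>s. s \<in> {0..L} \<Longrightarrow> norm (V s) \<le> M"
    unfolding bounded_pos by blast
  \<comment> \<open>Below the first bound the domains are given, below the second the curve stays
    regular and simple, and below the third no curve point moves as far as its distance from
    \<open>z0\<close>.\<close>
  define \<eta> where "\<eta> = min \<epsilon>\<^sub>0 (min \<eta>1 (\<rho> / M))"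
  have eta: "0 < \<eta>" "\<eta> \<le> \<epsilon>\<^sub>0" "\<eta> \<le> \<eta>1" "\<eta> \<le> \<rho> / M"
    using assms(1) \<eta>1_pos \<rho> M(1) by (simp_all add: \<eta>_def min_le_iff_disj)
  have near: "norm (deformed_curve \<gamma> V \<epsilon> s - \<gamma> s) < norm (\<gamma> s - z0)" if "\<bar>\<epsilon>\<bar> < \<eta>" "s \<in> {0..L}" for \<epsilon> s
  proof -
    have "norm (deformed_curve \<gamma> V \<epsilon> s - \<gamma> s) = \<bar>\<epsilon>\<bar> * norm (V s)" by (simp add: deformed_curve_def)
    also have "\<dots> \<le> \<bar>\<epsilon>\<bar> * M" using M(2)[OF that(2)] by (intro mult_left_mono) auto
    also have "\<dots> < \<rho>" using less_le_trans[OF that(1) eta(4)] by (simp add: pos_less_divide_eq[OF M(1)])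
    also have "\<dots> \<le> norm (\<gamma> s - z0)" using s1(2)[OF that(2)] by (simp add: \<rho>_def)
    finally show ?thesis .
  qed
  have dom: "smooth_Jordan_domain L (deformed_curve \<gamma> V \<epsilon>) (\<lambda>s. velocity \<gamma> s + \<epsilon> *\<^sub>R velocity V s) (\<Omega> \<epsilon>)"
    if \<epsilon>: "\<bar>\<epsilon>\<bar> < \<eta>" for \<epsilon>
  proof (rule smooth_Jordan_domainI[OF L])
    show "(deformed_curve \<gamma> V \<epsilon> has_vector_derivative velocity \<gamma> s + \<epsilon> *\<^sub>R velocity V s) (at s)" for s
      by (rule velocity_deformed_curve(2)[OF sm\<gamma> smV])
    show "continuous_on UNIV (\<lambda>s. velocity \<gamma> s + \<epsilon> *\<^sub>R velocity V s)"
      by (intro continuous_intros c')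
    show "velocity \<gamma> s + \<epsilon> *\<^sub>R velocity V s \<noteq> 0" if "s \<in> {0..L}" for s
      using \<eta>1(1)[OF _ that, of \<epsilon>] \<epsilon> eta(3) by simp
    show "inj_on (deformed_curve \<gamma> V \<epsilon>) {0..<L}"
      using \<eta>1(2)[of \<epsilon>] \<epsilon> eta(3) by (simp add: deformed_curve_def[abs_def])
    show cl: "deformed_curve \<gamma> V \<epsilon> L = deformed_curve \<gamma> V \<epsilon> 0"
      using p\<gamma>[of 0] pV[of 0] by (simp add: deformed_curve_def)
    show "velocity \<gamma> L + \<epsilon> *\<^sub>R velocity V L = velocity \<gamma> 0 + \<epsilon> *\<^sub>R velocity V 0"
      using velocity_periodic[OF per\<gamma>, of 0] velocity_periodic[OF assms(3), of 0] by simp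
    show "bounded_domain_with_boundary L (deformed_curve \<gamma> V \<epsilon>) (\<Omega> \<epsilon>)"
      using assms(4) \<epsilon> eta(2) by simp
    show "z0 \<notin> deformed_curve \<gamma> V \<epsilon> ` {0..L}"
      using near[OF \<epsilon>] by (force simp: norm_minus_commute)
    have Lt: "L * t \<in> {0..L}" if "t \<in> {0..1}" for t
      using that L by (simp add: mult_le_cancel_left1)
    \<comment> \<open>Each point moves by less than its distance from \<open>z0\<close>, so the
      straight-line homotopy avoids \<open>z0\<close>; thus the orientation known at \<epsilon> = 0
      is inherited.\<close>
    have "winding_number (\<lambda>t. deformed_curve \<gamma> V \<epsilon> (L * t)) z0 = winding_number (\<lambda>t. \<gamma> (L * t)) z0"
    proof (rule winding_number_nearby_loops_eq)
      show "path (\<lambda>t. \<gamma> (L * t))"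
        unfolding path_def by (intro continuous_on_compose2[OF c\<gamma>] continuous_intros) auto
      show "path (\<lambda>t. deformed_curve \<gamma> V \<epsilon> (L * t))"
        unfolding path_def deformed_curve_def
        by (intro continuous_intros continuous_on_compose2[OF c\<gamma>] continuous_on_compose2[OF cV]) auto
    qed (use cl p\<gamma>[of 0] near[OF \<epsilon>] Lt in \<open>simp_all add: pathfinish_def pathstart_def\<close>)
    with wn0 show "winding_number (\<lambda>t. deformed_curve \<gamma> V \<epsilon> (L * t)) z0 = 1" by simp
  qed
  define g1 where "g1 x = frechet_derivative g (at x) (0, 1)" for x
  define g2 where "g2 x = frechet_derivative g (at x) (0, \<i>)" for x
  have g12: "smooth_on g1 U" "smooth_on g2 U"
    unfolding g1_def[abs_def] g2_def[abs_def] by (rule smooth_on_directional_derivative[OF g])+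
  have curve_closure: "\<gamma> s + \<epsilon> *\<^sub>R V s \<in> closure (\<Omega> \<epsilon>)" if "\<bar>\<epsilon>\<bar> < \<eta>" "s \<in> {0..L}" for \<epsilon> s
    using smooth_Jordan_domain.curve_in_closure[OF dom[OF that(1)] that(2)] unfolding deformed_curve_def .
  interpret smooth_deformation L \<eta> \<gamma> "velocity \<gamma>" V "velocity V" U g1 g2
  proof
    show "(\<epsilon>, \<gamma> s + \<epsilon> *\<^sub>R V s) \<in> U" if "\<bar>\<epsilon>\<bar> < \<eta>" "s \<in> {0..L}" for \<epsilon> s
      using domU[OF _ curve_closure[OF that]] that(1) eta(2) by simp
    show "velocity \<gamma> s + \<epsilon> *\<^sub>R velocity V s \<noteq> 0" if "\<bar>\<epsilon>\<bar> < \<eta>" "s \<in> {0..L}" for \<epsilon> s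
      using \<eta>1(1)[OF _ that(2), of \<epsilon>] that(1) eta(3) by simp
  qed (use eta(1) c\<gamma> cV c' g12 in auto)
  have slice: "C1_on {z. (\<epsilon>, z) \<in> U} (\<lambda>z. g (\<epsilon>, z)) (\<lambda>z. g1 (\<epsilon>, z)) (\<lambda>z. g2 (\<epsilon>, z))" for \<epsilon>
    unfolding g1_def g2_def by (rule smooth_on_slice_C1_on[OF g])
  note slice1 = smooth_on_slice_C1_on[OF g12(1)] and slice2 = smooth_on_slice_C1_on[OF g12(2)]
  \<comment> \<open>This holds for all \<epsilon> near 0 and not merely at 0, so it also determines
    the \<epsilon>-derivative of \<open>\<sigma>\<close>.\<close>
  have \<sigma>_eq: "\<sigma> \<epsilon> s = sig \<epsilon> s" if \<epsilon>: "\<bar>\<epsilon>\<bar> < \<eta>" and s: "s \<in> {0..L}" for \<epsilon> s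
  proof -
    interpret dom: smooth_Jordan_domain L "deformed_curve \<gamma> V \<epsilon>" "\<lambda>s. velocity \<gamma> s + \<epsilon> *\<^sub>R velocity V s" "\<Omega> \<epsilon>"
      by (rule dom[OF \<epsilon>])
    let ?w = "velocity \<gamma> s + \<epsilon> *\<^sub>R velocity V s"
    let ?c = "deformed_curve \<gamma> V \<epsilon> s"
    have "?c \<in> {z. (\<epsilon>, z) \<in> U}" using domU \<epsilon> eta(2) dom.curve_in_closure[OF s] by simp
    note dg = C1_onD[OF slice this]
    have "unit_normal (deformed_curve \<gamma> V \<epsilon>) s = - \<i> * (?w /\<^sub>R norm ?w)"
      unfolding unit_normal_def unit_tangent_def clockwise_rotation_def velocity_deformed_curve(1)[OF sm\<gamma> smV] ..
    then have "\<sigma> \<epsilon> s = - (Re (- \<i> * (?w /\<^sub>R norm ?w)) * g1 (\<epsilon>, ?c) + Im (- \<i> * (?w /\<^sub>R norm ?w)) * g2 (\<epsilon>, ?c))"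
      using dom.outward_derivative_eq[OF s dg, of "u \<epsilon>"] gu \<epsilon> eta(2) unfolding assms(10) by simp
    also have "\<dots> = sig \<epsilon> s"
      unfolding sig_def flux_def speed_def along_def deformed_curve_def
      by (simp add: divide_inverse algebra_simps)
    finally show ?thesis .
  qed
  \<comment> \<open>Rellich's identity for the slice of the extension at \<epsilon>, solved for the
    norm; this uses that \<open>k \<epsilon>\<close> is positive.\<close>
  have \<N>_eq: "\<N> \<epsilon> = integral {0..L} (\<lambda>s. (sig \<epsilon> s)\<^sup>2 * support \<epsilon> s) / (2 * (k \<epsilon>)\<^sup>2)" if \<epsilon>: "\<bar>\<epsilon>\<bar> < \<eta>" for \<epsilon>
  proof -
    interpret dom: smooth_Jordan_domain L "deformed_curve \<gamma> V \<epsilon>" "\<lambda>s. velocity \<gamma> s + \<epsilon> *\<^sub>R velocity V s" "\<Omega> \<epsilon>"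
      by (rule dom[OF \<epsilon>])
    have \<epsilon>0: "\<bar>\<epsilon>\<bar> < \<epsilon>\<^sub>0" using \<epsilon> eta(2) by simp
    note ef = assms(7)[OF \<epsilon>0, unfolded dirichlet_eigenfunction_def]
    let ?U = "{z. (\<epsilon>, z) \<in> U}"
    have oU: "open ?U"
    proof -
      have "?U = Pair \<epsilon> -` U" by auto
      then show ?thesis using U(1) by (simp add: open_vimage continuous_intros)
    qed
    have cU: "closure (\<Omega> \<epsilon>) \<subseteq> ?U" using domU[OF \<epsilon>0] by blast
    then have \<Omega>U: "\<Omega> \<epsilon> \<subseteq> ?U" using closure_subset by blast
    have eq: "frechet_derivative g1 (at (\<epsilon>, z)) (0, 1) + frechet_derivative g2 (at (\<epsilon>, z)) (0, \<i>) + (k \<epsilon>)\<^sup>2 * g (\<epsilon>, z) = 0"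
      if z: "z \<in> \<Omega> \<epsilon>" for z
    proof -
      have uz: "u \<epsilon> z = g (\<epsilon>, z)" if "z \<in> \<Omega> \<epsilon>" for z
        using gu[OF \<epsilon>0] that closure_subset by blast
      have "laplacian (u \<epsilon>) z = frechet_derivative g1 (at (\<epsilon>, z)) (0, 1) + frechet_derivative g2 (at (\<epsilon>, z)) (0, \<i>)"
        by (rule laplacian_eq_C1_on[OF dom.D(1) z C1_on_subset[OF slice \<Omega>U] C1_on_subset[OF slice1 \<Omega>U]
              C1_on_subset[OF slice2 \<Omega>U] uz])
      then show ?thesis using ef z uz[OF z] by metis
    qed
    have g0: "g (\<epsilon>, deformed_curve \<gamma> V \<epsilon> s) = 0" if s: "s \<in> {0..L}" for s
    proof -
      have "deformed_curve \<gamma> V \<epsilon> s \<in> frontier (\<Omega> \<epsilon>)" using dom.D(3) s by blast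
      then have "u \<epsilon> (deformed_curve \<gamma> V \<epsilon> s) = 0" using ef by blast
      then show ?thesis using gu[OF \<epsilon>0 dom.curve_in_closure[OF s]] by simp
    qed
    have int_eq: "(LINT z:\<Omega> \<epsilon>|lborel. (g (\<epsilon>, z))\<^sup>2) = \<N> \<epsilon>"
    proof -
      have "indicator (\<Omega> \<epsilon>) z *\<^sub>R (g (\<epsilon>, z))\<^sup>2 = indicator (\<Omega> \<epsilon>) z *\<^sub>R (u \<epsilon> z)\<^sup>2" for z
      proof (cases "z \<in> \<Omega> \<epsilon>")
        case True
        then have "z \<in> closure (\<Omega> \<epsilon>)" using closure_subset by blast
        then show ?thesis using gu[OF \<epsilon>0] by simp
      qed simp
      then show ?thesis unfolding assms(11) set_lebesgue_integral_def by (simp only:)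
    qed
    have "((\<lambda>s. (sig \<epsilon> s)\<^sup>2 * support \<epsilon> s) has_integral 2 * (k \<epsilon>)\<^sup>2 * (LINT z:\<Omega> \<epsilon>|lborel. (g (\<epsilon>, z))\<^sup>2)) {0..L}"
      by (rule has_integral_eq[OF _ dom.Rellich_identity[OF oU cU slice slice1 slice2 eq g0]])
         (simp add: sig_def flux_def speed_def along_def support_def deformed_curve_def power_divide)
    then have "integral {0..L} (\<lambda>s. (sig \<epsilon> s)\<^sup>2 * support \<epsilon> s) = 2 * (k \<epsilon>)\<^sup>2 * \<N> \<epsilon>"
      unfolding int_eq by (rule integral_unique)
    then show ?thesis using assms(6)[OF \<epsilon>0] by simp
  qed
  have k0: "0 < k 0" using assms(1,6) by simp
  have dk: "DERIV k 0 :> deriv k 0"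
  proof -
    have "k differentiable (at 0)"
      using smooth_on_has_derivative[OF assms(8), of 0] assms(1) by (auto intro: differentiableI)
    then obtain D where "DERIV k 0 :> D" unfolding real_differentiable_def by blast
    then show ?thesis using DERIV_imp_deriv by metis
  qed
  define J where "J \<epsilon> = integral {0..L} (\<lambda>s. (sig \<epsilon> s)\<^sup>2 * support \<epsilon> s)" for \<epsilon>
  define I1 where "I1 = integral {0..L} (\<lambda>s. sig 0 s * sig' 0 s * support 0 s)"
  define I2 where "I2 = integral {0..L} (\<lambda>s. (sig 0 s)\<^sup>2 * support' 0 s)"
  have dJ: "DERIV J 0 :> 2 * I1 + I2"
    unfolding J_def[abs_def] I1_def I2_def by (rule DERIV_integral_sig_support)
  have dk2: "DERIV (\<lambda>\<epsilon>. 2 * (k \<epsilon>)\<^sup>2) 0 :> 4 * k 0 * deriv k 0"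
    by (rule DERIV_cong[OF DERIV_cmult[OF DERIV_power[OF dk, of 2], of 2]]) simp
  have "2 * (k 0)\<^sup>2 \<noteq> 0" using k0 by simp
  note dq = DERIV_divide[OF dJ dk2 this]
  \<comment> \<open>Agreement of \<open>\<N>\<close> with the quotient on an open interval around 0
    suffices for the derivative there.\<close>
  have "DERIV \<N> 0 :> ((2 * I1 + I2) * (2 * (k 0)\<^sup>2) - J 0 * (4 * k 0 * deriv k 0)) / (2 * (k 0)\<^sup>2 * (2 * (k 0)\<^sup>2))"
    by (rule has_field_derivative_transform_within_open[OF dq, of "{-\<eta><..<\<eta>}"])
       (use eta(1) \<N>_eq in \<open>auto simp: J_def abs_less_iff\<close>)
  moreover have "((2 * I1 + I2) * (2 * (k 0)\<^sup>2) - J 0 * (4 * k 0 * deriv k 0)) / (2 * (k 0)\<^sup>2 * (2 * (k 0)\<^sup>2))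
      = - 2 * (deriv k 0 / k 0) * \<N> 0 + 1 / (k 0)\<^sup>2 * I1 + 1 / (2 * (k 0)\<^sup>2) * I2"
  proof -
    \<comment> \<open>Rellich's identity at 0, used in reverse: it turns the term from
      differentiating \<open>k\<close> back into a multiple of the norm.\<close>
    have J0: "J 0 = 2 * (k 0)\<^sup>2 * \<N> 0" using \<N>_eq[of 0] eta(1) k0 by (simp add: J_def)
    show ?thesis unfolding J0 using k0 by (simp add: field_simps power2_eq_square)
  qed
  moreover have "I1 = arc_length_integral L \<gamma> (\<lambda>s. \<sigma> 0 s * deriv (\<lambda>\<epsilon>. \<sigma> \<epsilon> s) 0 * (\<gamma> s \<bullet> unit_normal \<gamma> s))"
    unfolding I1_def arc_length_integral_def
  proof (rule Henstock_Kurzweil_Integration.integral_cong)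
    fix s assume s: "s \<in> {0..L}"
    have "DERIV (\<lambda>\<epsilon>. \<sigma> \<epsilon> s) 0 :> sig' 0 s"
      by (rule has_field_derivative_transform_within_open[OF DERIV_sig[OF _ s], of 0 "{-\<eta><..<\<eta>}"])
         (use eta(1) \<sigma>_eq s in \<open>auto simp: abs_less_iff\<close>)
    then have "deriv (\<lambda>\<epsilon>. \<sigma> \<epsilon> s) 0 = sig' 0 s" by (rule DERIV_imp_deriv)
    \<comment> \<open>The arc-length factor cancels the normalisation of the unit normal.\<close>
    moreover have "(\<gamma> s \<bullet> unit_normal \<gamma> s) * norm (velocity \<gamma> s) = support 0 s"
      using reg[of s] by (simp add: unit_normal_def unit_tangent_def clockwise_rotation_def support_def
        inner_complex_def field_simps)
    ultimately show "sig 0 s * sig' 0 s * support 0 s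
        = \<sigma> 0 s * deriv (\<lambda>\<epsilon>. \<sigma> \<epsilon> s) 0 * (\<gamma> s \<bullet> unit_normal \<gamma> s) * norm (velocity \<gamma> s)"
      using \<sigma>_eq[OF _ s, of 0] eta(1) by (simp add: mult.assoc)
  qed
  moreover have "I2 = arc_length_integral L \<gamma> (\<lambda>s. (\<sigma> 0 s)\<^sup>2 *
      (V s \<bullet> unit_normal \<gamma> s + \<gamma> s \<bullet> clockwise_rotation (tangential_derivative \<gamma> V s)))"
    unfolding I2_def arc_length_integral_def
  proof (rule Henstock_Kurzweil_Integration.integral_cong)
    fix s assume s: "s \<in> {0..L}"
    \<comment> \<open>The same cancellation for both summands: the speed also divides the velocity
      of \<open>V\<close> in the tangential derivative.\<close>
    have "(V s \<bullet> unit_normal \<gamma> s + \<gamma> s \<bullet> clockwise_rotation (tangential_derivative \<gamma> V s)) * norm (velocity \<gamma> s)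
        = support' 0 s"
      using reg[of s] by (simp add: unit_normal_def unit_tangent_def tangential_derivative_def clockwise_rotation_def
        support'_def inner_complex_def field_simps)
    then show "(sig 0 s)\<^sup>2 * support' 0 s = (\<sigma> 0 s)\<^sup>2 *
      (V s \<bullet> unit_normal \<gamma> s + \<gamma> s \<bullet> clockwise_rotation (tangential_derivative \<gamma> V s)) * norm (velocity \<gamma> s)"
      using \<sigma>_eq[OF _ s, of 0] eta(1) by (simp add: mult.assoc)
  qed
  ultimately show ?thesis by simp
qed

end
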